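(* Let $r>0$, and let $\Gamma\subset\mathrm{PSL}_2(\mathbb{R})$ be a finite covolume Fuchsian group. If a measurable set $I\subseteq\mathbb{H}$ is distance $r$ avoiding and $\Gamma$-invariant, then $$\mu(\Gamma\backslash I)\leq (r+1)e^{-\frac{r}{2}}\,\mu(\Gamma\backslash\mathbb{H}).$$
   Context: $\mathbb{H}=\{z=x+iy\in\mathbb{C} : y>0\}$ is the hyperbolic plane with metric $(ds)^2=\frac{(dx)^2+(dy)^2}{y^2}$ (constant curvature $-1$), and $\mu$ is the standard hyperbolic area measure. The group $\mathrm{PSL}_2(\mathbb{R})$ acts on $\mathbb{H}$ by Möbius transformations, which are the orientation-preserving isometries. A Fuchsian group is a discrete subgroup $\Gamma\subset\mathrm{PSL}_2(\mathbb{R})$. A fundamental region for $\Gamma$ is a closed set $F\subseteq\mathbb{H}$ that is the closure of a non-empty open set $F_0$, with $\mu(F\setminus F_0)=0$, such that $\bigcup_{\gamma\in\Gamma}\gamma F=\mathbb{H}$ and $F_0\cap\gamma F_0=\emptyset$ for all $1\ne\gamma\in\Gamma$. The value $\mu(F)$ does not depend on the choice of $F$ and is denoted $\mu(\Gamma\backslash\mathbb{H})$; $\Gamma$ is called finite covolume if this is finite. A measurable set $I\subseteq\mathbb{H}$ is $\Gamma$-invariant if $\mu(I\triangle\gamma I)=0$ for every $\gamma\in\Gamma$; for such $I$, $\mu(\Gamma\backslash I):=\mu(I\cap F)$ for a fundamental region $F$ of $\Gamma$ (independent of the choice of $F$). A set $I\subseteq\mathbb{H}$ is distance $r$ avoiding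 if no two points of $I$ are at hyperbolic distance exactly $r$ from each other. *)

theory Defs
  imports "HOL-Analysis.Analysis" "HOL-Algebra.Coset"
begin

section \<open>The hyperbolic plane\<close>

definition upper_half_plane :: "complex set" where
  "upper_half_plane = {z. Im z > 0}"

text \<open>
  The distance induced by the metric \<open>ds\<^sup>2 = (dx\<^sup>2 + dy\<^sup>2) / y\<^sup>2\<close>: the infimum of the lengths of
  piecewise \<open>C\<^sup>1\<close> curves.  A \<^const>\<open>valid_path\<close> may have an unbounded derivative near its finitely
  many exceptional points, hence infinite length.  Lengths are therefore given by the relation
  \<^const>\<open>has_integral\<close>, since the function \<^const>\<open>integral\<close> would return \<open>0\<close> for such a curve.
\<close>

definition has_hyp_length :: "(real \<Rightarrow> complex) \<Rightarrow> real \<Rightarrow> bool" where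
  "has_hyp_length g l \<longleftrightarrow>
     ((\<lambda>t. norm (vector_derivative g (at t)) / Im (g t)) has_integral l) {0..1}"

definition hyp_dist :: "complex \<Rightarrow> complex \<Rightarrow> real" where
  "hyp_dist z w = Inf {l. \<exists>g. valid_path g \<and> path_image g \<subseteq> upper_half_plane \<and>
     pathstart g = z \<and> pathfinish g = w \<and> has_hyp_length g l}"

text \<open>
  The area form \<open>dx dy / y\<^sup>2\<close>.  The measurable sets are the Lebesgue measurable subsets of the upper
  half-plane, so in particular all its Borel subsets.
\<close>

definition hyp_area :: "complex measure" where
  "hyp_area = density (lebesgue_on upper_half_plane) (\<lambda>z. ennreal (1 / (Im z)\<^sup>2))"

definition distance_avoiding :: "real \<Rightarrow> complex set \<Rightarrow> bool" where
  "distance_avoiding r I \<longleftrightarrow> (\<forall>x\<in>I. \<forall>y\<in>I. hyp_dist x y \<noteq> r)"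


section \<open>The group \<open>PSL\<^sub>2(\<real>)\<close> and its action\<close>

definition SL2R :: "(real^2^2) monoid" where
  "SL2R = \<lparr>carrier = {A. det A = 1}, mult = (**), one = mat 1\<rparr>"

definition PSL2R :: "(real^2^2) set monoid" where
  "PSL2R = SL2R Mod {mat 1, - mat 1}"

definition PSL2R_topology :: "(real^2^2) set topology" where
  "PSL2R_topology = topology (\<lambda>U. U \<subseteq> carrier PSL2R \<and> openin (top_of_set (carrier SL2R)) (\<Union>U))"

definition mobius :: "real^2^2 \<Rightarrow> complex \<Rightarrow> complex" where
  "mobius A z = (of_real (A$1$1) * z + of_real (A$1$2)) / (of_real (A$2$1) * z + of_real (A$2$2))"

text \<open>The action of a class does not depend on the representative, see \<open>psl_act_eq\<close> below.\<close>

definition psl_act :: "(real^2^2) set \<Rightarrow> complex \<Rightarrow> complex" where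
  "psl_act \<gamma> z = mobius (SOME A. A \<in> \<gamma>) z"

definition fuchsian :: "(real^2^2) set set \<Rightarrow> bool" where
  "fuchsian \<Gamma> \<longleftrightarrow> subgroup \<Gamma> PSL2R \<and> subtopology PSL2R_topology \<Gamma> = discrete_topology \<Gamma>"


section \<open>Fundamental regions and covolume\<close>

definition fundamental_region :: "(real^2^2) set set \<Rightarrow> complex set \<Rightarrow> bool" where
  "fundamental_region \<Gamma> F \<longleftrightarrow>
     (\<exists>F0. open F0 \<and> F0 \<noteq> {} \<and> F0 \<subseteq> upper_half_plane \<and>
        F = closure F0 \<inter> upper_half_plane \<and>
        F - F0 \<in> null_sets hyp_area \<and>
        (\<Union>\<gamma>\<in>\<Gamma>. psl_act \<gamma> ` F) = upper_half_plane \<and>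
        (\<forall>\<gamma>\<in>\<Gamma>. \<gamma> \<noteq> \<one>\<^bsub>PSL2R\<^esub> \<longrightarrow> F0 \<inter> psl_act \<gamma> ` F0 = {}))"

definition finite_covolume_fuchsian :: "(real^2^2) set set \<Rightarrow> bool" where
  "finite_covolume_fuchsian \<Gamma> \<longleftrightarrow>
     fuchsian \<Gamma> \<and> (\<exists>F. fundamental_region \<Gamma> F \<and> emeasure hyp_area F < \<infinity>)"

definition invariant_set :: "(real^2^2) set set \<Rightarrow> complex set \<Rightarrow> bool" where
  "invariant_set \<Gamma> I \<longleftrightarrow> (\<forall>\<gamma>\<in>\<Gamma>. sym_diff I (psl_act \<gamma> ` I) \<in> null_sets hyp_area)"

text \<open>
  The area of the quotient of an invariant measurable set \<open>I\<close> by \<open>\<Gamma>\<close>; it does not depend on the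
  fundamental region chosen.  With \<open>I = upper_half_plane\<close> this is the covolume of \<open>\<Gamma>\<close>.
\<close>

definition quotient_area :: "(real^2^2) set set \<Rightarrow> complex set \<Rightarrow> ennreal" where
  "quotient_area \<Gamma> I = emeasure hyp_area (I \<inter> (SOME F. fundamental_region \<Gamma> F))"


section \<open>Well-definedness\<close>

lemma matrix_mult_uminus:
  fixes A B :: "real^2^2"
  shows "(- A) ** B = - (A ** B)" "A ** (- B) = - (A ** B)"
  by (simp_all add: matrix_matrix_mult_def vec_eq_iff sum_negf)

lemma group_SL2R: "group SL2R"
proof (rule groupI)
  fix A assume A: "A \<in> carrier SL2R"
  then have "invertible A" by (simp add: SL2R_def invertible_det_nz)
  then obtain B where B: "B ** A = mat 1" unfolding invertible_def by blast
  from A have "det B = 1" using det_mul[of B A] B by (simp add: SL2R_def)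
  with B show "\<exists>B\<in>carrier SL2R. B \<otimes>\<^bsub>SL2R\<^esub> A = \<one>\<^bsub>SL2R\<^esub>" by (auto simp: SL2R_def)
qed (auto simp: SL2R_def det_mul matrix_mul_assoc)

lemma normal_center: "normal {mat 1, - mat 1} SL2R"
proof -
  interpret group SL2R by (rule group_SL2R)
  have det: "det (- mat 1 :: real^2^2) = 1" by (simp add: det_2 mat_def)
  have inv: "inv\<^bsub>SL2R\<^esub> (- mat 1) = - mat 1"
    by (rule inv_equality) (use det in \<open>auto simp: SL2R_def matrix_mult_uminus\<close>)
  have one: "\<one>\<^bsub>SL2R\<^esub> = mat 1" by (simp add: SL2R_def)
  have "subgroup {mat 1, - mat 1} SL2R"
  proof (rule subgroupI)
    show "{mat 1, - mat 1} \<subseteq> carrier SL2R" using det by (simp add: SL2R_def)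
  next
    fix A assume "A \<in> {mat 1, - mat 1 :: real^2^2}"
    then show "inv\<^bsub>SL2R\<^esub> A \<in> {mat 1, - mat 1}" using inv inv_one one by force
  next
    fix A B assume "A \<in> {mat 1, - mat 1 :: real^2^2}" "B \<in> {mat 1, - mat 1 :: real^2^2}"
    then show "A \<otimes>\<^bsub>SL2R\<^esub> B \<in> {mat 1, - mat 1}"
      by (elim insertE emptyE) (simp_all add: SL2R_def matrix_mult_uminus)
  qed simp
  then show ?thesis
    by (rule normalI) (auto simp: SL2R_def r_coset_def l_coset_def matrix_mult_uminus)
qed

lemma group_PSL2R: "group PSL2R"
  unfolding PSL2R_def by (rule normal.factorgroup_is_group[OF normal_center])

lemma carrier_PSL2R: "carrier PSL2R = {{A, - A} |A. det A = 1}"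
  by (auto simp: PSL2R_def FactGroup_def RCOSETS_def r_coset_def SL2R_def matrix_mult_uminus)

lemma PSL2R_class_eq:
  assumes "\<gamma> \<in> carrier PSL2R" "A \<in> \<gamma>"
  shows "\<gamma> = {A, - A}"
proof -
  obtain B where "\<gamma> = {B, - B}" using assms(1) carrier_PSL2R by blast
  with assms(2) consider "\<gamma> = {B, - B}" "A = B" | "\<gamma> = {B, - B}" "A = - B" by blast
  then show ?thesis by cases (simp_all add: insert_commute)
qed

lemma mobius_uminus: "mobius (- A) z = mobius A z"
proof -
  have "mobius (- A) z = (- (of_real (A$1$1) * z + of_real (A$1$2))) /
      (- (of_real (A$2$1) * z + of_real (A$2$2)))"
    by (simp add: mobius_def)
  then show ?thesis unfolding minus_divide_divide mobius_def .
qed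

lemma psl_act_eq:
  assumes "\<gamma> \<in> carrier PSL2R" "A \<in> \<gamma>"
  shows "psl_act \<gamma> z = mobius A z"
proof -
  have "(SOME B. B \<in> \<gamma>) \<in> \<gamma>" using assms(2) by (rule someI)
  then have "(SOME B. B \<in> \<gamma>) = A \<or> (SOME B. B \<in> \<gamma>) = - A"
    using PSL2R_class_eq[OF assms] by simp
  then show ?thesis unfolding psl_act_def by (elim disjE) (simp_all add: mobius_uminus)
qed

lemma openin_PSL2R_topology:
  "openin PSL2R_topology U \<longleftrightarrow>
     U \<subseteq> carrier PSL2R \<and> openin (top_of_set (carrier SL2R)) (\<Union>U)"
proof -
  have disj: "\<gamma> = \<delta>"
    if "\<gamma> \<in> carrier PSL2R" "\<delta> \<in> carrier PSL2R" "A \<in> \<gamma>" "A \<in> \<delta>" for \<gamma> \<delta> A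
    using PSL2R_class_eq[OF that(1,3)] PSL2R_class_eq[OF that(2,4)] by simp
  have "istopology (\<lambda>U. U \<subseteq> carrier PSL2R \<and> openin (top_of_set (carrier SL2R)) (\<Union>U))"
    unfolding istopology_def
  proof (intro conjI allI impI)
    fix S T
    assume S: "S \<subseteq> carrier PSL2R \<and> openin (top_of_set (carrier SL2R)) (\<Union>S)"
      and T: "T \<subseteq> carrier PSL2R \<and> openin (top_of_set (carrier SL2R)) (\<Union>T)"
    have "\<Union>(S \<inter> T) = \<Union>S \<inter> \<Union>T"
    proof (rule Set.set_eqI)
      fix A
      show "A \<in> \<Union>(S \<inter> T) \<longleftrightarrow> A \<in> \<Union>S \<inter> \<Union>T"
        using disj S T by blast
    qed
    with S T show "openin (top_of_set (carrier SL2R)) (\<Union>(S \<inter> T))"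
      by (simp add: openin_Int)
    show "S \<inter> T \<subseteq> carrier PSL2R" using S by blast
  next
    fix K
    assume K: "\<forall>U\<in>K. U \<subseteq> carrier PSL2R \<and> openin (top_of_set (carrier SL2R)) (\<Union>U)"
    then show "\<Union>K \<subseteq> carrier PSL2R" by blast
    have "\<Union>(\<Union>K) = \<Union>((\<lambda>U. \<Union>U) ` K)" by blast
    moreover have "openin (top_of_set (carrier SL2R)) (\<Union>((\<lambda>U. \<Union>U) ` K))"
      by (rule openin_Union) (use K in blast)
    ultimately show "openin (top_of_set (carrier SL2R)) (\<Union>(\<Union>K))" by simp
  qed
  then show ?thesis unfolding PSL2R_topology_def by simp
qed

end

theory Submission
  imports Defs "HOL-Real_Asymp.Real_Asymp"
begin

text \<open>
  Write \<open>u(z,w) = |z - w|\<^sup>2 / (Im z Im w)\<close>, which is \<open>2 cosh d(z,w) - 2\<close>, and \<open>gap s = 2 cosh s - 2\<close>.  The theorem is a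
  ratio bound of Hoffman type for the operator \<open>T\<close> that averages over hyperbolic circles of radius \<open>r\<close>.
  Let \<open>f\<close> be the indicator function of \<open>I\<close> minus its mean \<open>\<delta>\<close> over the quotient.  Avoiding the distance \<open>r\<close> means
  \<open>\<langle>T 1\<^sub>I, 1\<^sub>I\<rangle> = 0\<close>, so \<open>\<langle>T f, f\<rangle>\<close> is \<open>- \<delta>\<^sup>2\<close> times the covolume.  Hence a lower bound \<open>T \<ge> - \<phi>(r)\<close> yields
  \<open>\<delta>\<^sup>2 \<le> \<phi>(r) \<delta> (1 - \<delta>)\<close> and so \<open>\<delta> \<le> \<phi>(r)\<close>.  The lower bound holds with the spherical function
  \<open>\<phi>(r) = (2/\<pi>) \<integral>\<^sub>0\<^sup>r ds / sqrt (gap r - gap s)\<close>, which is less than \<open>(r + 1) exp (- r/2)\<close> for \<open>r \<ge> 2\<close>; for \<open>r < 2\<close>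
  the constant in the theorem is at least \<open>1\<close>.

  Why the lower bound holds: put \<open>A = sqrt (- \<Delta> - 1/4)\<close>, where \<open>\<Delta>\<close> is the Laplace operator.  Then \<open>T\<close> is the integral
  of \<open>cos (s A)\<close> against the density \<open>(2/\<pi>) / sqrt (gap r - gap s)\<close> on \<open>0 < s < r\<close>, and \<open>1 + cos (s A) = 2 cos\<^sup>2 (s A / 2)\<close>
  is positive, whether \<open>A\<close> is real or imaginary.  Small eigenvalues of the quotient therefore do no harm.

  No spectral theory is needed for this.  The operator \<open>S\<^sub>s = sin (s A) / A\<close> has the explicit kernel
  \<open>1 / (2 \<pi> sqrt (gap s - u))\<close> on the disc of radius \<open>s\<close>; the kernel without the factor \<open>2 \<pi>\<close> is \<open>wave_kernel\<close> below.
  The addition formula for the cosine becomes \<open>S\<^sub>a S\<^sub>b = (1/2) \<integral> S\<^sub>s ds\<close> over \<open>a - b \<le> s \<le> a + b\<close> (\<open>wave_conv_eq\<close>).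
  This is proved by integrating both kernels over horocycles, which makes the wave kernel constant, and by the
  injectivity of this Abel transform (\<open>Abel_transform_injective\<close>).  Expanding the variance of \<open>S\<^sub>a 1\<^sub>I - S\<^sub>b 1\<^sub>I\<close> over a
  fundamental region (\<open>wave_variance\<close>) gives a second difference inequality, which says that the derivative of
  \<open>\<langle>S\<^sub>s f, f\<rangle>\<close> in \<open>s\<close> is at least \<open>- \<langle>f, f\<rangle>\<close> (\<open>rcorr_monotone\<close>): this is \<open>cos (s A) \<ge> - 1\<close>.  Finally the indicator of
  a disc is an explicit superposition of wave kernels (\<open>nn_integral_inv_sqrt_weight\<close>), so the vanishing of the
  correlation on a thin annulus of radius about \<open>r\<close> can be compared with that monotonicity (\<open>avoidance_inequality\<close>).

  The correlation is needed on an annulus and not only on a circle.  Therefore \<open>I\<close> is replaced by the orbit of a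
  compact subset of \<open>I\<close> in the open fundamental region: such an orbit avoids all distances near \<open>r\<close>
  (\<open>avoiding_orbit_has_gap\<close>), and the compact subset can have almost full measure by inner regularity.
\<close>

section \<open>Substitution and iterated integrals\<close>

lemma nn_integral_real_substitution:
  fixes g g' :: "real \<Rightarrow> real" and f :: "real \<Rightarrow> ennreal"
  assumes f [measurable]: "f \<in> borel_measurable borel"
    and deriv: "\<And>x. (g has_real_derivative g' x) (at x)"
    and cont: "continuous_on UNIV g'"
    and nonneg: "\<And>x. 0 \<le> g' x"
    and S: "range g = S" "S \<in> sets borel"
  shows "(\<integral>\<^sup>+x. f (g x) * ennreal (g' x) \<partial>lborel) = (\<integral>\<^sup>+y. f y * indicator S y \<partial>lborel)"
proof -
  have contg: "continuous_on UNIV g"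
    by (rule DERIV_continuous_on[OF DERIV_subset[OF deriv]]) auto
  have [measurable]: "g \<in> borel_measurable borel" "g' \<in> borel_measurable borel"
    using contg cont by (simp_all add: borel_measurable_continuous_onI)
  note [measurable] = S(2)
  have mono: "g x \<le> g y" if "x \<le> y" for x y
    using deriv nonneg that by (intro deriv_nonneg_imp_mono[where g=g and g'=g']) auto
  have ivl: "(\<Union>n::nat. {g (- real n)..g (real n)}) = S"
  proof (intro equalityI subsetI)
    fix y assume "y \<in> (\<Union>n::nat. {g (- real n)..g (real n)})"
    then obtain n :: nat where "g (- real n) \<le> y" "y \<le> g (real n)" by auto
    moreover have "continuous_on {- real n..real n} g"
      by (rule continuous_on_subset[OF contg]) simp
    ultimately obtain x where "g x = y"
      using IVT'[of g "- real n" y "real n"] by auto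
    then show "y \<in> S" using S by auto
  next
    fix y assume "y \<in> S"
    then obtain x where x: "y = g x" using S by auto
    obtain n :: nat where "\<bar>x\<bar> \<le> real n" using real_arch_simple by blast
    then have "y \<in> {g (- real n)..g (real n)}" using mono[of "- real n" x] mono[of x "real n"] x
      by (auto simp: abs_le_iff)
    then show "y \<in> (\<Union>n::nat. {g (- real n)..g (real n)})" by blast
  qed
  have ivl2: "(\<Union>n::nat. {- real n..real n}) = UNIV"
  proof (intro equalityI subsetI)
    fix x :: real
    obtain n :: nat where "\<bar>x\<bar> \<le> real n" using real_arch_simple by blast
    then have "x \<in> {- real n..real n}" by (simp only: atLeastAtMost_iff) linarith
    then show "x \<in> (\<Union>n::nat. {- real n..real n})" by blast
  qed auto
  have inc: "incseq (\<lambda>n::nat. {g (- real n)..g (real n)})"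
  proof (rule incseq_SucI)
    fix n :: nat
    show "{g (- real n)..g (real n)} \<subseteq> {g (- real (Suc n))..g (real (Suc n))}"
      using mono[of "- real (Suc n)" "- real n"] mono[of "real n" "real (Suc n)"] by auto
  qed
  have inc2: "incseq (\<lambda>n::nat. {- real n..real n})" by (rule incseq_SucI) auto
  have eq: "distr (density lborel (\<lambda>x. ennreal (g' x))) borel g = density lborel (indicator S)"
  proof (rule measure_eqI)
    fix A assume "A \<in> sets (distr (density lborel (\<lambda>x. ennreal (g' x))) borel g)"
    then have A [measurable]: "A \<in> sets borel" by simp
    let ?M = "density lborel (\<lambda>x. ennreal (g' x))"
    have "emeasure (distr ?M borel g) A = emeasure ?M (g -` A)"
      by (simp add: emeasure_distr)
    also have "g -` A = (\<Union>n. (g -` A \<inter> {- real n..real n}))"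
      using ivl2 by blast
    also have "emeasure ?M \<dots> = (SUP n. emeasure ?M (g -` A \<inter> {- real n..real n}))"
      using inc2 by (intro SUP_emeasure_incseq[symmetric]) (auto simp: incseq_def measurable_sets_borel[OF _ A])
    also have "\<dots> = (SUP n. emeasure lborel (A \<inter> {g (- real n)..g (real n)}))"
    proof (intro SUP_cong refl)
      fix n :: nat
      have "emeasure ?M (g -` A \<inter> {- real n..real n})
          = (\<integral>\<^sup>+x. ennreal (g' x) * indicator (g -` A \<inter> {- real n..real n}) x \<partial>lborel)"
        by (rule emeasure_density) (auto simp: measurable_sets_borel[OF _ A])
      also have "\<dots> = (\<integral>\<^sup>+x. ennreal (indicator A (g x) * g' x * indicator {- real n..real n} x) \<partial>lborel)"
        by (intro nn_integral_cong) (auto split: split_indicator)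
      also have "\<dots> = (\<integral>\<^sup>+x. ennreal (indicator A x * indicator {g (- real n)..g (real n)} x) \<partial>lborel)"
        using deriv cont nonneg
        by (intro nn_integral_substitution[symmetric]) (auto simp: set_borel_measurable_def intro: continuous_on_subset)
      also have "\<dots> = (\<integral>\<^sup>+x. indicator (A \<inter> {g (- real n)..g (real n)}) x \<partial>lborel)"
        by (intro nn_integral_cong) (auto split: split_indicator)
      finally show "emeasure ?M (g -` A \<inter> {- real n..real n}) = emeasure lborel (A \<inter> {g (- real n)..g (real n)})"
        by simp
    qed
    also have "\<dots> = emeasure lborel (\<Union>n. (A \<inter> {g (- real n)..g (real n)}))"
    proof (rule SUP_emeasure_incseq)
      show "incseq (\<lambda>n. A \<inter> {g (- real n)..g (real n)})"
        using inc unfolding incseq_def by blast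
    qed auto
    also have "(\<Union>n. (A \<inter> {g (- real n)..g (real n)})) = A \<inter> S"
      using ivl by blast
    also have "emeasure lborel (A \<inter> S) = emeasure (density lborel (indicator S)) A"
      by (simp add: emeasure_density indicator_inter_arith[symmetric] Int_commute)
    finally show "emeasure (distr ?M borel g) A = emeasure (density lborel (indicator S)) A" .
  qed simp
  have "(\<integral>\<^sup>+x. f (g x) * ennreal (g' x) \<partial>lborel) = (\<integral>\<^sup>+y. f y \<partial>distr (density lborel (\<lambda>x. ennreal (g' x))) borel g)"
    by (simp add: nn_integral_distr nn_integral_density mult.commute)
  also have "\<dots> = (\<integral>\<^sup>+y. f y * indicator S y \<partial>lborel)"
    unfolding eq by (simp add: nn_integral_density mult.commute)
  finally show ?thesis .
qed

lemma lborel_complex: "(lborel :: complex measure) = distr (lborel \<Otimes>\<^sub>M lborel) borel (\<lambda>(y, x). Complex x y)"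
proof (rule lborel_eqI)
  have [measurable]: "(\<lambda>(y, x). Complex x y) \<in> borel_measurable (borel \<Otimes>\<^sub>M borel)"
    unfolding borel_prod
    by (intro borel_measurable_continuous_onI) (simp add: case_prod_beta Complex_eq continuous_intros)
  fix l u :: complex assume lu: "\<And>b. b \<in> Basis \<Longrightarrow> l \<bullet> b \<le> u \<bullet> b"
  then have le: "Re l \<le> Re u" "Im l \<le> Im u"
    using lu[of 1] lu[of \<i>] by (simp_all add: Basis_complex_def)
  have "(\<lambda>(y, x). Complex x y) -` box l u = {Im l<..<Im u} \<times> {Re l<..<Re u}"
    by (auto simp: box_def Basis_complex_def)
  then show "emeasure (distr (lborel \<Otimes>\<^sub>M lborel) borel (\<lambda>(y, x). Complex x y)) (box l u) =
      ennreal (\<Prod>b\<in>Basis. (u - l) \<bullet> b)"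
    using le
    by (subst emeasure_distr)
      (simp_all add: space_pair_measure lborel.emeasure_pair_measure_Times Basis_complex_def ennreal_mult[symmetric] mult.commute)
qed simp

lemma nn_integral_lborel_complex:
  assumes [measurable]: "f \<in> borel_measurable borel"
  shows "(\<integral>\<^sup>+z. f z \<partial>lborel) = (\<integral>\<^sup>+y. \<integral>\<^sup>+x. f (Complex x y) \<partial>lborel \<partial>lborel)"
proof -
  have [measurable]: "(\<lambda>(y, x). Complex x y) \<in> borel_measurable (borel \<Otimes>\<^sub>M borel)"
    unfolding borel_prod
    by (intro borel_measurable_continuous_onI) (simp add: case_prod_beta Complex_eq continuous_intros)
  have "(\<integral>\<^sup>+z. f z \<partial>lborel) = (\<integral>\<^sup>+p. f (case p of (y, x) \<Rightarrow> Complex x y) \<partial>(lborel \<Otimes>\<^sub>M lborel))"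
    by (subst lborel_complex, subst nn_integral_distr) simp_all
  also have "\<dots> = (\<integral>\<^sup>+y. \<integral>\<^sup>+x. f (Complex x y) \<partial>lborel \<partial>lborel)"
    by (subst lborel.nn_integral_fst[symmetric]) simp_all
  finally show ?thesis .
qed

section \<open>The invariant measure\<close>

text \<open>
  The hyperbolic area as a Borel measure on all of \<open>\<complex>\<close>, concentrated on the upper half-plane.  Borel sets suit
  iterated integrals, for which the completed measure \<^const>\<open>hyp_area\<close> is awkward.
\<close>

definition nu :: "complex measure" where
  "nu = density lborel (\<lambda>z. indicator upper_half_plane z * ennreal (1 / (Im z)\<^sup>2))"

lemma sets_upper_half_plane [measurable]: "upper_half_plane \<in> sets borel"
  unfolding upper_half_plane_def by measurable

lemma open_upper_half_plane: "open upper_half_plane"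
  unfolding upper_half_plane_def by (rule open_halfspace_Im_gt)

lemma measurable_Complex [measurable]:
  "f \<in> borel_measurable M \<Longrightarrow> g \<in> borel_measurable M \<Longrightarrow> (\<lambda>x. Complex (f x) (g x)) \<in> borel_measurable M"
  by (simp add: Complex_eq)

lemma sets_nu [simp, measurable_cong]: "sets nu = sets borel"
  and space_nu [simp]: "space nu = UNIV"
  by (simp_all add: nu_def)

lemma sigma_finite_nu: "sigma_finite_measure nu"
  unfolding nu_def
  by (subst sigma_finite_measure.sigma_finite_iff_density_finite[OF lborel.sigma_finite_measure_axioms]) (auto simp: ennreal_mult_eq_top_iff split: split_indicator)

interpretation nu: sigma_finite_measure nu
  by (rule sigma_finite_nu)

interpretation nu: pair_sigma_finite nu nu ..

interpretation nu_lborel: pair_sigma_finite nu lborel ..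

interpretation lborel_nu: pair_sigma_finite lborel nu ..

lemma AE_nu: "AE z in nu. 0 < Im z"
  unfolding nu_def by (subst AE_density) (auto simp: upper_half_plane_def split: split_indicator)

lemma nn_integral_nu_cong:
  "(\<And>z. 0 < Im z \<Longrightarrow> f z = g z) \<Longrightarrow> (\<integral>\<^sup>+z. f z \<partial>nu) = (\<integral>\<^sup>+z. g z \<partial>nu)"
  using AE_nu by (intro nn_integral_cong_AE) auto

text \<open>
  Coordinates \<open>x + \<i> exp b\<close>: the lines of constant \<open>b\<close> are horocycles at infinity.
\<close>

lemma nn_integral_nu:
  assumes [measurable]: "f \<in> borel_measurable borel"
  shows "(\<integral>\<^sup>+z. f z \<partial>nu) = (\<integral>\<^sup>+b. (\<integral>\<^sup>+x. f (Complex x (exp b)) \<partial>lborel) * ennreal (exp (- b)) \<partial>lborel)"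
proof -
  define h where "h y = (\<integral>\<^sup>+x. f (Complex x y) \<partial>lborel)" for y
  have [measurable]: "h \<in> borel_measurable borel"
    unfolding h_def by measurable
  have range: "range exp = {0::real<..}"
    by (auto simp: image_iff) (metis exp_ln)
  have "(\<integral>\<^sup>+z. f z \<partial>nu) = (\<integral>\<^sup>+z. (indicator upper_half_plane z * ennreal (1 / (Im z)\<^sup>2)) * f z \<partial>lborel)"
    by (simp add: nu_def nn_integral_density)
  also have "\<dots> = (\<integral>\<^sup>+y. \<integral>\<^sup>+x. (indicator {0<..} y * ennreal (1 / y\<^sup>2)) * f (Complex x y) \<partial>lborel \<partial>lborel)"
    by (subst nn_integral_lborel_complex) (auto simp: upper_half_plane_def indicator_def)
  also have "\<dots> = (\<integral>\<^sup>+y. (h y * ennreal (1 / y\<^sup>2)) * indicator {0<..} y \<partial>lborel)"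
    unfolding h_def by (subst nn_integral_cmult) (auto simp: mult_ac)
  also have "\<dots> = (\<integral>\<^sup>+b. (h (exp b) * ennreal (1 / (exp b)\<^sup>2)) * ennreal (exp b) \<partial>lborel)"
    by (rule nn_integral_real_substitution[symmetric])
       (auto intro!: derivative_eq_intros continuous_intros range)
  also have "\<dots> = (\<integral>\<^sup>+b. h (exp b) * ennreal (exp (- b)) \<partial>lborel)"
  proof (intro nn_integral_cong)
    fix b
    have "ennreal (1 / (exp b)\<^sup>2) * ennreal (exp b) = ennreal (exp (- b))"
      by (simp add: ennreal_mult[symmetric] exp_minus field_simps power2_eq_square)
    then show "(h (exp b) * ennreal (1 / (exp b)\<^sup>2)) * ennreal (exp b) = h (exp b) * ennreal (exp (- b))"
      by (simp add: mult.assoc)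
  qed
  finally show ?thesis unfolding h_def .
qed

lemma nn_integral_nu_translation:
  assumes [measurable]: "f \<in> borel_measurable borel"
  shows "(\<integral>\<^sup>+z. f (z + of_real t) \<partial>nu) = (\<integral>\<^sup>+z. f z \<partial>nu)"
proof -
  have "(\<integral>\<^sup>+x. f (Complex (x + t) y) \<partial>lborel) = (\<integral>\<^sup>+x. f (Complex x y) \<partial>lborel)" for y
    using nn_integral_real_affine[of "\<lambda>x. f (Complex x y)" 1 t] by (simp add: add.commute)
  then show ?thesis
    by (simp add: nn_integral_nu Complex_eq algebra_simps)
qed

lemma nn_integral_nu_scaling:
  assumes [measurable]: "f \<in> borel_measurable borel" and a: "0 < a"
  shows "(\<integral>\<^sup>+z. f (of_real a * z) \<partial>nu) = (\<integral>\<^sup>+z. f z \<partial>nu)"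
proof -
  define h where "h b = (\<integral>\<^sup>+x. f (Complex x (exp b)) \<partial>lborel)" for b
  have [measurable]: "h \<in> borel_measurable borel"
    unfolding h_def by measurable
  have 1: "h (b + ln a) = ennreal a * (\<integral>\<^sup>+x. f (of_real a * Complex x (exp b)) \<partial>lborel)" for b
    using nn_integral_real_affine[of "\<lambda>x. f (Complex x (exp (b + ln a)))" a 0] a
    by (simp add: h_def exp_add Complex_eq algebra_simps)
  have "(\<integral>\<^sup>+z. f (of_real a * z) \<partial>nu)
      = (\<integral>\<^sup>+b. h (b + ln a) * ennreal (exp (- (b + ln a))) \<partial>lborel)"
    unfolding nn_integral_nu[of "\<lambda>z. f (of_real a * z)", simplified]
  proof (rule nn_integral_cong)
    fix b
    have "ennreal (exp (- b)) = ennreal a * ennreal (exp (- (b + ln a)))"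
      using a by (simp add: ennreal_mult[symmetric] exp_diff exp_minus field_simps)
    then show "(\<integral>\<^sup>+x. f (of_real a * Complex x (exp b)) \<partial>lborel) * ennreal (exp (- b))
      = h (b + ln a) * ennreal (exp (- (b + ln a)))"
      unfolding 1 by (simp add: mult_ac)
  qed
  also have "\<dots> = (\<integral>\<^sup>+b. h b * ennreal (exp (- b)) \<partial>lborel)"
    using nn_integral_real_affine[of "\<lambda>b. h b * ennreal (exp (- b))" 1 "ln a"] by (simp add: add.commute)
  also have "\<dots> = (\<integral>\<^sup>+z. f z \<partial>nu)"
    unfolding h_def by (rule nn_integral_nu[symmetric]) measurable
  finally show ?thesis .
qed

text \<open>
  Here \<open>p = x / y\<close> parametrizes the rays from \<open>0\<close>.  In these coordinates the inversion \<open>- 1 / z\<close> acts on each ray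
  by a reflection in \<open>b\<close>, so that its invariance needs no Jacobian in the plane.
\<close>

lemma nn_integral_nu_radial_coordinates:
  assumes [measurable]: "f \<in> borel_measurable borel"
  shows "(\<integral>\<^sup>+z. f z \<partial>nu) = (\<integral>\<^sup>+p. \<integral>\<^sup>+b. f (of_real (exp b) * Complex p 1) \<partial>lborel \<partial>lborel)"
proof -
  have "(\<integral>\<^sup>+x. f (Complex x (exp b)) \<partial>lborel) * ennreal (exp (- b))
      = (\<integral>\<^sup>+p. f (of_real (exp b) * Complex p 1) \<partial>lborel)" for b
  proof -
    have "(\<integral>\<^sup>+x. f (Complex x (exp b)) \<partial>lborel)
        = ennreal (exp b) * (\<integral>\<^sup>+p. f (of_real (exp b) * Complex p 1) \<partial>lborel)"
      using nn_integral_real_affine[of "\<lambda>x. f (Complex x (exp b))" "exp b" 0]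
      by (simp add: Complex_eq algebra_simps)
    moreover have "ennreal (exp b) * ennreal (exp (- b)) = 1"
      by (simp add: ennreal_mult[symmetric] exp_minus)
    ultimately show ?thesis
      by (simp add: mult_ac) (simp add: mult.assoc[symmetric])
  qed
  then have "(\<integral>\<^sup>+z. f z \<partial>nu) = (\<integral>\<^sup>+b. \<integral>\<^sup>+p. f (of_real (exp b) * Complex p 1) \<partial>lborel \<partial>lborel)"
    by (simp add: nn_integral_nu)
  also have "\<dots> = (\<integral>\<^sup>+p. \<integral>\<^sup>+b. f (of_real (exp b) * Complex p 1) \<partial>lborel \<partial>lborel)"
    by (rule lborel_pair.Fubini') measurable
  finally show ?thesis .
qed

lemma nn_integral_nu_inversion:
  assumes [measurable]: "f \<in> borel_measurable borel"
  shows "(\<integral>\<^sup>+z. f (- 1 / z) \<partial>nu) = (\<integral>\<^sup>+z. f z \<partial>nu)"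
proof -
  define F where "F p = (\<integral>\<^sup>+b. f (of_real (exp b) * Complex p 1) \<partial>lborel)" for p
  have [measurable]: "F \<in> borel_measurable borel"
    unfolding F_def by measurable
  have inv: "- 1 / (of_real (exp b) * Complex p 1) = of_real (exp (- ln (1 + p\<^sup>2) + - 1 * b)) * Complex (- p) 1" for b p
  proof -
    have "1 + p\<^sup>2 > 0" by (simp add: add_pos_nonneg)
    then have e: "exp (- ln (1 + p\<^sup>2) + - 1 * b) = 1 / ((1 + p\<^sup>2) * exp b)"
      by (simp add: exp_diff exp_minus field_simps)
    show ?thesis unfolding e using \<open>1 + p\<^sup>2 > 0\<close>
      by (simp add: complex_eq_iff Re_divide Im_divide power2_eq_square divide_simps)
         (simp add: algebra_simps)
  qed
  have "(\<integral>\<^sup>+z. f (- 1 / z) \<partial>nu) = (\<integral>\<^sup>+p. \<integral>\<^sup>+b. f (of_real (exp (- ln (1 + p\<^sup>2) + - 1 * b)) * Complex (- p) 1) \<partial>lborel \<partial>lborel)"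
    unfolding inv[symmetric] by (rule nn_integral_nu_radial_coordinates) measurable
  also have "\<dots> = (\<integral>\<^sup>+p. F (- p) \<partial>lborel)"
  proof (intro nn_integral_cong)
    fix p
    show "(\<integral>\<^sup>+b. f (of_real (exp (- ln (1 + p\<^sup>2) + - 1 * b)) * Complex (- p) 1) \<partial>lborel) = F (- p)"
      using nn_integral_real_affine[of "\<lambda>b. f (of_real (exp b) * Complex (- p) 1)" "-1" "- ln (1 + p\<^sup>2)"]
      by (simp add: F_def)
  qed
  also have "\<dots> = (\<integral>\<^sup>+p. F p \<partial>lborel)"
    using nn_integral_real_affine[of F "-1" 0] by simp
  also have "\<dots> = (\<integral>\<^sup>+z. f z \<partial>nu)"
    unfolding F_def by (rule nn_integral_nu_radial_coordinates[symmetric]) measurable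
  finally show ?thesis .
qed

section \<open>Moebius transformations\<close>

text \<open>
  This is \<open>2 cosh d - 2\<close> where \<open>d\<close> is the hyperbolic distance, see \<open>hyp_dist_eq\<close> below.
\<close>

definition hyp_gap :: "complex \<Rightarrow> complex \<Rightarrow> real" where
  "hyp_gap z w = (cmod (z - w))\<^sup>2 / (Im z * Im w)"

lemma mobius_denominator_nonzero:
  fixes A :: "real^2^2"
  assumes "det A = 1" "0 < Im z"
  shows "of_real (A$2$1) * z + of_real (A$2$2) \<noteq> 0"
  using assms by (auto simp: det_2 complex_eq_iff)

lemma Im_mobius:
  fixes A :: "real^2^2"
  assumes "det A = 1" "0 < Im z"
  shows "Im (mobius A z) = Im z / (cmod (of_real (A$2$1) * z + of_real (A$2$2)))\<^sup>2"
proof -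
  have "(A$1$1 * Im z) * (A$2$1 * Re z + A$2$2) - (A$1$1 * Re z + A$1$2) * (A$2$1 * Im z)
      = det A * Im z"
    by (simp add: det_2 algebra_simps)
  then show ?thesis
    using assms by (simp add: mobius_def Im_divide cmod_def power2_eq_square)
qed

lemma Im_mobius_pos:
  fixes A :: "real^2^2"
  assumes "det A = 1" "0 < Im z"
  shows "0 < Im (mobius A z)"
  using mobius_denominator_nonzero[OF assms] assms by (simp add: Im_mobius)

lemma mobius_diff:
  fixes A :: "real^2^2"
  assumes "det A = 1" "0 < Im z" "0 < Im w"
  shows "mobius A z - mobius A w =
    (z - w) / ((of_real (A$2$1) * z + of_real (A$2$2)) * (of_real (A$2$1) * w + of_real (A$2$2)))"
proof -
  have d: "of_real (A$1$1) * of_real (A$2$2) - of_real (A$1$2) * of_real (A$2$1) = (1::complex)"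
    using assms(1) by (simp add: det_2 flip: of_real_mult of_real_diff)
  have "(of_real (A$1$1) * z + of_real (A$1$2)) * (of_real (A$2$1) * w + of_real (A$2$2))
      - (of_real (A$1$1) * w + of_real (A$1$2)) * (of_real (A$2$1) * z + of_real (A$2$2))
      = (of_real (A$1$1) * of_real (A$2$2) - of_real (A$1$2) * of_real (A$2$1)) * (z - w)"
    by (simp add: algebra_simps)
  then show ?thesis
    using mobius_denominator_nonzero[OF assms(1,2)] mobius_denominator_nonzero[OF assms(1,3)] d
    by (simp add: mobius_def diff_frac_eq)
qed

lemma hyp_gap_mobius:
  fixes A :: "real^2^2"
  assumes "det A = 1" "0 < Im z" "0 < Im w"
  shows "hyp_gap (mobius A z) (mobius A w) = hyp_gap z w"
  using mobius_denominator_nonzero[OF assms(1,2)] mobius_denominator_nonzero[OF assms(1,3)] assms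
  by (simp add: hyp_gap_def mobius_diff Im_mobius norm_divide norm_mult power_divide power_mult_distrib)

lemma mobius_mult:
  fixes A B :: "real^2^2"
  assumes "det A = 1" "det B = 1" "0 < Im z"
  shows "mobius (A ** B) z = mobius A (mobius B z)"
proof -
  note B = mobius_denominator_nonzero[OF assms(2,3)]
  have "mobius A (mobius B z) =
    ((of_real (A$1$1) * (of_real (B$1$1) * z + of_real (B$1$2)) + of_real (A$1$2) * (of_real (B$2$1) * z + of_real (B$2$2)))
      / (of_real (B$2$1) * z + of_real (B$2$2))) /
    ((of_real (A$2$1) * (of_real (B$1$1) * z + of_real (B$1$2)) + of_real (A$2$2) * (of_real (B$2$1) * z + of_real (B$2$2)))
      / (of_real (B$2$1) * z + of_real (B$2$2)))"
  proof -
    have "of_real a * (N / D) + of_real b = (of_real a * N + of_real b * D) / D"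
      if "D \<noteq> 0" for a b :: real and N D :: complex
      using that by (simp add: add_divide_distrib)
    then show ?thesis
      unfolding mobius_def[of A] mobius_def[of B] using B by simp
  qed
  also have "\<dots> = mobius (A ** B) z"
  proof -
    have "(X / D) / (Y / D) = X / Y" if "D \<noteq> 0" for X Y D :: complex
      using that by simp
    note cancel = this[OF B]
    show ?thesis
      unfolding cancel by (simp add: mobius_def matrix_matrix_mult_def UNIV_2 algebra_simps)
  qed
  finally show ?thesis ..
qed

lemma mobius_one: "mobius (mat 1) z = z"
  by (simp add: mobius_def mat_def)

lemma measurable_mobius [measurable]: "mobius A \<in> borel_measurable borel"
  unfolding mobius_def[abs_def] by measurable

text \<open>
  A Moebius transformation is composed of translations, scalings and at most one inversion.
\<close>

lemma nn_integral_nu_mobius: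
  fixes A :: "real^2^2"
  assumes A: "det A = 1" and [measurable]: "f \<in> borel_measurable borel"
  shows "(\<integral>\<^sup>+z. f (mobius A z) \<partial>nu) = (\<integral>\<^sup>+z. f z \<partial>nu)"
proof (cases "A$2$1 = 0")
  case True
  with A have ad: "A$1$1 * A$2$2 = 1" by (simp add: det_2)
  then have nz: "A$1$1 \<noteq> 0" "A$2$2 \<noteq> 0" by auto
  then have d: "A$2$2 = 1 / A$1$1" using ad by (metis nonzero_eq_divide_eq mult.commute)
  have "mobius A z = of_real ((A$1$1)\<^sup>2) * z + of_real (A$1$1 * A$1$2)" for z
    using nz True by (simp add: mobius_def d power2_eq_square field_simps)
  then have "(\<integral>\<^sup>+z. f (mobius A z) \<partial>nu) = (\<integral>\<^sup>+z. f (of_real ((A$1$1)\<^sup>2) * z + of_real (A$1$1 * A$1$2)) \<partial>nu)"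
    by simp
  also have "\<dots> = (\<integral>\<^sup>+z. f (z + of_real (A$1$1 * A$1$2)) \<partial>nu)"
    using nz by (intro nn_integral_nu_scaling[of "\<lambda>z. f (z + of_real (A$1$1 * A$1$2))"]) auto
  also have "\<dots> = (\<integral>\<^sup>+z. f z \<partial>nu)"
    by (rule nn_integral_nu_translation) measurable
  finally show ?thesis .
next
  case False
  define c where "c = A$2$1"
  have c: "c \<noteq> 0" using False by (simp add: c_def)
  define g where "g z = f (of_real (1 / c\<^sup>2) * z + of_real (A$1$1 / c))" for z
  have [measurable]: "g \<in> borel_measurable borel" unfolding g_def by measurable
  have *: "mobius A z = of_real (1 / c\<^sup>2) * (- 1 / (z + of_real (A$2$2 / c))) + of_real (A$1$1 / c)" if "0 < Im z" for z
  proof -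
    have nz: "of_real c * z + of_real (A$2$2) \<noteq> 0"
      using mobius_denominator_nonzero[OF A that] by (simp add: c_def)
    have "A$1$2 * c = A$1$1 * A$2$2 - 1"
      using A by (simp add: det_2 c_def)
    then have "of_real (A$1$2 * c) = (of_real (A$1$1 * A$2$2 - 1) :: complex)" by simp
    then have b: "of_real (A$1$2) * of_real c = of_real (A$1$1) * of_real (A$2$2) - (1::complex)"
      by (simp only: of_real_mult of_real_diff of_real_1)
    have shift: "z + of_real (A$2$2 / c) = (of_real c * z + of_real (A$2$2)) / of_real c"
      using c by (simp add: field_simps)
    have frac: "1 / C\<^sup>2 * (- 1 / (E / C)) + a / C = (a * E - 1) / (C * E)"
      if "C \<noteq> 0" "E \<noteq> 0" for C E a :: complex
      using that by (simp add: divide_simps power2_eq_square)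
    have "of_real (1 / c\<^sup>2) * (- 1 / (z + of_real (A$2$2 / c))) + of_real (A$1$1 / c)
      = (of_real (A$1$1) * (of_real c * z + of_real (A$2$2)) - 1) / (of_real c * (of_real c * z + of_real (A$2$2)))"
      unfolding shift using frac[of "of_real c", OF _ nz, of "of_real (A$1$1)"] c by simp
    also have "\<dots> = (of_real c * (of_real (A$1$1) * z + of_real (A$1$2))) / (of_real c * (of_real c * z + of_real (A$2$2)))"
      using b by (simp add: algebra_simps)
    also have "\<dots> = mobius A z"
      using c by (simp add: mobius_def c_def)
    finally show ?thesis ..
  qed
  have "(\<integral>\<^sup>+z. f (mobius A z) \<partial>nu) = (\<integral>\<^sup>+z. g (- 1 / (z + of_real (A$2$2 / c))) \<partial>nu)"
    by (intro nn_integral_nu_cong) (simp add: * g_def)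
  also have "\<dots> = (\<integral>\<^sup>+z. g (- 1 / z) \<partial>nu)"
    by (rule nn_integral_nu_translation[of "\<lambda>z. g (- 1 / z)"]) measurable
  also have "\<dots> = (\<integral>\<^sup>+z. g z \<partial>nu)"
    by (rule nn_integral_nu_inversion) measurable
  also have "\<dots> = (\<integral>\<^sup>+z. f (z + of_real (A$1$1 / c)) \<partial>nu)"
    unfolding g_def using c by (intro nn_integral_nu_scaling[of "\<lambda>z. f (z + of_real (A$1$1 / c))"]) auto
  also have "\<dots> = (\<integral>\<^sup>+z. f z \<partial>nu)"
    by (rule nn_integral_nu_translation) measurable
  finally show ?thesis .
qed

section \<open>Polar coordinates and the Abel transform\<close>

text \<open>
  The area of the disc \<open>x\<^sup>2 + y\<^sup>2 < t\<close> is \<open>\<pi> t\<close>, so the image of plane Lebesgue measure under the squared norm is \<open>\<pi>\<close> times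
  Lebesgue measure on the half line.  The minus sign in the proof turns discs into the right half lines for which
  the uniqueness criterion is stated.
\<close>

lemma nn_integral_sum_of_squares:
  fixes F :: "real \<Rightarrow> ennreal"
  assumes [measurable]: "F \<in> borel_measurable borel"
  shows "(\<integral>\<^sup>+y. \<integral>\<^sup>+x. F (x\<^sup>2 + y\<^sup>2) \<partial>lborel \<partial>lborel) = ennreal pi * (\<integral>\<^sup>+u. F u * indicator {0..} u \<partial>lborel)"
proof -
  let ?M = "distr (lborel :: complex measure) borel (\<lambda>z. - (cmod z)\<^sup>2)"
  let ?N = "density lborel (\<lambda>v. ennreal pi * indicator {..0} v)"
  have "?M = ?N"
  proof (rule measure_eqI_lessThan)
    have M: "emeasure ?M {t<..} = ennreal (if t < 0 then pi * (- t) else 0)" for t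
    proof -
      have "emeasure ?M {t<..} = emeasure lborel ((\<lambda>z::complex. - (cmod z)\<^sup>2) -` {t<..})"
        by (simp add: emeasure_distr)
      also have "(\<lambda>z::complex. - (cmod z)\<^sup>2) -` {t<..} = (if t < 0 then ball 0 (sqrt (- t)) else {})"
      proof (rule Set.set_eqI)
        fix z :: complex
        have "(cmod z)\<^sup>2 < - t \<longleftrightarrow> cmod z < sqrt (- t)"
          using real_sqrt_less_iff[of "(cmod z)\<^sup>2" "- t"] by simp
        moreover have "\<not> (cmod z)\<^sup>2 < - t" if "\<not> t < 0"
          using that zero_le_power2[of "cmod z"] by linarith
        ultimately show "z \<in> (\<lambda>z. - (cmod z)\<^sup>2) -` {t<..} \<longleftrightarrow> z \<in> (if t < 0 then ball 0 (sqrt (- t)) else {})"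
          by (auto simp: dist_norm)
      qed
      finally show ?thesis by (simp add: emeasure_ball unit_ball_vol_2)
    qed
    fix t :: real
    show "emeasure ?M {t<..} < \<infinity>" unfolding M by simp
    have "emeasure ?N {t<..} = ennreal pi * emeasure lborel ({..0} \<inter> {t<..})"
      by (simp add: emeasure_density mult.assoc nn_integral_cmult indicator_inter_arith[symmetric])
    also have "{..0} \<inter> {t<..} = {t<..0}" by auto
    finally show "emeasure ?M {t<..} = emeasure ?N {t<..}"
      unfolding M by (simp add: ennreal_mult[symmetric])
  qed simp_all
  then have "(\<integral>\<^sup>+v. F (- v) \<partial>?M) = (\<integral>\<^sup>+v. F (- v) \<partial>?N)" by simp
  also have "(\<integral>\<^sup>+v. F (- v) \<partial>?M) = (\<integral>\<^sup>+z. F ((cmod z)\<^sup>2) \<partial>lborel)"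
    by (simp add: nn_integral_distr)
  also have "\<dots> = (\<integral>\<^sup>+y. \<integral>\<^sup>+x. F (x\<^sup>2 + y\<^sup>2) \<partial>lborel \<partial>lborel)"
    by (subst nn_integral_lborel_complex) (simp_all add: cmod_power2)
  also have "(\<integral>\<^sup>+v. F (- v) \<partial>?N) = (\<integral>\<^sup>+v. ennreal pi * (F (- v) * indicator {0..} (- v)) \<partial>lborel)"
    by (subst nn_integral_density) (auto intro!: nn_integral_cong split: split_indicator)
  also have "\<dots> = ennreal pi * (\<integral>\<^sup>+v. F (- v) * indicator {0..} (- v) \<partial>lborel)"
    by (rule nn_integral_cmult) measurable
  also have "(\<integral>\<^sup>+v. F (- v) * indicator {0..} (- v) \<partial>lborel) = (\<integral>\<^sup>+u. F u * indicator {0..} u \<partial>lborel)"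
    using nn_integral_real_affine[of "\<lambda>u. F u * indicator {0..} u" "-1" 0] by simp
  finally show ?thesis .
qed

text \<open>
  Applying the transform \<open>F \<mapsto> \<integral> F (p + x\<^sup>2) dx\<close> twice is integration over the plane, hence gives \<open>\<pi>\<close> times the tail
  integral of \<open>F\<close> from \<open>p\<close>.  Tail integrals determine \<open>F\<close> almost everywhere.
\<close>

lemma Abel_transform_injective:
  fixes F G :: "real \<Rightarrow> ennreal"
  assumes [measurable]: "F \<in> borel_measurable borel" "G \<in> borel_measurable borel"
    and eq: "\<And>p. 0 \<le> p \<Longrightarrow> (\<integral>\<^sup>+x. F (p + x\<^sup>2) \<partial>lborel) = (\<integral>\<^sup>+x. G (p + x\<^sup>2) \<partial>lborel)"
    and fin: "(\<integral>\<^sup>+u. G u * indicator {0..} u \<partial>lborel) < \<infinity>"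
  shows "AE u in lborel. 0 \<le> u \<longrightarrow> F u = G u"
proof -
  have tail: "(\<integral>\<^sup>+y. \<integral>\<^sup>+x. H ((p + y\<^sup>2) + x\<^sup>2) \<partial>lborel \<partial>lborel) = ennreal pi * (\<integral>\<^sup>+u. H u * indicator {p..} u \<partial>lborel)"
    if [measurable]: "H \<in> borel_measurable borel" for H :: "real \<Rightarrow> ennreal" and p
  proof -
    have "(\<integral>\<^sup>+y. \<integral>\<^sup>+x. H ((p + y\<^sup>2) + x\<^sup>2) \<partial>lborel \<partial>lborel) = ennreal pi * (\<integral>\<^sup>+u. H (p + u) * indicator {0..} u \<partial>lborel)"
      using nn_integral_sum_of_squares[of "\<lambda>u. H (p + u)"] by (simp add: add_ac)
    also have "(\<integral>\<^sup>+u. H (p + u) * indicator {0..} u \<partial>lborel) = (\<integral>\<^sup>+u. H u * indicator {p..} u \<partial>lborel)"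
      using nn_integral_real_affine[of "\<lambda>u. H u * indicator {p..} u" 1 p] by (simp add: indicator_def)
    finally show ?thesis .
  qed
  have eq2: "(\<integral>\<^sup>+u. F u * indicator {p..} u \<partial>lborel) = (\<integral>\<^sup>+u. G u * indicator {p..} u \<partial>lborel)" if "0 \<le> p" for p
  proof -
    have "ennreal pi * (\<integral>\<^sup>+u. F u * indicator {p..} u \<partial>lborel) = ennreal pi * (\<integral>\<^sup>+u. G u * indicator {p..} u \<partial>lborel)"
      unfolding tail[symmetric, OF assms(1)] tail[symmetric, OF assms(2)]
      using that by (intro nn_integral_cong eq) simp
    then show ?thesis by (simp add: ennreal_mult_cancel_left)
  qed
  let ?F = "density lborel (\<lambda>u. F u * indicator {0..} u)"
  let ?G = "density lborel (\<lambda>u. G u * indicator {0..} u)"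
  have D: "emeasure (density lborel (\<lambda>u. H u * indicator {0..} u)) {t<..} = (\<integral>\<^sup>+u. H u * indicator {max 0 t..} u \<partial>lborel)"
    if [measurable]: "H \<in> borel_measurable borel" for H :: "real \<Rightarrow> ennreal" and t
  proof -
    have "AE u in lborel. u \<noteq> t" by (rule AE_lborel_singleton)
    then have "AE u in lborel. H u * indicator {0..} u * indicator {t<..} u = H u * indicator {max 0 t..} u"
      by eventually_elim (auto split: split_indicator)
    then show ?thesis
      by (subst emeasure_density) (auto intro: nn_integral_cong_AE)
  qed
  have "?F = ?G"
  proof (rule measure_eqI_lessThan)
    fix t
    show "emeasure ?F {t<..} = emeasure ?G {t<..}"
      unfolding D[OF assms(1)] D[OF assms(2)] by (rule eq2) simp
    have "emeasure ?F {t<..} = (\<integral>\<^sup>+u. G u * indicator {max 0 t..} u \<partial>lborel)"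
      unfolding D[OF assms(1)] by (rule eq2) simp
    also have "\<dots> \<le> (\<integral>\<^sup>+u. G u * indicator {0..} u \<partial>lborel)"
      by (intro nn_integral_mono) (auto split: split_indicator)
    finally show "emeasure ?F {t<..} < \<infinity>" using fin by (rule le_less_trans)
  qed simp_all
  then have "AE u in lborel. F u * indicator {0..} u = G u * indicator {0..} u"
    by (intro sigma_finite_measure.density_unique[OF lborel.sigma_finite_measure_axioms]) auto
  then show ?thesis
    by eventually_elim (auto split: split_indicator_asm)
qed

section \<open>The inverse square root and two-point homogeneity\<close>

definition inv_sqrt :: "real \<Rightarrow> real \<Rightarrow> ennreal" where
  "inv_sqrt q u = (if u < q then ennreal (1 / sqrt (q - u)) else 0)"

lemma measurable_inv_sqrt [measurable]:
  assumes [measurable]: "f \<in> borel_measurable M" "g \<in> borel_measurable M"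
  shows "(\<lambda>x. inv_sqrt (f x) (g x)) \<in> borel_measurable M"
  unfolding inv_sqrt_def by measurable

lemma nn_integral_inv_sqrt_square:
  "(\<integral>\<^sup>+x. inv_sqrt D (x\<^sup>2) \<partial>lborel) = (if 0 < D then ennreal pi else 0)"
proof (cases "0 < D")
  case False
  then have "inv_sqrt D (x\<^sup>2) = 0" for x
    using order_trans[OF _ zero_le_power2[of x], of D] by (simp add: inv_sqrt_def not_less)
  then show ?thesis using False by simp
next
  case True
  let ?f = "\<lambda>x. if x \<in> {- sqrt D..sqrt D} then 1 / sqrt (D - x\<^sup>2) else 0"
  have abs: "x \<in> {- sqrt D..sqrt D} \<longleftrightarrow> x\<^sup>2 \<le> D" for x
    using real_sqrt_le_iff[of "x\<^sup>2" D] by (auto simp: abs_le_iff)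
  have "((\<lambda>x. 1 / sqrt (D - x\<^sup>2)) has_integral (arcsin (sqrt D / sqrt D) - arcsin (- sqrt D / sqrt D))) {- sqrt D..sqrt D}"
  proof (rule fundamental_theorem_of_calculus_interior)
    show "continuous_on {- sqrt D..sqrt D} (\<lambda>x. arcsin (x / sqrt D))"
      using True by (intro continuous_intros) (auto simp: field_simps)
    fix x assume x: "x \<in> {- sqrt D<..<sqrt D}"
    then have x2: "x\<^sup>2 < D"
      using True real_sqrt_less_iff[of "x\<^sup>2" D] by (simp add: abs_less_iff)
    have "((\<lambda>x. arcsin (x / sqrt D)) has_real_derivative inverse (sqrt (1 - (x / sqrt D)\<^sup>2)) * (1 / sqrt D)) (at x)"
      using x True by (intro DERIV_chain2[where f=arcsin] DERIV_arcsin) (auto intro!: derivative_eq_intros simp: field_simps)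
    also have "inverse (sqrt (1 - (x / sqrt D)\<^sup>2)) * (1 / sqrt D) = 1 / sqrt (D - x\<^sup>2)"
      using True x2 by (simp add: power_divide divide_simps real_sqrt_divide real_sqrt_mult[symmetric])
    finally show "((\<lambda>x. arcsin (x / sqrt D)) has_vector_derivative 1 / sqrt (D - x\<^sup>2)) (at x)"
      by (simp add: has_real_derivative_iff_has_vector_derivative)
  qed (use True in simp)
  then have "((\<lambda>x. 1 / sqrt (D - x\<^sup>2)) has_integral pi) {- sqrt D..sqrt D}"
    using True by simp
  then have "(?f has_integral pi) UNIV"
    by (subst has_integral_restrict_UNIV)
  moreover have "0 \<le> ?f x" for x using abs[of x] by auto
  ultimately have "(\<integral>\<^sup>+x. ennreal (?f x) \<partial>lborel) = ennreal pi"
    by (intro nn_integral_has_integral_lborel) auto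
  moreover have "ennreal (?f x) = inv_sqrt D (x\<^sup>2)" for x
    unfolding abs inv_sqrt_def by auto
  ultimately show ?thesis using True by simp
qed

text \<open>
  The integral of the kernel over a horocycle depends on the kernel radius only through its support.  This is what
  makes the wave kernel computable.
\<close>

lemma nn_integral_inv_sqrt_horocycle:
  assumes a: "0 < a"
  shows "(\<integral>\<^sup>+x. inv_sqrt q (p + (x - c)\<^sup>2 / a) \<partial>lborel) = (if p < q then ennreal (pi * sqrt a) else 0)"
proof -
  have "(\<integral>\<^sup>+x. inv_sqrt q (p + (x - c)\<^sup>2 / a) \<partial>lborel)
      = ennreal (sqrt a) * (\<integral>\<^sup>+x. inv_sqrt q (p + (c + sqrt a * x - c)\<^sup>2 / a) \<partial>lborel)"
    using a nn_integral_real_affine[of "\<lambda>x. inv_sqrt q (p + (x - c)\<^sup>2 / a)" "sqrt a" c] by simp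
  also have "(\<integral>\<^sup>+x. inv_sqrt q (p + (c + sqrt a * x - c)\<^sup>2 / a) \<partial>lborel) = (\<integral>\<^sup>+x. inv_sqrt (q - p) (x\<^sup>2) \<partial>lborel)"
    using a by (intro nn_integral_cong) (simp add: inv_sqrt_def power_mult_distrib algebra_simps less_diff_eq)
  also have "\<dots> = (if 0 < q - p then ennreal pi else 0)"
    by (rule nn_integral_inv_sqrt_square)
  finally show ?thesis
    using a by (simp add: ennreal_mult[symmetric] mult.commute)
qed

lemma nn_integral_inv_sqrt_tail:
  assumes "p \<le> q"
  shows "(\<integral>\<^sup>+u. inv_sqrt q u * indicator {p..} u \<partial>lborel) = ennreal (2 * sqrt (q - p))"
proof -
  let ?f = "\<lambda>u. if u \<in> {p..q} then 1 / sqrt (q - u) else 0"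
  have "((\<lambda>u. 1 / sqrt (q - u)) has_integral (- 2 * sqrt (q - q) - (- 2 * sqrt (q - p)))) {p..q}"
  proof (rule fundamental_theorem_of_calculus_interior)
    show "continuous_on {p..q} (\<lambda>u. - 2 * sqrt (q - u))" by (intro continuous_intros)
    fix u assume "u \<in> {p<..<q}"
    then have "((\<lambda>u. - 2 * sqrt (q - u)) has_real_derivative 1 / sqrt (q - u)) (at u)"
      by (auto intro!: derivative_eq_intros simp: field_simps)
    then show "((\<lambda>u. - 2 * sqrt (q - u)) has_vector_derivative 1 / sqrt (q - u)) (at u)"
      by (simp add: has_real_derivative_iff_has_vector_derivative)
  qed (rule assms)
  then have "(?f has_integral (2 * sqrt (q - p))) UNIV"
    by (subst has_integral_restrict_UNIV) simp
  then have "(\<integral>\<^sup>+u. ennreal (?f u) \<partial>lborel) = ennreal (2 * sqrt (q - p))"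
    by (intro nn_integral_has_integral_lborel) auto
  moreover have "ennreal (?f u) = inv_sqrt q u * indicator {p..} u" for u
    by (auto simp: inv_sqrt_def split: split_indicator)
  ultimately show ?thesis by simp
qed

definition gap :: "real \<Rightarrow> real" where
  "gap s = 2 * cosh s - 2"

lemma gap_nonneg: "0 \<le> gap s"
  using cosh_real_ge_1[of s] by (simp add: gap_def)

lemma gap_minus [simp]: "gap (- s) = gap s" and gap_0 [simp]: "gap 0 = 0"
  by (simp_all add: gap_def)

lemma gap_less_iff: "gap s < gap t \<longleftrightarrow> \<bar>s\<bar> < \<bar>t\<bar>"
  using cosh_real_nonneg_le_iff[of "\<bar>t\<bar>" "\<bar>s\<bar>"] by (simp add: gap_def not_le[symmetric])

lemma gap_eq_iff: "gap s = gap t \<longleftrightarrow> \<bar>s\<bar> = \<bar>t\<bar>"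
  by (simp add: gap_def)

lemma gap_sinh: "gap s = (2 * sinh (s / 2))\<^sup>2"
  using cosh_add[of "s / 2" "s / 2"] cosh_square_eq[of "s / 2"]
  by (simp add: gap_def power_mult_distrib power2_eq_square)

lemma continuous_on_gap [continuous_intros]: "continuous_on S f \<Longrightarrow> continuous_on S (\<lambda>x. gap (f x))"
  unfolding gap_def by (intro continuous_intros)

lemma measurable_gap [measurable]: "gap \<in> borel_measurable borel"
  by (intro borel_measurable_continuous_onI continuous_intros)

lemma measurable_hyp_gap [measurable]:
  assumes [measurable]: "f \<in> borel_measurable M" "g \<in> borel_measurable M"
  shows "(\<lambda>x. hyp_gap (f x) (g x)) \<in> borel_measurable M"
  unfolding hyp_gap_def by measurable

lemma hyp_gap_commute: "hyp_gap z w = hyp_gap w z"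
  by (simp add: hyp_gap_def norm_minus_commute mult.commute)

lemma hyp_gap_nonneg: "0 < Im z \<Longrightarrow> 0 < Im w \<Longrightarrow> 0 \<le> hyp_gap z w"
  by (simp add: hyp_gap_def)

text \<open>
  Along a horocycle the gap is a constant plus a multiple of the squared Euclidean displacement, so integrating a
  radial function over a horocycle is an Abel transform.
\<close>

lemma hyp_gap_horocyclic:
  "hyp_gap (Complex x (exp b)) (Complex y (exp c)) = gap (b - c) + (y - x)\<^sup>2 / exp (b + c)"
proof -
  have "gap (b - c) = (exp b - exp c)\<^sup>2 / (exp b * exp c)"
    by (simp add: gap_def cosh_def exp_diff field_simps power2_eq_square)
  then show ?thesis
    by (simp add: hyp_gap_def cmod_power2 exp_add add_divide_distrib power2_commute)
qed

lemma hyp_gap_i: "hyp_gap \<i> w = hyp_gap (Complex 0 (exp 0)) w"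
  by (simp add: Complex_eq)

lemma two_point_homogeneous:
  assumes z: "0 < Im z" and w: "0 < Im w"
  obtains A :: "real^2^2" and t where "det A = 1" "mobius A z = \<i>" "mobius A w = Complex 0 (exp t)"
    "0 \<le> t" "gap t = hyp_gap z w"
proof -
  \<comment> \<open>First \<open>z\<close> is moved to \<open>\<i>\<close> by \<open>B\<close>, then the image \<open>v\<close> of \<open>w\<close> to the imaginary axis by a rotation \<open>C\<close> about \<open>\<i>\<close>;
    the inversion \<open>D\<close> corrects the sign of \<open>t\<close>.\<close>
  have mob: "mobius (vector [vector [a, b], vector [c, d]]) v = (of_real a * v + of_real b) / (of_real c * v + of_real d)"
    for a b c d :: real and v
    by (simp add: mobius_def)
  have dt: "det (vector [vector [a, b], vector [c, d]] :: real^2^2) = a * d - b * c" for a b c d :: real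
    by (simp add: det_2)
  define y where "y = sqrt (Im z)"
  have y: "y > 0" "y * y = Im z" using z by (auto simp: y_def)
  define B :: "real^2^2" where "B = vector [vector [1 / y, - Re z / y], vector [0, y]]"
  have B: "det B = 1" using y by (simp add: B_def dt)
  have Bz: "mobius B z = \<i>"
    unfolding B_def mob using y z
    by (simp add: complex_eq_iff Re_divide Im_divide power2_eq_square field_simps)
  define v where "v = mobius B w"
  have v: "0 < Im v" unfolding v_def by (rule Im_mobius_pos[OF B w])
  define p where "p = (1 - (cmod v)\<^sup>2) / 2"
  \<comment> \<open>The rotation by the half angle of \<open>\<phi>\<close> sends \<open>v\<close> to a point whose real part is a multiple of this expression.\<close>
  obtain \<phi> where \<phi>: "p * sin \<phi> + Re v * cos \<phi> = 0"
  proof (cases "p = 0 \<and> Re v = 0")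
    case True then show ?thesis using that[of 0] by simp
  next
    case False
    define m where "m = sqrt (p\<^sup>2 + (Re v)\<^sup>2)"
    have pos: "p\<^sup>2 + (Re v)\<^sup>2 > 0" using False by (simp add: sum_power2_gt_zero_iff)
    then have m: "m > 0" "m\<^sup>2 = p\<^sup>2 + (Re v)\<^sup>2" by (simp_all add: m_def)
    have "(p / m)\<^sup>2 + (- Re v / m)\<^sup>2 = (p\<^sup>2 + (Re v)\<^sup>2) / m\<^sup>2"
      by (simp add: power_divide add_divide_distrib)
    also have "\<dots> = 1" unfolding m(2)[symmetric] using m(1) by simp
    finally have "(p / m)\<^sup>2 + (- Re v / m)\<^sup>2 = 1" .
    then obtain \<phi> where "p / m = cos \<phi>" "- Re v / m = sin \<phi>"
      using sincos_total_2pi by blast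
    then have "p = m * cos \<phi>" "Re v = - (m * sin \<phi>)" using m by (auto simp: field_simps)
    then show ?thesis using that[of \<phi>] by simp
  qed
  define c s where "c = cos (\<phi> / 2)" and "s = sin (\<phi> / 2)"
  have cs: "c\<^sup>2 + s\<^sup>2 = 1" by (simp add: c_def s_def)
  have dbl: "sin \<phi> = 2 * s * c" "cos \<phi> = c\<^sup>2 - s\<^sup>2"
    using sin_double[of "\<phi> / 2"] cos_double[of "\<phi> / 2"] by (simp_all add: c_def s_def)
  define C :: "real^2^2" where "C = vector [vector [c, s], vector [- s, c]]"
  have C: "det C = 1" using cs by (simp add: C_def dt power2_eq_square)
  have nz: "c \<noteq> 0 \<or> s \<noteq> 0" using cs by auto
  have Ci: "mobius C \<i> = \<i>"
  proof -
    have "of_real (- s) * \<i> + of_real c \<noteq> 0" using nz by (auto simp: complex_eq_iff)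
    moreover have "of_real c * \<i> + of_real s = \<i> * (of_real (- s) * \<i> + of_real c)"
      by (simp add: complex_eq_iff)
    ultimately show ?thesis unfolding C_def mob by simp
  qed
  have Re0: "Re (mobius C v) = 0"
  proof -
    have "(c * Re v + s) * (- s * Re v + c) + (c * Im v) * (- s * Im v)
      = p * (2 * s * c) + Re v * (c\<^sup>2 - s\<^sup>2)"
      unfolding p_def cmod_power2 by (simp add: field_simps power2_eq_square)
    also have "\<dots> = 0" using \<phi> unfolding dbl .
    finally show ?thesis
      unfolding C_def mob by (simp add: Re_divide)
  qed
  define D :: "real^2^2" where "D = vector [vector [0, -1], vector [1, 0]]"
  have D: "det D = 1" "\<And>v. mobius D v = - 1 / v" by (simp_all add: D_def dt mob)
  have pos: "0 < Im (mobius C v)" by (rule Im_mobius_pos[OF C v])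
  define t where "t = ln (Im (mobius C v))"
  have Cv: "mobius C v = Complex 0 (exp t)"
    using Re0 pos by (simp add: t_def complex_eq_iff)
  have dCB: "det (C ** B) = 1" "mobius (C ** B) z = \<i>" "mobius (C ** B) w = Complex 0 (exp t)"
    using B C Bz Ci Cv by (simp_all add: det_mul mobius_mult z w v_def)
  have gap: "gap t = hyp_gap z w"
    using hyp_gap_mobius[OF dCB(1) z w] unfolding dCB hyp_gap_i hyp_gap_horocyclic by simp
  show thesis
  proof (cases "0 \<le> t")
    case True
    then show thesis using that dCB gap by blast
  next
    case False
    have "det (D ** (C ** B)) = 1" using D dCB by (simp add: det_mul)
    moreover have "mobius (D ** (C ** B)) z = \<i>"
      using D dCB by (simp add: mobius_mult z)
    moreover have "mobius (D ** (C ** B)) w = Complex 0 (exp (- t))"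
      using D dCB by (simp add: mobius_mult w complex_eq_iff Re_divide Im_divide exp_minus power2_eq_square field_simps)
    ultimately show thesis using that[of "D ** (C ** B)" "- t"] False gap by simp
  qed
qed

section \<open>The wave kernel\<close>

lemma measurable_cosh_sinh [measurable]:
  "(cosh :: real \<Rightarrow> real) \<in> borel_measurable borel" "(sinh :: real \<Rightarrow> real) \<in> borel_measurable borel"
  by (intro borel_measurable_continuous_onI continuous_intros)+

text \<open>
  Polar coordinates: circles of radius \<open>s\<close> about a point bound discs of area \<open>\<pi> gap s\<close>.
\<close>

lemma nn_integral_hyp_gap:
  assumes [measurable]: "\<psi> \<in> borel_measurable borel" and z: "0 < Im z"
  shows "(\<integral>\<^sup>+w. \<psi> (hyp_gap z w) \<partial>nu) = ennreal pi * (\<integral>\<^sup>+u. \<psi> u * indicator {0..} u \<partial>lborel)"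
proof -
  define T where "T p = (\<integral>\<^sup>+x. \<psi> (p + x\<^sup>2) \<partial>lborel)" for p
  have [measurable]: "T \<in> borel_measurable borel" unfolding T_def by measurable
  define I where "I = (\<integral>\<^sup>+w. \<psi> (hyp_gap \<i> w) \<partial>nu)"
  have I1: "I = (\<integral>\<^sup>+b. T (gap b) * ennreal (exp (- b / 2)) \<partial>lborel)"
  proof -
    have "(\<integral>\<^sup>+x. \<psi> (hyp_gap \<i> (Complex x (exp b))) \<partial>lborel) * ennreal (exp (- b)) = T (gap b) * ennreal (exp (- b / 2))" for b
    proof -
      have "(\<integral>\<^sup>+x. \<psi> (hyp_gap \<i> (Complex x (exp b))) \<partial>lborel) = (\<integral>\<^sup>+x. \<psi> (gap b + x\<^sup>2 / exp b) \<partial>lborel)"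
        unfolding hyp_gap_i hyp_gap_horocyclic by simp
      also have "\<dots> = ennreal (exp (b / 2)) * (\<integral>\<^sup>+x. \<psi> (gap b + (0 + exp (b / 2) * x)\<^sup>2 / exp b) \<partial>lborel)"
        using nn_integral_real_affine[of "\<lambda>x. \<psi> (gap b + x\<^sup>2 / exp b)" "exp (b / 2)" 0] by simp
      also have "(\<integral>\<^sup>+x. \<psi> (gap b + (0 + exp (b / 2) * x)\<^sup>2 / exp b) \<partial>lborel) = T (gap b)"
        by (simp add: T_def power_mult_distrib exp_double[symmetric])
      finally have "(\<integral>\<^sup>+x. \<psi> (hyp_gap \<i> (Complex x (exp b))) \<partial>lborel) = ennreal (exp (b / 2)) * T (gap b)" .
      moreover have "ennreal (exp (b / 2)) * ennreal (exp (- b)) = ennreal (exp (- b / 2))"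
        by (simp add: ennreal_mult[symmetric] exp_add[symmetric])
      ultimately show ?thesis by (simp add: mult_ac)
    qed
    then show ?thesis unfolding I_def by (simp add: nn_integral_nu)
  qed
  have I2: "I = (\<integral>\<^sup>+b. T (gap b) * ennreal (exp (b / 2)) \<partial>lborel)"
    unfolding I1 using nn_integral_real_affine[of "\<lambda>b. T (gap b) * ennreal (exp (- b / 2))" "-1" 0] by simp
  have range: "range (\<lambda>b::real. 2 * sinh (b / 2)) = UNIV"
  proof -
    have "y \<in> range (\<lambda>b::real. 2 * sinh (b / 2))" for y :: real
      by (rule image_eqI[of _ _ "2 * arsinh (y / 2)"]) simp_all
    then show ?thesis by blast
  qed
  \<comment> \<open>The weights \<open>exp (- b/2)\<close> and \<open>exp (b/2)\<close> give the same integral, since \<open>gap\<close> is even; their mean is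
    \<open>cosh (b/2)\<close>, the derivative of \<open>2 sinh (b/2)\<close>, whose square is \<open>gap b\<close>.\<close>
  have "2 * I = I + I" by (rule mult_2)
  also have "\<dots> = (\<integral>\<^sup>+b. T (gap b) * ennreal (exp (- b / 2)) \<partial>lborel) + (\<integral>\<^sup>+b. T (gap b) * ennreal (exp (b / 2)) \<partial>lborel)"
    using I1 I2 by simp
  also have "\<dots> = (\<integral>\<^sup>+b. T (gap b) * ennreal (exp (- b / 2)) + T (gap b) * ennreal (exp (b / 2)) \<partial>lborel)"
    by (rule nn_integral_add[symmetric]) measurable
  also have "\<dots> = (\<integral>\<^sup>+b. 2 * (T ((2 * sinh (b / 2))\<^sup>2) * ennreal (cosh (b / 2))) \<partial>lborel)"
  proof (intro nn_integral_cong)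
    fix b :: real
    have "ennreal (exp (- b / 2)) + ennreal (exp (b / 2)) = ennreal (2 * cosh (b / 2))"
      by (simp add: ennreal_plus[symmetric] cosh_def del: ennreal_plus)
    also have "\<dots> = 2 * ennreal (cosh (b / 2))" by (simp add: ennreal_mult)
    finally have "ennreal (exp (- b / 2)) + ennreal (exp (b / 2)) = 2 * ennreal (cosh (b / 2))" .
    then show "T (gap b) * ennreal (exp (- b / 2)) + T (gap b) * ennreal (exp (b / 2)) = 2 * (T ((2 * sinh (b / 2))\<^sup>2) * ennreal (cosh (b / 2)))"
      unfolding gap_sinh[symmetric] by (simp add: distrib_left[symmetric] mult_ac)
  qed
  also have "\<dots> = 2 * (\<integral>\<^sup>+b. T ((2 * sinh (b / 2))\<^sup>2) * ennreal (cosh (b / 2)) \<partial>lborel)"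
    by (rule nn_integral_cmult) measurable
  also have "(\<integral>\<^sup>+b. T ((2 * sinh (b / 2))\<^sup>2) * ennreal (cosh (b / 2)) \<partial>lborel) = (\<integral>\<^sup>+v. T (v\<^sup>2) * indicator UNIV v \<partial>lborel)"
    by (rule nn_integral_real_substitution[where f="\<lambda>v. T (v\<^sup>2)"])
       (auto intro!: derivative_eq_intros continuous_intros range)
  also have "\<dots> = ennreal pi * (\<integral>\<^sup>+u. \<psi> u * indicator {0..} u \<partial>lborel)"
    unfolding T_def using nn_integral_sum_of_squares[of \<psi>] by (simp add: add.commute)
  finally have I: "I = ennreal pi * (\<integral>\<^sup>+u. \<psi> u * indicator {0..} u \<partial>lborel)"
    by (simp add: ennreal_mult_cancel_left)
  obtain A :: "real^2^2" where A: "det A = 1" "mobius A z = \<i>"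
    using two_point_homogeneous[OF z z] by metis
  have "(\<integral>\<^sup>+w. \<psi> (hyp_gap z w) \<partial>nu) = (\<integral>\<^sup>+w. \<psi> (hyp_gap \<i> (mobius A w)) \<partial>nu)"
    using hyp_gap_mobius[OF A(1) z] A(2) by (intro nn_integral_nu_cong) simp
  also have "\<dots> = I"
    unfolding I_def by (rule nn_integral_nu_mobius[OF A(1)]) measurable
  finally show ?thesis using I by simp
qed

text \<open>
  Transfers almost everywhere statements about radial functions to points of the plane.
\<close>

lemma AE_hyp_gap:
  assumes "AE u in lborel. 0 \<le> u \<longrightarrow> P u" and z: "0 < Im z"
  shows "AE w in nu. P (hyp_gap z w)"
proof -
  obtain N where N: "{u \<in> space lborel. \<not> (0 \<le> u \<longrightarrow> P u)} \<subseteq> N" "N \<in> null_sets lborel"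
    using assms(1) by (auto simp: eventually_ae_filter)
  then have [measurable]: "N \<in> sets borel" by auto
  have "{w. hyp_gap z w \<in> N} \<in> sets nu" by measurable
  then have "emeasure nu {w. hyp_gap z w \<in> N} = (\<integral>\<^sup>+w. indicator {w. hyp_gap z w \<in> N} w \<partial>nu)"
    by (rule nn_integral_indicator[symmetric])
  also have "\<dots> = (\<integral>\<^sup>+w. indicator N (hyp_gap z w) \<partial>nu)"
    by (intro nn_integral_cong) (simp add: indicator_def)
  also have "\<dots> = ennreal pi * (\<integral>\<^sup>+u. indicator N u * indicator {0..} u \<partial>lborel)"
    by (rule nn_integral_hyp_gap[OF _ z]) measurable
  also have "(\<integral>\<^sup>+u. indicator N u * indicator {0..} u \<partial>lborel) = (\<integral>\<^sup>+u. 0 \<partial>(lborel :: real measure))"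
    by (intro nn_integral_cong_AE eventually_mono[OF AE_not_in[OF N(2)]]) simp
  finally have "{w. hyp_gap z w \<in> N} \<in> null_sets nu"
    by (intro null_setsI) auto
  then have "AE w in nu. hyp_gap z w \<notin> N"
    by (rule AE_not_in[THEN AE_mp]) simp
  with AE_nu show ?thesis
    by eventually_elim (use N(1) z hyp_gap_nonneg in fastforce)
qed

lemma gap_mono: "0 \<le> s \<Longrightarrow> s \<le> t \<Longrightarrow> gap s \<le> gap t"
  using gap_less_iff[of t s] by (simp add: not_less[symmetric])

text \<open>
  Up to the factor \<open>2 \<pi>\<close>, the kernel of \<open>sin (s A) / A\<close> with \<open>A = sqrt (- \<Delta> - 1/4)\<close>, that is, the fundamental solution
  of the shifted wave equation at time \<open>s\<close>.
\<close>

definition wave_kernel :: "real \<Rightarrow> complex \<Rightarrow> complex \<Rightarrow> ennreal" where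
  "wave_kernel s z w = inv_sqrt (gap s) (hyp_gap z w)"

lemma measurable_wave_kernel [measurable]:
  assumes [measurable]: "h \<in> borel_measurable M" "f \<in> borel_measurable M" "g \<in> borel_measurable M"
  shows "(\<lambda>x. wave_kernel (h x) (f x) (g x)) \<in> borel_measurable M"
  unfolding wave_kernel_def by measurable

lemma wave_kernel_commute: "wave_kernel s z w = wave_kernel s w z"
  by (simp add: wave_kernel_def hyp_gap_commute)

lemma wave_kernel_mobius:
  fixes A :: "real^2^2"
  shows "det A = 1 \<Longrightarrow> 0 < Im z \<Longrightarrow> 0 < Im w \<Longrightarrow> wave_kernel s (mobius A z) (mobius A w) = wave_kernel s z w"
  by (simp add: wave_kernel_def hyp_gap_mobius)

lemma sqrt_gap: "0 \<le> s \<Longrightarrow> sqrt (gap s) = 2 * sinh (s / 2)"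
  unfolding gap_sinh real_sqrt_abs by simp

lemma nn_integral_wave_kernel:
  assumes "0 < Im z" "0 \<le> s"
  shows "(\<integral>\<^sup>+w. wave_kernel s z w \<partial>nu) = ennreal (4 * pi * sinh (s / 2))"
proof -
  have "(\<integral>\<^sup>+w. wave_kernel s z w \<partial>nu) = ennreal pi * ennreal (2 * sqrt (gap s - 0))"
    unfolding wave_kernel_def using assms
    by (subst nn_integral_hyp_gap) (auto simp: nn_integral_inv_sqrt_tail gap_nonneg)
  then show ?thesis
    using assms by (simp add: sqrt_gap ennreal_mult[symmetric] mult_ac)
qed

lemma nn_integral_wave_kernel_horocycle:
  assumes "0 \<le> s"
  shows "(\<integral>\<^sup>+y. wave_kernel s (Complex x (exp b)) (Complex y (exp c)) \<partial>lborel)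
    = ennreal (pi * exp ((b + c) / 2)) * indicator {- s<..<s} (b - c)"
proof -
  have "sqrt (exp (b + c)) = exp ((b + c) / 2)"
    by (rule real_sqrt_unique) (simp_all add: exp_double[symmetric])
  then show ?thesis
    unfolding wave_kernel_def hyp_gap_horocyclic using assms
    by (subst nn_integral_inv_sqrt_horocycle) (auto simp: gap_less_iff abs_less_iff split: split_indicator)
qed

section \<open>Composition of wave kernels\<close>

definition wave_conv :: "real \<Rightarrow> real \<Rightarrow> complex \<Rightarrow> complex \<Rightarrow> ennreal" where
  "wave_conv s t z w = (\<integral>\<^sup>+v. wave_kernel s z v * wave_kernel t v w \<partial>nu)"

lemma measurable_wave_conv [measurable]:
  assumes [measurable]: "f \<in> borel_measurable M" "g \<in> borel_measurable M"
  shows "(\<lambda>x. wave_conv s t (f x) (g x)) \<in> borel_measurable M"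
  unfolding wave_conv_def by measurable

lemma wave_conv_mobius:
  fixes A :: "real^2^2"
  assumes A: "det A = 1" and "0 < Im z" "0 < Im w"
  shows "wave_conv s t (mobius A z) (mobius A w) = wave_conv s t z w"
proof -
  have "wave_conv s t (mobius A z) (mobius A w)
      = (\<integral>\<^sup>+v. wave_kernel s (mobius A z) (mobius A v) * wave_kernel t (mobius A v) (mobius A w) \<partial>nu)"
    unfolding wave_conv_def
    by (rule nn_integral_nu_mobius[OF A, symmetric]) measurable
  also have "\<dots> = wave_conv s t z w"
    unfolding wave_conv_def using assms by (intro nn_integral_nu_cong) (simp add: wave_kernel_mobius)
  finally show ?thesis .
qed

text \<open>
  A kernel invariant under the group is a function of the distance alone.
\<close>

lemma wave_conv_radial:
  assumes "0 < Im z" "0 < Im w"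
  shows "wave_conv s t z w = wave_conv s t \<i> (Complex 0 (exp (arcosh (hyp_gap z w / 2 + 1))))"
proof -
  obtain A :: "real^2^2" and r where A: "det A = 1" "mobius A z = \<i>" "mobius A w = Complex 0 (exp r)"
    "0 \<le> r" "gap r = hyp_gap z w"
    using two_point_homogeneous[OF assms] .
  have "r = arcosh (hyp_gap z w / 2 + 1)"
    using A(4) arcosh_cosh_real[of r] by (simp add: A(5)[symmetric] gap_def diff_divide_distrib)
  then show ?thesis
    using wave_conv_mobius[OF A(1) assms, of s t] A by simp
qed

text \<open>
  By the horocyclic integral of both factors, the horocyclic transform of the composition is the convolution of the
  indicator functions of \<open>(- s, s)\<close> and \<open>(- t, t)\<close>.
\<close>

lemma nn_integral_wave_conv_horocycle:
  assumes st: "0 \<le> t" "t \<le> s"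
  shows "(\<integral>\<^sup>+y. wave_conv s t \<i> (Complex y (exp c)) \<partial>lborel)
    = ennreal (pi\<^sup>2 * exp (c / 2)) * ennreal (max 0 (s + t - max (s - t) \<bar>c\<bar>))"
proof -
  have "(\<integral>\<^sup>+y. wave_conv s t \<i> (Complex y (exp c)) \<partial>lborel)
      = (\<integral>\<^sup>+v. \<integral>\<^sup>+y. wave_kernel s \<i> v * wave_kernel t v (Complex y (exp c)) \<partial>lborel \<partial>nu)"
    unfolding wave_conv_def
    by (rule nu_lborel.Fubini') measurable
  also have "\<dots> = (\<integral>\<^sup>+v. wave_kernel s \<i> v * (\<integral>\<^sup>+y. wave_kernel t v (Complex y (exp c)) \<partial>lborel) \<partial>nu)"
    by (intro nn_integral_cong nn_integral_cmult) measurable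
  also have "\<dots> = (\<integral>\<^sup>+b. (\<integral>\<^sup>+x. wave_kernel s \<i> (Complex x (exp b)) *
      (\<integral>\<^sup>+y. wave_kernel t (Complex x (exp b)) (Complex y (exp c)) \<partial>lborel) \<partial>lborel) * ennreal (exp (- b)) \<partial>lborel)"
    by (rule nn_integral_nu) measurable
  also have "\<dots> = (\<integral>\<^sup>+b. (\<integral>\<^sup>+x. wave_kernel s \<i> (Complex x (exp b)) \<partial>lborel)
      * (ennreal (pi * exp ((b + c) / 2)) * indicator {- t<..<t} (b - c)) * ennreal (exp (- b)) \<partial>lborel)"
    unfolding nn_integral_wave_kernel_horocycle[OF st(1)]
    by (subst nn_integral_multc) simp_all
  also have "\<dots> = (\<integral>\<^sup>+b. ennreal (pi\<^sup>2 * exp (c / 2)) * indicator ({- s<..<s} \<inter> {c - t<..<c + t}) b \<partial>lborel)"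
  proof (intro nn_integral_cong)
    fix b
    have K: "(\<integral>\<^sup>+x. wave_kernel s \<i> (Complex x (exp b)) \<partial>lborel) = ennreal (pi * exp (b / 2)) * indicator {- s<..<s} b"
      using nn_integral_wave_kernel_horocycle[of s 0 0 b] st by (auto simp: Complex_eq indicator_def)
    have E: "pi * exp (b / 2) * (pi * exp ((b + c) / 2)) * exp (- b) = pi\<^sup>2 * exp (c / 2)"
      by (simp add: power2_eq_square exp_add[symmetric] mult_ac) (simp add: exp_add[symmetric] mult.assoc[symmetric] field_simps)
    show "(\<integral>\<^sup>+x. wave_kernel s \<i> (Complex x (exp b)) \<partial>lborel)
      * (ennreal (pi * exp ((b + c) / 2)) * indicator {- t<..<t} (b - c)) * ennreal (exp (- b))
      = ennreal (pi\<^sup>2 * exp (c / 2)) * indicator ({- s<..<s} \<inter> {c - t<..<c + t}) b"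
      unfolding K E[symmetric] by (auto simp: ennreal_mult split: split_indicator)
  qed
  also have "\<dots> = ennreal (pi\<^sup>2 * exp (c / 2)) * emeasure lborel ({- s<..<s} \<inter> {c - t<..<c + t})"
    by (simp add: nn_integral_cmult)
  also have "{- s<..<s} \<inter> {c - t<..<c + t} = {max (- s) (c - t)<..<min s (c + t)}"
    by auto
  also have "emeasure lborel {max (- s) (c - t)<..<min s (c + t)} = ennreal (max 0 (min s (c + t) - max (- s) (c - t)))"
  proof (cases "max (- s) (c - t) \<le> min s (c + t)")
    case True
    then show ?thesis by (subst emeasure_lborel_Ioo) auto
  next
    case False
    then have "{max (- s) (c - t)<..<min s (c + t)} = {}" by auto
    moreover have "max 0 (min s (c + t) - max (- s) (c - t)) = 0" using False by linarith
    ultimately show ?thesis by simp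
  qed
  also have "max 0 (min s (c + t) - max (- s) (c - t)) = max 0 (s + t - max (s - t) \<bar>c\<bar>)"
    using st by (auto simp: max_def min_def abs_if)
  finally show ?thesis .
qed

text \<open>
  The kernel form of \<open>sin (s A) sin (t A) = (1/2) (cos ((s - t) A) - cos ((s + t) A))\<close>.  Both sides are radial, and
  their Abel transforms agree because the convolution of two centred intervals is a superposition of centred
  intervals.
\<close>

lemma wave_conv_eq:
  assumes st: "0 \<le> t" "t \<le> s" and z: "0 < Im z"
  shows "AE w in nu. wave_conv s t z w = ennreal pi * (\<integral>\<^sup>+\<sigma>. wave_kernel \<sigma> z w * indicator {s - t..s + t} \<sigma> \<partial>lborel)"
proof -
  define F where "F u = wave_conv s t \<i> (Complex 0 (exp (arcosh (u / 2 + 1))))" for u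
  define G where "G u = ennreal pi * (\<integral>\<^sup>+\<sigma>. inv_sqrt (gap \<sigma>) u * indicator {s - t..s + t} \<sigma> \<partial>lborel)" for u
  have [measurable]: "(arcosh :: real \<Rightarrow> real) \<in> borel_measurable borel"
    unfolding arcosh_def[abs_def] by measurable
  have [measurable]: "F \<in> borel_measurable borel" "G \<in> borel_measurable borel"
    unfolding F_def G_def by measurable
  have F: "wave_conv s t z w = F (hyp_gap z w)" if "0 < Im z" "0 < Im w" for z w
    unfolding F_def by (rule wave_conv_radial[OF that])
  have abel: "(\<integral>\<^sup>+y. H (hyp_gap \<i> (Complex y (exp c))) \<partial>lborel) = ennreal (exp (c / 2)) * (\<integral>\<^sup>+x. H (gap c + x\<^sup>2) \<partial>lborel)"
    if [measurable]: "H \<in> borel_measurable borel" for H :: "real \<Rightarrow> ennreal" and c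
  proof -
    have "(\<integral>\<^sup>+y. H (hyp_gap \<i> (Complex y (exp c))) \<partial>lborel) = (\<integral>\<^sup>+y. H (gap c + y\<^sup>2 / exp c) \<partial>lborel)"
      unfolding hyp_gap_i hyp_gap_horocyclic by simp
    also have "\<dots> = ennreal (exp (c / 2)) * (\<integral>\<^sup>+x. H (gap c + (0 + exp (c / 2) * x)\<^sup>2 / exp c) \<partial>lborel)"
      using nn_integral_real_affine[of "\<lambda>y. H (gap c + y\<^sup>2 / exp c)" "exp (c / 2)" 0] by simp
    finally show ?thesis by (simp add: power_mult_distrib exp_double[symmetric])
  qed
  have "AE u in lborel. 0 \<le> u \<longrightarrow> F u = G u"
  proof (rule Abel_transform_injective)
    fix p :: real assume p: "0 \<le> p"
    define c where "c = arcosh (p / 2 + 1)"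
    have c: "gap c = p" using p by (simp add: c_def gap_def cosh_arcosh_real)
    have "(\<integral>\<^sup>+y. G (hyp_gap \<i> (Complex y (exp c))) \<partial>lborel)
        = ennreal pi * (\<integral>\<^sup>+y. \<integral>\<^sup>+\<sigma>. wave_kernel \<sigma> \<i> (Complex y (exp c)) * indicator {s - t..s + t} \<sigma> \<partial>lborel \<partial>lborel)"
      unfolding G_def wave_kernel_def by (rule nn_integral_cmult) measurable
    also have "(\<integral>\<^sup>+y. \<integral>\<^sup>+\<sigma>. wave_kernel \<sigma> \<i> (Complex y (exp c)) * indicator {s - t..s + t} \<sigma> \<partial>lborel \<partial>lborel)
        = (\<integral>\<^sup>+\<sigma>. \<integral>\<^sup>+y. wave_kernel \<sigma> \<i> (Complex y (exp c)) * indicator {s - t..s + t} \<sigma> \<partial>lborel \<partial>lborel)"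
      by (rule lborel_pair.Fubini') measurable
    also have "\<dots> = (\<integral>\<^sup>+\<sigma>. ennreal (pi * exp (c / 2)) * indicator ({s - t..s + t} \<inter> {\<bar>c\<bar><..}) \<sigma> \<partial>lborel)"
    proof (intro nn_integral_cong)
      fix \<sigma>
      have "(\<integral>\<^sup>+y. wave_kernel \<sigma> \<i> (Complex y (exp c)) \<partial>lborel) = ennreal (pi * exp (c / 2)) * indicator {- \<sigma><..<\<sigma>} c" if "0 \<le> \<sigma>"
        using nn_integral_wave_kernel_horocycle[OF that, of 0 0 c] by (auto simp: Complex_eq indicator_def)
      then show "(\<integral>\<^sup>+y. wave_kernel \<sigma> \<i> (Complex y (exp c)) * indicator {s - t..s + t} \<sigma> \<partial>lborel)
        = ennreal (pi * exp (c / 2)) * indicator ({s - t..s + t} \<inter> {\<bar>c\<bar><..}) \<sigma>"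
        using st by (cases "\<sigma> \<in> {s - t..s + t}") (auto simp: nn_integral_multc abs_less_iff split: split_indicator)
    qed
    also have "\<dots> = ennreal (pi * exp (c / 2)) * emeasure lborel ({s - t..s + t} \<inter> {\<bar>c\<bar><..})"
      by (simp add: nn_integral_cmult)
    also have "emeasure lborel ({s - t..s + t} \<inter> {\<bar>c\<bar><..}) = ennreal (max 0 (s + t - max (s - t) \<bar>c\<bar>))"
    proof (cases "\<bar>c\<bar> < s - t")
      case True
      then have "{s - t..s + t} \<inter> {\<bar>c\<bar><..} = {s - t..s + t}" by auto
      then show ?thesis using True st by simp
    next
      case False
      then have "{s - t..s + t} \<inter> {\<bar>c\<bar><..} = {\<bar>c\<bar><..s + t}" by auto
      then show ?thesis using False st by (cases "\<bar>c\<bar> \<le> s + t") (simp_all add: max_def)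
    qed
    also have "ennreal pi * (ennreal (pi * exp (c / 2)) * ennreal (max 0 (s + t - max (s - t) \<bar>c\<bar>)))
        = (\<integral>\<^sup>+y. wave_conv s t \<i> (Complex y (exp c)) \<partial>lborel)"
      unfolding nn_integral_wave_conv_horocycle[OF st]
      by (simp add: ennreal_mult[symmetric] power2_eq_square mult_ac)
    also have "\<dots> = (\<integral>\<^sup>+y. F (hyp_gap \<i> (Complex y (exp c))) \<partial>lborel)"
      by (simp add: F)
    finally have "ennreal (exp (c / 2)) * (\<integral>\<^sup>+x. F (p + x\<^sup>2) \<partial>lborel) = ennreal (exp (c / 2)) * (\<integral>\<^sup>+x. G (p + x\<^sup>2) \<partial>lborel)"
      by (simp add: abel c)
    then show "(\<integral>\<^sup>+x. F (p + x\<^sup>2) \<partial>lborel) = (\<integral>\<^sup>+x. G (p + x\<^sup>2) \<partial>lborel)"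
      by (simp add: ennreal_mult_cancel_left)
  next
    have total: "(\<integral>\<^sup>+u. G u * indicator {0..} u \<partial>lborel)
        = ennreal pi * (\<integral>\<^sup>+u. \<integral>\<^sup>+\<sigma>. inv_sqrt (gap \<sigma>) u * indicator {s - t..s + t} \<sigma> * indicator {0..} u \<partial>lborel \<partial>lborel)"
    proof -
      have inner: "(\<integral>\<^sup>+\<sigma>. inv_sqrt (gap \<sigma>) u * indicator {s - t..s + t} \<sigma> * indicator {0..} u \<partial>lborel)
        = (\<integral>\<^sup>+\<sigma>. inv_sqrt (gap \<sigma>) u * indicator {s - t..s + t} \<sigma> \<partial>lborel) * indicator {0..} u" for u
        by (rule nn_integral_multc) measurable
      show ?thesis
        unfolding G_def inner mult.assoc[of "ennreal pi"] by (rule nn_integral_cmult) measurable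
    qed
    have "(\<integral>\<^sup>+u. \<integral>\<^sup>+\<sigma>. inv_sqrt (gap \<sigma>) u * indicator {s - t..s + t} \<sigma> * indicator {0..} u \<partial>lborel \<partial>lborel)
        = (\<integral>\<^sup>+\<sigma>. \<integral>\<^sup>+u. inv_sqrt (gap \<sigma>) u * indicator {s - t..s + t} \<sigma> * indicator {0..} u \<partial>lborel \<partial>lborel)"
      by (rule lborel_pair.Fubini') measurable
    also have "\<dots> \<le> (\<integral>\<^sup>+\<sigma>. ennreal (2 * sqrt (gap (s + t))) * indicator {s - t..s + t} \<sigma> \<partial>lborel)"
    proof (intro nn_integral_mono)
      fix \<sigma>
      have "(\<integral>\<^sup>+u. inv_sqrt (gap \<sigma>) u * indicator {s - t..s + t} \<sigma> * indicator {0..} u \<partial>lborel)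
        = (\<integral>\<^sup>+u. inv_sqrt (gap \<sigma>) u * indicator {0..} u \<partial>lborel) * indicator {s - t..s + t} \<sigma>"
        by (subst nn_integral_multc[symmetric]) (simp_all add: mult_ac)
      also have "\<dots> = ennreal (2 * sqrt (gap \<sigma>)) * indicator {s - t..s + t} \<sigma>"
        using nn_integral_inv_sqrt_tail[OF gap_nonneg] by simp
      also have "\<dots> \<le> ennreal (2 * sqrt (gap (s + t))) * indicator {s - t..s + t} \<sigma>"
        using st by (auto split: split_indicator intro!: ennreal_leI gap_mono)
      finally show "(\<integral>\<^sup>+u. inv_sqrt (gap \<sigma>) u * indicator {s - t..s + t} \<sigma> * indicator {0..} u \<partial>lborel)
        \<le> ennreal (2 * sqrt (gap (s + t))) * indicator {s - t..s + t} \<sigma>" .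
    qed
    also have "\<dots> = ennreal (2 * sqrt (gap (s + t))) * ennreal (2 * t)"
      using st by (simp add: nn_integral_cmult_indicator)
    also have "\<dots> < \<infinity>" by (simp add: ennreal_mult_less_top)
    finally show "(\<integral>\<^sup>+u. G u * indicator {0..} u \<partial>lborel) < \<infinity>"
      unfolding total by (simp add: ennreal_mult_less_top)
  qed simp_all
  from AE_hyp_gap[OF this z] AE_nu show ?thesis
    by eventually_elim (simp add: F z G_def wave_kernel_def)
qed

section \<open>Unfolding over a fundamental domain\<close>

text \<open>
  A countable family of measure preserving isometries, closed under inverses, and a set whose translates are disjoint
  and cover almost everything.
\<close>

locale tiling =
  fixes G :: "'i set" and act :: "'i \<Rightarrow> complex \<Rightarrow> complex" and ginv :: "'i \<Rightarrow> 'i" and F :: "complex set"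
  assumes countable_G: "countable G"
    and measurable_act: "g \<in> G \<Longrightarrow> act g \<in> borel_measurable borel"
    and Im_act: "g \<in> G \<Longrightarrow> 0 < Im z \<Longrightarrow> 0 < Im (act g z)"
    and nn_integral_act: "g \<in> G \<Longrightarrow> f \<in> borel_measurable borel \<Longrightarrow> (\<integral>\<^sup>+z. f (act g z) \<partial>nu) = (\<integral>\<^sup>+z. f z \<partial>nu)"
    and hyp_gap_act: "g \<in> G \<Longrightarrow> 0 < Im z \<Longrightarrow> 0 < Im w \<Longrightarrow> hyp_gap (act g z) (act g w) = hyp_gap z w"
    and ginv: "g \<in> G \<Longrightarrow> ginv g \<in> G" "g \<in> G \<Longrightarrow> ginv (ginv g) = g"
    and act_ginv: "g \<in> G \<Longrightarrow> 0 < Im z \<Longrightarrow> act (ginv g) (act g z) = z"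
    and F: "F \<in> sets borel" "F \<subseteq> upper_half_plane"
    and disjoint: "g \<in> G \<Longrightarrow> h \<in> G \<Longrightarrow> z \<in> F \<Longrightarrow> w \<in> F \<Longrightarrow> act g z = act h w \<Longrightarrow> g = h"
    and cover: "AE z in nu. \<exists>g\<in>G. z \<in> act g ` F"
begin

lemma measurable_act' [measurable]:
  "g \<in> G \<Longrightarrow> f \<in> borel_measurable M \<Longrightarrow> (\<lambda>x. act g (f x)) \<in> borel_measurable M"
  using measurable_compose[of f M borel "act g" borel] measurable_act by blast

lemma sets_F [measurable]: "F \<in> sets borel" by (rule F(1))

lemma Im_F: "z \<in> F \<Longrightarrow> 0 < Im z" using F(2) by (auto simp: upper_half_plane_def)

lemma nn_integral_tiles:
  assumes h [measurable]: "h \<in> borel_measurable borel"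
  shows "(\<integral>\<^sup>+z. h z \<partial>nu) = (\<integral>\<^sup>+g. (\<integral>\<^sup>+w. indicator F w * h (act g w) \<partial>nu) \<partial>count_space G)"
proof -
  have one: "AE z in nu. (\<integral>\<^sup>+g. indicator F (act (ginv g) z) \<partial>count_space G) = (1::ennreal)"
    using cover AE_nu
  proof eventually_elim
    fix z assume "\<exists>g\<in>G. z \<in> act g ` F" and z: "0 < Im z"
    then obtain g w where g: "g \<in> G" "w \<in> F" "z = act g w" by blast
    have "act (ginv k) z \<in> F \<longleftrightarrow> k = g" if k: "k \<in> G" for k
    proof
      assume "act (ginv k) z \<in> F"
      moreover have "act k (act (ginv k) z) = z"
        using act_ginv[OF ginv(1)[OF k] z] ginv(2)[OF k] by simp
      ultimately show "k = g" using disjoint[OF k g(1) _ g(2)] g(3) by simp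
    next
      assume "k = g"
      then show "act (ginv k) z \<in> F" using g act_ginv[OF g(1) Im_F[OF g(2)]] by simp
    qed
    then have "(\<integral>\<^sup>+k. indicator F (act (ginv k) z) \<partial>count_space G) = (\<integral>\<^sup>+k. indicator {g} k \<partial>count_space G)"
      by (intro nn_integral_cong) (auto split: split_indicator)
    also have "\<dots> = 1" using g by simp
    finally show "(\<integral>\<^sup>+k. indicator F (act (ginv k) z) \<partial>count_space G) = (1::ennreal)" .
  qed
  have "(\<integral>\<^sup>+z. h z \<partial>nu) = (\<integral>\<^sup>+z. \<integral>\<^sup>+g. h z * indicator F (act (ginv g) z) \<partial>count_space G \<partial>nu)"
    by (intro nn_integral_cong_AE eventually_mono[OF one]) (simp add: nn_integral_cmult)
  also have "\<dots> = (\<integral>\<^sup>+g. \<integral>\<^sup>+z. h z * indicator F (act (ginv g) z) \<partial>nu \<partial>count_space G)"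
    using ginv(1) by (intro nn_integral_count_space_nn_integral countable_G) simp
  also have "\<dots> = (\<integral>\<^sup>+g. \<integral>\<^sup>+w. indicator F w * h (act g w) \<partial>nu \<partial>count_space G)"
  proof (rule nn_integral_cong)
    fix g assume "g \<in> space (count_space G)"
    then have g: "g \<in> G" by simp
    have [measurable]: "(\<lambda>z. h z * indicator F (act (ginv g) z)) \<in> borel_measurable borel"
      using ginv(1)[OF g] by simp
    have "(\<integral>\<^sup>+z. h z * indicator F (act (ginv g) z) \<partial>nu) = (\<integral>\<^sup>+w. h (act g w) * indicator F (act (ginv g) (act g w)) \<partial>nu)"
      by (rule nn_integral_act[OF g, symmetric]) measurable
    also have "\<dots> = (\<integral>\<^sup>+w. indicator F w * h (act g w) \<partial>nu)"
      using g by (intro nn_integral_nu_cong) (simp add: act_ginv mult.commute)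
    finally show "(\<integral>\<^sup>+z. h z * indicator F (act (ginv g) z) \<partial>nu) = (\<integral>\<^sup>+w. indicator F w * h (act g w) \<partial>nu)" .
  qed
  finally show ?thesis .
qed

text \<open>
  A kernel invariant under the diagonal action has the same integral over \<open>F \<times> \<complex>\<close> and over \<open>\<complex> \<times> F\<close>: both are the sum
  over \<open>g\<close> of the integrals over \<open>F \<times> g F\<close>.  In operator language, invariant symmetric kernels are self-adjoint on the
  quotient.
\<close>

lemma unfolding_symmetry:
  assumes h: "case_prod h \<in> borel_measurable (borel \<Otimes>\<^sub>M borel)"
    and inv: "\<And>g z w. g \<in> G \<Longrightarrow> 0 < Im z \<Longrightarrow> 0 < Im w \<Longrightarrow> h (act g z) (act g w) = h z w"
  shows "(\<integral>\<^sup>+z. indicator F z * (\<integral>\<^sup>+w. h z w \<partial>nu) \<partial>nu) = (\<integral>\<^sup>+z. indicator F z * (\<integral>\<^sup>+w. h w z \<partial>nu) \<partial>nu)"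
proof -
  have h' [measurable]: "(\<lambda>x. h (f x) (k x)) \<in> borel_measurable M"
    if [measurable]: "f \<in> borel_measurable M" "k \<in> borel_measurable M" for f k and M :: "'b measure"
    using measurable_compose[OF measurable_Pair[OF that] h] by simp
  define J where "J g = (\<integral>\<^sup>+z. \<integral>\<^sup>+w. indicator F z * (indicator F w * h z (act g w)) \<partial>nu \<partial>nu)" for g
  have "(\<integral>\<^sup>+z. indicator F z * (\<integral>\<^sup>+w. h z w \<partial>nu) \<partial>nu)
      = (\<integral>\<^sup>+z. \<integral>\<^sup>+g. indicator F z * (\<integral>\<^sup>+w. indicator F w * h z (act g w) \<partial>nu) \<partial>count_space G \<partial>nu)"
    by (subst nn_integral_tiles, measurable) (simp add: nn_integral_cmult)
  also have "\<dots> = (\<integral>\<^sup>+g. \<integral>\<^sup>+z. indicator F z * (\<integral>\<^sup>+w. indicator F w * h z (act g w) \<partial>nu) \<partial>nu \<partial>count_space G)"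
    by (intro nn_integral_count_space_nn_integral countable_G) measurable
  also have "\<dots> = (\<integral>\<^sup>+g. J g \<partial>count_space G)"
    unfolding J_def by (intro nn_integral_cong) (simp add: nn_integral_cmult)
  finally have left: "(\<integral>\<^sup>+z. indicator F z * (\<integral>\<^sup>+w. h z w \<partial>nu) \<partial>nu) = (\<integral>\<^sup>+g. J g \<partial>count_space G)" .
  have "(\<integral>\<^sup>+z. indicator F z * (\<integral>\<^sup>+w. h w z \<partial>nu) \<partial>nu)
      = (\<integral>\<^sup>+z. \<integral>\<^sup>+g. indicator F z * (\<integral>\<^sup>+w. indicator F w * h (act g w) z \<partial>nu) \<partial>count_space G \<partial>nu)"
    by (subst nn_integral_tiles, measurable) (simp add: nn_integral_cmult)
  also have "\<dots> = (\<integral>\<^sup>+g. \<integral>\<^sup>+z. indicator F z * (\<integral>\<^sup>+w. indicator F w * h (act g w) z \<partial>nu) \<partial>nu \<partial>count_space G)"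
    by (intro nn_integral_count_space_nn_integral countable_G) measurable
  also have "\<dots> = (\<integral>\<^sup>+g. J (ginv g) \<partial>count_space G)"
  proof (intro nn_integral_cong)
    fix g assume "g \<in> space (count_space G)"
    then have g: "g \<in> G" by simp
    note [measurable] = g ginv(1)[OF g]
    have "(\<integral>\<^sup>+z. indicator F z * (\<integral>\<^sup>+w. indicator F w * h (act g w) z \<partial>nu) \<partial>nu)
        = (\<integral>\<^sup>+z. \<integral>\<^sup>+w. indicator F z * (indicator F w * h (act g w) z) \<partial>nu \<partial>nu)"
      by (simp add: nn_integral_cmult)
    also have "\<dots> = (\<integral>\<^sup>+w. \<integral>\<^sup>+z. indicator F z * (indicator F w * h (act g w) z) \<partial>nu \<partial>nu)"
      by (rule nu.Fubini') measurable
    also have "\<dots> = J (ginv g)"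
    proof -
      have "indicator F z * (indicator F w * h (act g w) z) = indicator F w * (indicator F z * h w (act (ginv g) z))" for z w
      proof (cases "z \<in> F \<and> w \<in> F")
        case True
        then have "0 < Im z" "0 < Im w" using Im_F by auto
        then have "h (act (ginv g) (act g w)) (act (ginv g) z) = h (act g w) z"
          by (intro inv ginv Im_act g) auto
        then show ?thesis using act_ginv[OF g \<open>0 < Im w\<close>] by (simp add: mult_ac)
      qed auto
      then show ?thesis unfolding J_def by simp
    qed
    finally show "(\<integral>\<^sup>+z. indicator F z * (\<integral>\<^sup>+w. indicator F w * h (act g w) z \<partial>nu) \<partial>nu) = J (ginv g)" .
  qed
  also have "\<dots> = (\<integral>\<^sup>+g. J g \<partial>count_space G)"
    by (rule nn_integral_bij_count_space, rule bij_betw_byWitness[where f'=ginv]) (auto simp: ginv)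
  finally show ?thesis using left by simp
qed

end

section \<open>Correlations of an invariant set\<close>

locale invariant_tiling = tiling +
  fixes E :: "complex set"
  assumes E: "E \<in> sets borel" "E \<subseteq> upper_half_plane"
    and invariant: "g \<in> G \<Longrightarrow> 0 < Im z \<Longrightarrow> act g z \<in> E \<longleftrightarrow> z \<in> E"
begin

lemma sets_E [measurable]: "E \<in> sets borel" by (rule E(1))

text \<open>
  \<open>2 \<pi> S\<^sub>s\<close> applied to the indicator function of \<open>E\<close>.
\<close>

definition wave :: "real \<Rightarrow> complex \<Rightarrow> ennreal" where
  "wave s z = (\<integral>\<^sup>+w. wave_kernel s z w * indicator E w \<partial>nu)"

lemma measurable_wave [measurable]:
  assumes [measurable]: "f \<in> borel_measurable M" "k \<in> borel_measurable M"
  shows "(\<lambda>x. wave (f x) (k x)) \<in> borel_measurable M"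
  unfolding wave_def by measurable

lemma wave_act:
  assumes g: "g \<in> G" and z: "0 < Im z"
  shows "wave s (act g z) = wave s z"
proof -
  have "wave s (act g z) = (\<integral>\<^sup>+w. wave_kernel s (act g z) (act g w) * indicator E (act g w) \<partial>nu)"
    unfolding wave_def by (rule nn_integral_act[OF g, symmetric]) measurable
  also have "\<dots> = wave s z"
    unfolding wave_def
    by (intro nn_integral_nu_cong) (simp add: wave_kernel_def hyp_gap_act g z invariant indicator_def)
  finally show ?thesis .
qed

lemma wave_le:
  assumes "0 < Im z" "0 \<le> s"
  shows "wave s z \<le> ennreal (4 * pi * sinh (s / 2))"
proof -
  have "wave s z \<le> (\<integral>\<^sup>+w. wave_kernel s z w \<partial>nu)"
    unfolding wave_def by (intro nn_integral_mono) (auto split: split_indicator)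
  then show ?thesis using assms by (simp add: nn_integral_wave_kernel)
qed

text \<open>
  The inner product \<open>\<langle>2 \<pi> S\<^sub>s 1\<^sub>E, 1\<^sub>E\<rangle>\<close> on the quotient.
\<close>

definition corr :: "real \<Rightarrow> ennreal" where
  "corr s = (\<integral>\<^sup>+z. indicator (F \<inter> E) z * wave s z \<partial>nu)"

lemma measurable_corr [measurable]: "corr \<in> borel_measurable borel"
  unfolding corr_def[abs_def] by measurable

lemma corr_le:
  assumes "0 \<le> s"
  shows "corr s \<le> ennreal (4 * pi * sinh (s / 2)) * emeasure nu (F \<inter> E)"
proof -
  have "corr s \<le> (\<integral>\<^sup>+z. ennreal (4 * pi * sinh (s / 2)) * indicator (F \<inter> E) z \<partial>nu)"
    unfolding corr_def using wave_le[OF Im_F assms]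
    by (intro nn_integral_mono) (auto split: split_indicator)
  then show ?thesis by (simp add: nn_integral_cmult_indicator)
qed

text \<open>
  A quantitative one-sided continuity; the kernel decreases in \<open>s\<close> where it was already positive, and the mass of the
  new part of its support is small.
\<close>

lemma corr_increase:
  assumes "0 \<le> s" "s \<le> t"
  shows "corr t \<le> corr s + ennreal (2 * pi * sqrt (gap t - gap s)) * emeasure nu (F \<inter> E)"
proof -
  have gap: "gap s \<le> gap t"
    using assms by (rule gap_mono)
  have step: "wave t z \<le> wave s z + ennreal (2 * pi * sqrt (gap t - gap s))" if z: "0 < Im z" for z
  proof -
    have "wave t z \<le> (\<integral>\<^sup>+w. wave_kernel s z w * indicator E w
        + inv_sqrt (gap t) (hyp_gap z w) * indicator {gap s..} (hyp_gap z w) \<partial>nu)"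
      unfolding wave_def using gap
      by (intro nn_integral_mono)
         (auto simp: wave_kernel_def inv_sqrt_def frac_le split: split_indicator intro!: ennreal_leI add_increasing2)
    also have "\<dots> = wave s z + (\<integral>\<^sup>+w. inv_sqrt (gap t) (hyp_gap z w) * indicator {gap s..} (hyp_gap z w) \<partial>nu)"
      unfolding wave_def by (rule nn_integral_add) measurable
    also have "(\<integral>\<^sup>+w. inv_sqrt (gap t) (hyp_gap z w) * indicator {gap s..} (hyp_gap z w) \<partial>nu)
        = ennreal pi * (\<integral>\<^sup>+u. inv_sqrt (gap t) u * indicator {gap s..} u * indicator {0..} u \<partial>lborel)"
      by (rule nn_integral_hyp_gap[OF _ z]) measurable
    also have "(\<integral>\<^sup>+u. inv_sqrt (gap t) u * indicator {gap s..} u * indicator {0..} u \<partial>lborel)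
        = (\<integral>\<^sup>+u. inv_sqrt (gap t) u * indicator {gap s..} u \<partial>lborel)"
      using gap_nonneg[of s] by (intro nn_integral_cong) (auto split: split_indicator)
    also have "\<dots> = ennreal (2 * sqrt (gap t - gap s))"
      by (rule nn_integral_inv_sqrt_tail[OF gap])
    finally show ?thesis using gap by (simp add: ennreal_mult[symmetric] mult_ac)
  qed
  have "corr t \<le> (\<integral>\<^sup>+z. indicator (F \<inter> E) z * wave s z + ennreal (2 * pi * sqrt (gap t - gap s)) * indicator (F \<inter> E) z \<partial>nu)"
    unfolding corr_def using step[OF Im_F]
    by (intro nn_integral_mono) (auto split: split_indicator)
  also have "\<dots> = corr s + ennreal (2 * pi * sqrt (gap t - gap s)) * emeasure nu (F \<inter> E)"
    unfolding corr_def by (subst nn_integral_add) (simp_all add: nn_integral_cmult_indicator)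
  finally show ?thesis .
qed

lemma wave_total:
  assumes "0 \<le> s"
  shows "(\<integral>\<^sup>+z. indicator F z * wave s z \<partial>nu) = ennreal (4 * pi * sinh (s / 2)) * emeasure nu (F \<inter> E)"
proof -
  have "(\<integral>\<^sup>+z. indicator F z * wave s z \<partial>nu) = (\<integral>\<^sup>+z. indicator F z * (\<integral>\<^sup>+w. wave_kernel s w z * indicator E z \<partial>nu) \<partial>nu)"
    unfolding wave_def
  proof (rule unfolding_symmetry)
    show "(\<lambda>(z, w). wave_kernel s z w * indicator E w) \<in> borel_measurable (borel \<Otimes>\<^sub>M borel)"
      unfolding case_prod_beta by measurable
  qed (simp add: wave_kernel_def hyp_gap_act invariant indicator_def)
  also have "\<dots> = (\<integral>\<^sup>+z. ennreal (4 * pi * sinh (s / 2)) * indicator (F \<inter> E) z \<partial>nu)"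
    using nn_integral_wave_kernel[OF _ assms]
    by (intro nn_integral_nu_cong) (simp add: wave_kernel_commute[of s _ z for z] nn_integral_cmult indicator_inter_arith mult_ac)
  also have "\<dots> = ennreal (4 * pi * sinh (s / 2)) * emeasure nu (F \<inter> E)"
    by (simp add: nn_integral_cmult_indicator)
  finally show ?thesis .
qed

text \<open>
  Self-adjointness followed by the product formula \<open>wave_conv_eq\<close>.
\<close>

lemma wave_product:
  assumes st: "0 \<le> t" "t \<le> s"
  shows "(\<integral>\<^sup>+z. indicator F z * (wave s z * wave t z) \<partial>nu) = ennreal pi * (\<integral>\<^sup>+\<sigma>. corr \<sigma> * indicator {s - t..s + t} \<sigma> \<partial>lborel)"
proof -
  have "(\<integral>\<^sup>+z. indicator F z * (wave s z * wave t z) \<partial>nu)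
      = (\<integral>\<^sup>+z. indicator F z * (\<integral>\<^sup>+w. wave t z * (wave_kernel s z w * indicator E w) \<partial>nu) \<partial>nu)"
    unfolding wave_def[of s] by (simp add: nn_integral_cmult mult.commute)
  also have "\<dots> = (\<integral>\<^sup>+z. indicator F z * (\<integral>\<^sup>+w. wave t w * (wave_kernel s w z * indicator E z) \<partial>nu) \<partial>nu)"
  proof (rule unfolding_symmetry)
    show "(\<lambda>(z, w). wave t z * (wave_kernel s z w * indicator E w)) \<in> borel_measurable (borel \<Otimes>\<^sub>M borel)"
      unfolding case_prod_beta by measurable
  qed (simp add: wave_kernel_def hyp_gap_act invariant indicator_def wave_act)
  also have "\<dots> = (\<integral>\<^sup>+z. indicator (F \<inter> E) z * (\<integral>\<^sup>+w. wave t w * wave_kernel s z w \<partial>nu) \<partial>nu)"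
    by (intro nn_integral_cong) (auto simp: wave_kernel_commute[of s _ z for z] split: split_indicator)
  also have "\<dots> = (\<integral>\<^sup>+z. indicator (F \<inter> E) z * (ennreal pi * (\<integral>\<^sup>+\<sigma>. wave \<sigma> z * indicator {s - t..s + t} \<sigma> \<partial>lborel)) \<partial>nu)"
  proof (intro nn_integral_nu_cong)
    fix z assume z: "0 < Im z"
    have "(\<integral>\<^sup>+w. wave t w * wave_kernel s z w \<partial>nu)
        = (\<integral>\<^sup>+w. \<integral>\<^sup>+v. wave_kernel s z w * wave_kernel t w v * indicator E v \<partial>nu \<partial>nu)"
      unfolding wave_def by (simp add: nn_integral_cmult[symmetric] mult_ac)
    also have "\<dots> = (\<integral>\<^sup>+v. \<integral>\<^sup>+w. wave_kernel s z w * wave_kernel t w v * indicator E v \<partial>nu \<partial>nu)"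
      by (rule nu.Fubini') measurable
    also have "\<dots> = (\<integral>\<^sup>+v. wave_conv s t z v * indicator E v \<partial>nu)"
      unfolding wave_conv_def by (simp add: nn_integral_multc)
    also have "\<dots> = (\<integral>\<^sup>+v. ennreal pi * (\<integral>\<^sup>+\<sigma>. wave_kernel \<sigma> z v * indicator {s - t..s + t} \<sigma> * indicator E v \<partial>lborel) \<partial>nu)"
      by (intro nn_integral_cong_AE eventually_mono[OF wave_conv_eq[OF st z]])
         (subst nn_integral_multc, measurable, simp add: mult.assoc)
    also have "\<dots> = ennreal pi * (\<integral>\<^sup>+v. \<integral>\<^sup>+\<sigma>. wave_kernel \<sigma> z v * indicator {s - t..s + t} \<sigma> * indicator E v \<partial>lborel \<partial>nu)"
      by (rule nn_integral_cmult) measurable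
    also have "(\<integral>\<^sup>+v. \<integral>\<^sup>+\<sigma>. wave_kernel \<sigma> z v * indicator {s - t..s + t} \<sigma> * indicator E v \<partial>lborel \<partial>nu)
        = (\<integral>\<^sup>+\<sigma>. \<integral>\<^sup>+v. wave_kernel \<sigma> z v * indicator {s - t..s + t} \<sigma> * indicator E v \<partial>nu \<partial>lborel)"
      by (rule lborel_nu.Fubini') measurable
    also have "\<dots> = (\<integral>\<^sup>+\<sigma>. wave \<sigma> z * indicator {s - t..s + t} \<sigma> \<partial>lborel)"
      unfolding wave_def
      by (intro nn_integral_cong, subst nn_integral_multc[symmetric]) (simp_all add: mult_ac)
    finally show "indicator (F \<inter> E) z * (\<integral>\<^sup>+w. wave t w * wave_kernel s z w \<partial>nu)
      = indicator (F \<inter> E) z * (ennreal pi * (\<integral>\<^sup>+\<sigma>. wave \<sigma> z * indicator {s - t..s + t} \<sigma> \<partial>lborel))"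
      by simp
  qed
  also have "\<dots> = ennreal pi * (\<integral>\<^sup>+z. \<integral>\<^sup>+\<sigma>. indicator (F \<inter> E) z * wave \<sigma> z * indicator {s - t..s + t} \<sigma> \<partial>lborel \<partial>nu)"
    by (simp add: nn_integral_cmult[symmetric] mult_ac)
  also have "(\<integral>\<^sup>+z. \<integral>\<^sup>+\<sigma>. indicator (F \<inter> E) z * wave \<sigma> z * indicator {s - t..s + t} \<sigma> \<partial>lborel \<partial>nu)
      = (\<integral>\<^sup>+\<sigma>. \<integral>\<^sup>+z. indicator (F \<inter> E) z * wave \<sigma> z * indicator {s - t..s + t} \<sigma> \<partial>nu \<partial>lborel)"
    by (rule lborel_nu.Fubini') measurable
  also have "\<dots> = (\<integral>\<^sup>+\<sigma>. corr \<sigma> * indicator {s - t..s + t} \<sigma> \<partial>lborel)"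
    unfolding corr_def by (simp add: nn_integral_multc)
  finally show ?thesis .
qed

end

section \<open>Inverting the Abel transform\<close>

text \<open>
  The density that inverts the Abel transform: integrating the wave kernels of all radii \<open>s < R\<close> against it gives a
  multiple of the indicator function of the disc of radius \<open>R\<close>.
\<close>

definition weight :: "real \<Rightarrow> real \<Rightarrow> real" where
  "weight R s = (if 0 \<le> s \<and> s < R then sinh s / sqrt (gap R - gap s) else 0)"

lemma measurable_weight [measurable]: "weight R \<in> borel_measurable borel"
  unfolding weight_def[abs_def] by measurable

lemma weight_nonneg: "0 \<le> weight R s"
  using gap_less_iff[of s R] by (auto simp: weight_def)

lemma has_real_derivative_gap: "(gap has_real_derivative 2 * sinh s) (at s)"
  unfolding gap_def[abs_def] by (auto intro!: derivative_eq_intros)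

text \<open>
  After the substitution \<open>q = gap s\<close> this is the integral of \<open>1 / sqrt ((q - u) (gap R - q))\<close> over \<open>u < q < gap R\<close>, which
  is \<open>\<pi>\<close> for every \<open>u\<close>; the factor \<open>1/2\<close> comes from \<open>dq = 2 sinh s ds\<close>.
\<close>

lemma nn_integral_inv_sqrt_weight:
  assumes u: "0 \<le> u" and R: "0 \<le> R"
  shows "(\<integral>\<^sup>+s. inv_sqrt (gap s) u * ennreal (weight R s) \<partial>lborel) = (if u < gap R then ennreal (pi / 2) else 0)"
proof (cases "u < gap R")
  case False
  have "inv_sqrt (gap s) u * ennreal (weight R s) = 0" for s
    using False gap_less_iff[of s R] by (auto simp: inv_sqrt_def weight_def)
  then have "(\<integral>\<^sup>+s. inv_sqrt (gap s) u * ennreal (weight R s) \<partial>lborel) = (\<integral>\<^sup>+s. 0 \<partial>(lborel :: real measure))"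
    by (rule nn_integral_cong)
  then show ?thesis using False by simp
next
  case True
  define a where "a = arcosh (u / 2 + 1)"
  have "cosh a = u / 2 + 1"
    unfolding a_def by (rule cosh_arcosh_real) (use u in simp)
  moreover have "0 \<le> a"
    unfolding a_def by (rule arcosh_nonneg_real) (use u in simp)
  ultimately have a: "gap a = u" "0 \<le> a" by (simp_all add: gap_def)
  then have aR: "a < R" using True R gap_less_iff[of a R] by simp
  define D where "D = gap R - u"
  have D: "D > 0" using True by (simp add: D_def)
  let ?k = "\<lambda>s. sinh s / (sqrt (gap s - u) * sqrt (gap R - gap s))"
  let ?f = "\<lambda>s. if s \<in> {a..R} then ?k s else 0"
  let ?\<phi> = "\<lambda>s. (2 * gap s - u - gap R) / D"
  have rng: "- 1 \<le> ?\<phi> s \<and> ?\<phi> s \<le> 1" if "s \<in> {a..R}" for s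
    using gap_mono[of a s] gap_mono[of s R] that a D by (simp add: D_def field_simps)
  have int: "(?k has_integral (1 / 2 * arcsin (?\<phi> R) - 1 / 2 * arcsin (?\<phi> a))) {a..R}"
  proof (rule fundamental_theorem_of_calculus_interior)
    show "continuous_on {a..R} (\<lambda>s. 1 / 2 * arcsin (?\<phi> s))"
      using rng D by (intro continuous_intros) auto
    fix s assume s: "s \<in> {a<..<R}"
    then have g: "u < gap s" "gap s < gap R" using gap_less_iff[of a s] gap_less_iff[of s R] a by auto
    have sq: "1 - (?\<phi> s)\<^sup>2 = 4 * ((gap s - u) * (gap R - gap s)) / D\<^sup>2"
      using D by (simp add: power_divide diff_divide_eq_iff) (simp add: D_def power2_eq_square algebra_simps)
    have "- 1 < ?\<phi> s" "?\<phi> s < 1" using g D by (simp_all add: D_def field_simps)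
    then have "((\<lambda>s. 1 / 2 * arcsin (?\<phi> s)) has_real_derivative
      1 / 2 * (inverse (sqrt (1 - (?\<phi> s)\<^sup>2)) * ((2 * (2 * sinh s)) / D))) (at s)"
      using D by (intro DERIV_cmult DERIV_chain2[where f=arcsin] DERIV_arcsin)
        (auto intro!: derivative_eq_intros has_real_derivative_gap)
    also have "1 / 2 * (inverse (sqrt (1 - (?\<phi> s)\<^sup>2)) * ((2 * (2 * sinh s)) / D)) = ?k s"
    proof -
      have cancel: "1 / 2 * (inverse (2 * (x * y) / D) * ((2 * (2 * v)) / D)) = v / (x * y)"
        if "x \<noteq> 0" "y \<noteq> 0" for x y v :: real
        using D that by (simp add: divide_simps)
      have root: "sqrt (1 - (?\<phi> s)\<^sup>2) = 2 * (sqrt (gap s - u) * sqrt (gap R - gap s)) / D"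
        unfolding sq real_sqrt_divide real_sqrt_mult real_sqrt_abs real_sqrt_four using D by simp
      show ?thesis
        unfolding root by (rule cancel) (use g in auto)
    qed
    finally show "((\<lambda>s. 1 / 2 * arcsin (?\<phi> s)) has_vector_derivative ?k s) (at s)"
      by (simp only: has_real_derivative_iff_has_vector_derivative)
  qed (use aR in simp)
  have endR: "?\<phi> R = 1" using D by (simp add: D_def)
  have enda: "?\<phi> a = - 1"
  proof -
    have "2 * gap a - u - gap R = - D" using a(1) by (simp add: D_def)
    then show ?thesis using D by simp
  qed
  have "(?k has_integral (1 / 2 * arcsin 1 - 1 / 2 * arcsin (- 1))) {a..R}"
    using int unfolding endR enda .
  then have "(?k has_integral (pi / 2)) {a..R}" by simp
  then have "(?f has_integral (pi / 2)) UNIV"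
    by (subst has_integral_restrict_UNIV)
  moreover have "0 \<le> ?f s" for s
    using gap_mono[of a s] gap_mono[of s R] a by auto
  ultimately have "(\<integral>\<^sup>+s. ennreal (?f s) \<partial>lborel) = ennreal (pi / 2)"
    by (intro nn_integral_has_integral_lborel) auto
  moreover have "ennreal (?f s) = inv_sqrt (gap s) u * ennreal (weight R s)" for s
  proof (cases "a < s \<and> s < R")
    case True
    then have "u < gap s" "gap s < gap R" using gap_less_iff[of a s] gap_less_iff[of s R] a by auto
    then show ?thesis using True a
      by (simp add: inv_sqrt_def weight_def ennreal_mult[symmetric])
  next
    case False
    then consider "s < a" | "s = a" | "s = R" | "R < s" by linarith
    then show ?thesis
      using a aR gap_less_iff[of a s] by cases (auto simp: inv_sqrt_def weight_def)
  qed
  ultimately show ?thesis using True by simp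
qed

lemma nn_integral_sinh_weight:
  assumes R: "0 \<le> R"
  shows "(\<integral>\<^sup>+s. ennreal (4 * pi * sinh (s / 2)) * ennreal (weight R s) \<partial>lborel) = ennreal (pi\<^sup>2 / 2 * gap R)"
proof -
  have "(\<integral>\<^sup>+s. ennreal (4 * pi * sinh (s / 2)) * ennreal (weight R s) \<partial>lborel)
      = (\<integral>\<^sup>+s. ennreal pi * (\<integral>\<^sup>+u. inv_sqrt (gap s) u * ennreal (weight R s) * indicator {0..} u \<partial>lborel) \<partial>lborel)"
  proof (intro nn_integral_cong)
    fix s
    have "(\<integral>\<^sup>+u. inv_sqrt (gap s) u * ennreal (weight R s) * indicator {0..} u \<partial>lborel)
        = (\<integral>\<^sup>+u. inv_sqrt (gap s) u * indicator {0..} u \<partial>lborel) * ennreal (weight R s)"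
      by (subst nn_integral_multc[symmetric]) (simp_all add: mult_ac)
    also have "\<dots> = ennreal (2 * sqrt (gap s)) * ennreal (weight R s)"
      using nn_integral_inv_sqrt_tail[OF gap_nonneg] by simp
    finally have inner: "(\<integral>\<^sup>+u. inv_sqrt (gap s) u * ennreal (weight R s) * indicator {0..} u \<partial>lborel)
        = ennreal (2 * sqrt (gap s)) * ennreal (weight R s)" .
    show "ennreal (4 * pi * sinh (s / 2)) * ennreal (weight R s)
        = ennreal pi * (\<integral>\<^sup>+u. inv_sqrt (gap s) u * ennreal (weight R s) * indicator {0..} u \<partial>lborel)"
    proof (cases "0 \<le> s")
      case True
      then have "ennreal (4 * pi * sinh (s / 2)) = ennreal pi * ennreal (2 * sqrt (gap s))"
        by (simp add: sqrt_gap ennreal_mult[symmetric])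
      then show ?thesis unfolding inner by (simp add: mult.assoc)
    qed (simp add: weight_def)
  qed
  also have "\<dots> = ennreal pi * (\<integral>\<^sup>+s. \<integral>\<^sup>+u. inv_sqrt (gap s) u * ennreal (weight R s) * indicator {0..} u \<partial>lborel \<partial>lborel)"
    by (rule nn_integral_cmult) measurable
  also have "(\<integral>\<^sup>+s. \<integral>\<^sup>+u. inv_sqrt (gap s) u * ennreal (weight R s) * indicator {0..} u \<partial>lborel \<partial>lborel)
      = (\<integral>\<^sup>+u. \<integral>\<^sup>+s. inv_sqrt (gap s) u * ennreal (weight R s) * indicator {0..} u \<partial>lborel \<partial>lborel)"
    by (rule lborel_pair.Fubini') measurable
  also have "\<dots> = (\<integral>\<^sup>+u. ennreal (pi / 2) * indicator {0..<gap R} u \<partial>lborel)"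
  proof (intro nn_integral_cong)
    fix u
    have "(\<integral>\<^sup>+s. inv_sqrt (gap s) u * ennreal (weight R s) * indicator {0..} u \<partial>lborel)
      = (\<integral>\<^sup>+s. inv_sqrt (gap s) u * ennreal (weight R s) \<partial>lborel) * indicator {0..} u"
      by (rule nn_integral_multc) measurable
    then show "(\<integral>\<^sup>+s. inv_sqrt (gap s) u * ennreal (weight R s) * indicator {0..} u \<partial>lborel)
        = ennreal (pi / 2) * indicator {0..<gap R} u"
      using nn_integral_inv_sqrt_weight[OF _ R, of u] by (auto split: split_indicator)
  qed
  also have "\<dots> = ennreal (pi / 2) * ennreal (gap R)"
    by (simp add: nn_integral_cmult_indicator gap_nonneg)
  finally show ?thesis
    by (simp add: ennreal_mult[symmetric] gap_nonneg power2_eq_square)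
qed

lemma (in invariant_tiling) corr_weight:
  assumes R: "0 \<le> R"
  shows "(\<integral>\<^sup>+s. corr s * ennreal (weight R s) \<partial>lborel)
    = ennreal (pi / 2) * (\<integral>\<^sup>+z. \<integral>\<^sup>+w. indicator (F \<inter> E) z * (indicator E w * indicator {..<gap R} (hyp_gap z w)) \<partial>nu \<partial>nu)"
proof -
  have "(\<integral>\<^sup>+s. corr s * ennreal (weight R s) \<partial>lborel)
      = (\<integral>\<^sup>+s. \<integral>\<^sup>+z. indicator (F \<inter> E) z * wave s z * ennreal (weight R s) \<partial>nu \<partial>lborel)"
    unfolding corr_def by (simp add: nn_integral_multc)
  also have "\<dots> = (\<integral>\<^sup>+z. \<integral>\<^sup>+s. indicator (F \<inter> E) z * wave s z * ennreal (weight R s) \<partial>lborel \<partial>nu)"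
    by (rule nu_lborel.Fubini') measurable
  also have "\<dots> = (\<integral>\<^sup>+z. ennreal (pi / 2) * (\<integral>\<^sup>+w. indicator (F \<inter> E) z * (indicator E w * indicator {..<gap R} (hyp_gap z w)) \<partial>nu) \<partial>nu)"
  proof (rule nn_integral_nu_cong)
    fix z assume z: "0 < Im z"
    have "(\<integral>\<^sup>+s. indicator (F \<inter> E) z * wave s z * ennreal (weight R s) \<partial>lborel)
        = (\<integral>\<^sup>+s. \<integral>\<^sup>+w. indicator (F \<inter> E) z * (indicator E w * (wave_kernel s z w * ennreal (weight R s))) \<partial>nu \<partial>lborel)"
      unfolding wave_def
      by (intro nn_integral_cong, subst nn_integral_cmult[symmetric], measurable, subst nn_integral_multc[symmetric])
         (simp_all add: mult_ac)
    also have "\<dots> = (\<integral>\<^sup>+w. \<integral>\<^sup>+s. indicator (F \<inter> E) z * (indicator E w * (wave_kernel s z w * ennreal (weight R s))) \<partial>lborel \<partial>nu)"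
      by (rule nu_lborel.Fubini') measurable
    also have "\<dots> = (\<integral>\<^sup>+w. ennreal (pi / 2) * (indicator (F \<inter> E) z * (indicator E w * indicator {..<gap R} (hyp_gap z w))) \<partial>nu)"
    proof (rule nn_integral_nu_cong)
      fix w assume w: "0 < Im w"
      show "(\<integral>\<^sup>+s. indicator (F \<inter> E) z * (indicator E w * (wave_kernel s z w * ennreal (weight R s))) \<partial>lborel)
        = ennreal (pi / 2) * (indicator (F \<inter> E) z * (indicator E w * indicator {..<gap R} (hyp_gap z w)))"
        using nn_integral_inv_sqrt_weight[OF hyp_gap_nonneg[OF z w] R]
        by (simp add: nn_integral_cmult wave_kernel_def indicator_def)
    qed
    also have "\<dots> = ennreal (pi / 2) * (\<integral>\<^sup>+w. indicator (F \<inter> E) z * (indicator E w * indicator {..<gap R} (hyp_gap z w)) \<partial>nu)"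
      by (rule nn_integral_cmult) measurable
    finally show "(\<integral>\<^sup>+s. indicator (F \<inter> E) z * wave s z * ennreal (weight R s) \<partial>lborel)
      = ennreal (pi / 2) * (\<integral>\<^sup>+w. indicator (F \<inter> E) z * (indicator E w * indicator {..<gap R} (hyp_gap z w)) \<partial>nu)" .
  qed
  also have "\<dots> = ennreal (pi / 2) * (\<integral>\<^sup>+z. \<integral>\<^sup>+w. indicator (F \<inter> E) z * (indicator E w * indicator {..<gap R} (hyp_gap z w)) \<partial>nu \<partial>nu)"
    by (rule nn_integral_cmult) measurable
  finally show ?thesis .
qed

text \<open>
  If no distance lies between \<open>R\<close> and \<open>R'\<close>, the discs of both radii contain the same pairs of points of \<open>E\<close>.
\<close>

lemma (in invariant_tiling) corr_weight_avoiding: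
  assumes R: "0 \<le> R" "R \<le> R'"
    and avoid: "\<And>z w. z \<in> F \<inter> E \<Longrightarrow> w \<in> E \<Longrightarrow> \<not> (gap R \<le> hyp_gap z w \<and> hyp_gap z w < gap R')"
  shows "(\<integral>\<^sup>+s. corr s * ennreal (weight R' s) \<partial>lborel) = (\<integral>\<^sup>+s. corr s * ennreal (weight R s) \<partial>lborel)"
proof -
  have "indicator (F \<inter> E) z * (indicator E w * indicator {..<gap R'} (hyp_gap z w))
      = (indicator (F \<inter> E) z * (indicator E w * indicator {..<gap R} (hyp_gap z w)) :: ennreal)" for z w
    using avoid[of z w] gap_mono[OF R] by (auto split: split_indicator)
  then show ?thesis
    using R by (simp add: corr_weight)
qed

section \<open>The derivative of the correlation is bounded below\<close>

lemma second_difference_telescope: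
  fixes G :: "real \<Rightarrow> real"
  assumes "\<And>j. j \<le> n \<Longrightarrow> - K \<le> G (s + real j * h + h) - 2 * G (s + real j * h) + G (s + real j * h - h)"
  shows "- (real (Suc n) * K) \<le> (G (s + real n * h + h) - G (s + real n * h)) - (G s - G (s - h))"
  using assms
proof (induction n)
  case 0
  then show ?case using "0.prems"[of 0] by simp
next
  case (Suc n)
  have IH: "- (real (Suc n) * K) \<le> (G (s + real n * h + h) - G (s + real n * h)) - (G s - G (s - h))"
    by (rule Suc.IH) (use Suc.prems in simp)
  have e: "s + real (Suc n) * h = s + real n * h + h" "s + real (Suc n) * h - h = s + real n * h"
    by (simp_all add: algebra_simps)
  have "- K \<le> G (s + real n * h + h + h) - 2 * G (s + real n * h + h) + G (s + real n * h)"
    using Suc.prems[of "Suc n"] unfolding e by simp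
  with IH show ?case unfolding e by (simp add: algebra_simps)
qed

text \<open>
  The function \<open>2 sinh (s/2)\<close>, which is \<open>S\<^sub>s\<close> applied to the constant \<open>1\<close>, and its primitive \<open>4 cosh (s/2)\<close>.
\<close>

lemma sinh_mean_value:
  fixes s h :: real
  assumes "0 \<le> s" "0 \<le> h"
  shows "h * (2 * sinh (s / 2)) \<le> 4 * cosh ((s + h) / 2) - 4 * cosh (s / 2)"
    and "h \<le> s \<Longrightarrow> 4 * cosh (s / 2) - 4 * cosh ((s - h) / 2) \<le> h * (2 * sinh (s / 2))"
proof -
  have d: "((\<lambda>x::real. 4 * cosh (x / 2)) has_real_derivative 2 * sinh (x / 2)) (at x)" for x
    by (auto intro!: derivative_eq_intros)
  show "h * (2 * sinh (s / 2)) \<le> 4 * cosh ((s + h) / 2) - 4 * cosh (s / 2)"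
  proof (cases "h = 0")
    case False
    then obtain x where x: "s < x" "x < s + h" "4 * cosh ((s + h) / 2) - 4 * cosh (s / 2) = (s + h - s) * (2 * sinh (x / 2))"
      using MVT2[of s "s + h" "\<lambda>x. 4 * cosh (x / 2)" "\<lambda>x. 2 * sinh (x / 2)"] d assms by auto
    then show ?thesis using assms by (simp add: mult_left_mono)
  qed simp
  show "4 * cosh (s / 2) - 4 * cosh ((s - h) / 2) \<le> h * (2 * sinh (s / 2))" if "h \<le> s"
  proof (cases "h = 0")
    case False
    then obtain x where x: "s - h < x" "x < s" "4 * cosh (s / 2) - 4 * cosh ((s - h) / 2) = (s - (s - h)) * (2 * sinh (x / 2))"
      using MVT2[of "s - h" s "\<lambda>x. 4 * cosh (x / 2)" "\<lambda>x. 2 * sinh (x / 2)"] d assms by auto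
    then show ?thesis using assms by (simp add: mult_left_mono)
  qed simp
qed

text \<open>
  Where \<open>G\<close> is a primitive of \<open>p\<close>, the hypothesis on second differences says in the limit that \<open>G'' \<ge> - B\<close> after
  subtraction of the mean, since \<open>2 (4 cosh (h/2) - 4)\<close> is asymptotic to \<open>h\<^sup>2\<close>.  Telescoping with step \<open>(t - s) / n\<close> avoids
  any differentiability of \<open>p\<close>: it leaves difference quotients of \<open>G\<close> to the right of \<open>t\<close> and to the left of \<open>s\<close>, where
  the one-sided continuity of \<open>p\<close> bounds them by values of \<open>p\<close>.
\<close>

lemma monotone_from_second_differences:
  fixes p G :: "real \<Rightarrow> real" and K L B :: real
  assumes G_upper: "\<And>x y M. 0 \<le> x \<Longrightarrow> x \<le> y \<Longrightarrow> (\<And>s. x \<le> s \<Longrightarrow> s \<le> y \<Longrightarrow> p s \<le> M) \<Longrightarrow> G y - G x \<le> M * (y - x)"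
    and G_lower: "\<And>x y M. 0 \<le> x \<Longrightarrow> x \<le> y \<Longrightarrow> (\<And>s. x \<le> s \<Longrightarrow> s \<le> y \<Longrightarrow> M \<le> p s) \<Longrightarrow> M * (y - x) \<le> G y - G x"
    and increase: "\<And>s t. 0 \<le> s \<Longrightarrow> s \<le> t \<Longrightarrow> p t \<le> p s + L * sqrt (gap t - gap s)"
    and L: "0 \<le> L"
    and second: "\<And>s h. 0 < h \<Longrightarrow> h \<le> s \<Longrightarrow>
      - (2 * B * (4 * cosh (h / 2) - 4)) \<le> (G (s + h) - K * (4 * cosh ((s + h) / 2)))
        - 2 * (G s - K * (4 * cosh (s / 2))) + (G (s - h) - K * (4 * cosh ((s - h) / 2)))"
    and K: "0 \<le> K"
    and s: "0 < s" "s \<le> t"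
  shows "p s - K * (2 * sinh (s / 2)) + B * s \<le> p t - K * (2 * sinh (t / 2)) + B * t"
proof (cases "s = t")
  case False
  define d where "d = t - s"
  have d: "d > 0" using s False by (simp add: d_def)
  define X where "X = (p t - K * (2 * sinh (t / 2))) - (p s - K * (2 * sinh (s / 2)))"
  define e where "e n = L * sqrt (gap (t + d / real n) - gap t) + L * sqrt (gap s - gap (s - d / real n))" for n :: nat
  define b where "b n = real (Suc n) * (2 * B * (4 * cosh (d / real n / 2) - 4)) / (d / real n)" for n :: nat
  have ev: "\<forall>\<^sub>F n in sequentially. - b n - e n \<le> X"
  proof -
    obtain n0 :: nat where n0: "d / s < real n0" using reals_Archimedean2 by blast
    have "- b n - e n \<le> X" if n: "n \<ge> Suc n0" for n
    proof -
      define h where "h = d / real n"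
      have npos: "0 < real n" using n by simp
      have h: "0 < h" using d npos by (simp add: h_def)
      have "d / s < real n" using n0 n by (simp add: order_less_trans)
      then have hs: "h \<le> s" using s(1) npos by (simp add: h_def field_simps)
      have nh: "s + real n * h = t" using npos by (simp add: h_def d_def)
      let ?G = "\<lambda>x. G x - K * (4 * cosh (x / 2))"
      have "- (real (Suc n) * (2 * B * (4 * cosh (h / 2) - 4))) \<le> (?G (s + real n * h + h) - ?G (s + real n * h)) - (?G s - ?G (s - h))"
      proof (rule second_difference_telescope)
        fix j
        have "h \<le> s + real j * h" using hs h by (simp add: add_increasing2)
        then show "- (2 * B * (4 * cosh (h / 2) - 4)) \<le> ?G (s + real j * h + h) - 2 * ?G (s + real j * h) + ?G (s + real j * h - h)"
          by (rule second[OF h])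
      qed
      then have 1: "- (real (Suc n) * (2 * B * (4 * cosh (h / 2) - 4))) \<le> (?G (t + h) - ?G t) - (?G s - ?G (s - h))"
        unfolding nh .
      have "p x \<le> p t + L * sqrt (gap (t + h) - gap t)" if "t \<le> x" "x \<le> t + h" for x
      proof -
        have "p x \<le> p t + L * sqrt (gap x - gap t)" using increase[of t x] s that by simp
        also have "\<dots> \<le> p t + L * sqrt (gap (t + h) - gap t)"
          using gap_mono[of x "t + h"] s that L by (intro add_left_mono mult_left_mono real_sqrt_le_mono) auto
        finally show ?thesis .
      qed
      then have "G (t + h) - G t \<le> (p t + L * sqrt (gap (t + h) - gap t)) * (t + h - t)"
        using s h by (intro G_upper) auto
      moreover have "K * (h * (2 * sinh (t / 2))) \<le> K * (4 * cosh ((t + h) / 2) - 4 * cosh (t / 2))"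
        using sinh_mean_value(1)[of t h] s h K by (intro mult_left_mono) auto
      ultimately have 2: "?G (t + h) - ?G t \<le> h * (p t + L * sqrt (gap (t + h) - gap t) - K * (2 * sinh (t / 2)))"
        by (simp add: algebra_simps)
      have "p s - L * sqrt (gap s - gap (s - h)) \<le> p x" if "s - h \<le> x" "x \<le> s" for x
      proof -
        have "p s \<le> p x + L * sqrt (gap s - gap x)" using increase[of x s] hs that by simp
        also have "\<dots> \<le> p x + L * sqrt (gap s - gap (s - h))"
          using gap_mono[of "s - h" x] hs that L by (intro add_left_mono mult_left_mono real_sqrt_le_mono) auto
        finally show ?thesis by simp
      qed
      then have "(p s - L * sqrt (gap s - gap (s - h))) * (s - (s - h)) \<le> G s - G (s - h)"
        using hs h by (intro G_lower) auto
      moreover have "K * (4 * cosh (s / 2) - 4 * cosh ((s - h) / 2)) \<le> K * (h * (2 * sinh (s / 2)))"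
        using sinh_mean_value(2)[of s h] s h hs K by (intro mult_left_mono) auto
      ultimately have 3: "h * (p s - L * sqrt (gap s - gap (s - h)) - K * (2 * sinh (s / 2))) \<le> ?G s - ?G (s - h)"
        by (simp add: algebra_simps)
      have "- (real (Suc n) * (2 * B * (4 * cosh (h / 2) - 4))) \<le> h * (X + e n)"
        using 1 2 3 by (simp add: X_def e_def h_def[symmetric] algebra_simps)
      then have "- (real (Suc n) * (2 * B * (4 * cosh (h / 2) - 4))) / h \<le> X + e n"
        unfolding pos_divide_le_eq[OF h] by (simp only: mult.commute)
      then show ?thesis by (simp add: b_def h_def[symmetric])
    qed
    then show ?thesis unfolding eventually_sequentially by blast
  qed
  have b: "b \<longlonglongrightarrow> B * d"
    unfolding b_def using d by real_asymp
  have "(\<lambda>n. d / real n) \<longlonglongrightarrow> 0" by (rule lim_const_over_n)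
  then have "e \<longlonglongrightarrow> L * sqrt (gap (t + 0) - gap t) + L * sqrt (gap s - gap (s - 0))"
    unfolding e_def gap_def by (intro tendsto_intros)
  then have "e \<longlonglongrightarrow> 0" by simp
  from tendsto_diff[OF tendsto_minus[OF b] this]
  have "(\<lambda>n. - b n - e n) \<longlonglongrightarrow> - (B * d)" by simp
  from tendsto_upperbound[OF this ev] have "- (B * d) \<le> X" by simp
  then show ?thesis by (simp add: X_def d_def algebra_simps)
qed simp

section \<open>Comparing two radii\<close>

lemma has_bochner_integral_nonneg_has_integral:
  fixes f :: "real \<Rightarrow> real"
  assumes "f \<in> borel_measurable borel" "\<And>x. 0 \<le> f x" "(f has_integral I) UNIV"
  shows "has_bochner_integral lborel f I"
proof -
  have "(\<integral>\<^sup>+x. ennreal (f x) \<partial>lborel) = ennreal I"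
    by (rule nn_integral_has_integral_lborel[OF assms])
  moreover have "0 \<le> I" using assms(3) by (rule has_integral_nonneg) (rule assms(2))
  ultimately show ?thesis using assms by (intro has_bochner_integral_nn_integral) auto
qed

lemma weight_alt: "weight R s = (if s \<in> {0..R} then sinh s / sqrt (gap R - gap s) else 0)"
  by (auto simp: weight_def)

lemma weight_antiderivative:
  assumes "s \<in> {0<..<R}"
  shows "((\<lambda>s. - sqrt (gap R - gap s)) has_real_derivative weight R s) (at s)"
proof -
  have "gap s < gap R" using assms gap_less_iff[of s R] by simp
  then have "((\<lambda>s. - sqrt (gap R - gap s)) has_real_derivative - (inverse (sqrt (gap R - gap s)) / 2 * (0 - 2 * sinh s))) (at s)"
    by (intro DERIV_minus DERIV_chain2[OF DERIV_real_sqrt] DERIV_diff DERIV_const has_real_derivative_gap) simp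
  moreover have "- (inverse (sqrt (gap R - gap s)) / 2 * (0 - 2 * sinh s)) = weight R s"
    using assms by (simp add: weight_def field_simps)
  ultimately show ?thesis by simp
qed

lemma weight_integral:
  assumes R: "0 < R"
  shows "has_bochner_integral lborel (weight R) (sqrt (gap R))"
proof (rule has_bochner_integral_nonneg_has_integral)
  have "(weight R has_integral (- sqrt (gap R - gap R) - (- sqrt (gap R - gap 0)))) {0..R}"
    using R weight_antiderivative
    by (intro fundamental_theorem_of_calculus_interior)
       (auto intro!: continuous_intros simp: has_real_derivative_iff_has_vector_derivative)
  then have "((\<lambda>s. if s \<in> {0..R} then weight R s else 0) has_integral sqrt (gap R)) UNIV"
    by (subst has_integral_restrict_UNIV) simp
  then show "(weight R has_integral sqrt (gap R)) UNIV"
    by (rule has_integral_eq[rotated]) (auto simp: weight_alt)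
qed (auto simp: weight_nonneg)

lemma sinh_weight_integral:
  assumes R: "0 < R"
  shows "has_bochner_integral lborel (\<lambda>s. 2 * sinh (s / 2) * weight R s) (pi / 4 * gap R)"
proof -
  have nn: "0 \<le> 2 * sinh (s / 2) * weight R s" for s
    using weight_nonneg[of R s] by (cases "0 \<le> s") (simp_all add: weight_def)
  have "ennreal (2 * pi) * (\<integral>\<^sup>+s. ennreal (2 * sinh (s / 2) * weight R s) \<partial>lborel)
      = (\<integral>\<^sup>+s. ennreal (4 * pi * sinh (s / 2)) * ennreal (weight R s) \<partial>lborel)"
  proof (subst nn_integral_cmult[symmetric], measurable, rule nn_integral_cong)
    fix s
    have "ennreal (2 * pi) * ennreal (2 * sinh (s / 2) * weight R s) = ennreal (2 * pi * (2 * sinh (s / 2) * weight R s))"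
      by (rule ennreal_mult[symmetric]) (use nn in auto)
    also have "2 * pi * (2 * sinh (s / 2) * weight R s) = 4 * pi * sinh (s / 2) * weight R s"
      by simp
    also have "ennreal (4 * pi * sinh (s / 2) * weight R s) = ennreal (4 * pi * sinh (s / 2)) * ennreal (weight R s)"
    proof (cases "0 \<le> s")
      case True
      then show ?thesis by (intro ennreal_mult weight_nonneg) simp
    qed (simp add: weight_def)
    finally show "ennreal (2 * pi) * ennreal (2 * sinh (s / 2) * weight R s) = ennreal (4 * pi * sinh (s / 2)) * ennreal (weight R s)" .
  qed
  also have "\<dots> = ennreal (pi\<^sup>2 / 2 * gap R)"
    using R by (intro nn_integral_sinh_weight) simp
  also have "\<dots> = ennreal (2 * pi) * ennreal (pi / 4 * gap R)"
    by (simp add: ennreal_mult[symmetric] gap_nonneg power2_eq_square)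
  finally have "(\<integral>\<^sup>+s. ennreal (2 * sinh (s / 2) * weight R s) \<partial>lborel) = ennreal (pi / 4 * gap R)"
    by (simp add: ennreal_mult_cancel_left)
  then show ?thesis
    using nn by (intro has_bochner_integral_nn_integral) (auto simp: gap_nonneg)
qed

text \<open>
  Integration by parts.
\<close>

lemma moment_weight_integral:
  assumes R: "0 < R"
  shows "has_bochner_integral lborel (\<lambda>s. s * weight R s) (integral {0..R} (\<lambda>s. sqrt (gap R - gap s)))"
proof (rule has_bochner_integral_nonneg_has_integral)
  let ?r = "\<lambda>s. sqrt (gap R - gap s)"
  have "((\<lambda>s. s * weight R s - ?r s) has_integral (- (R * ?r R) - - (0 * ?r 0))) {0..R}"
  proof (rule fundamental_theorem_of_calculus_interior)
    show "continuous_on {0..R} (\<lambda>s. - (s * ?r s))" by (intro continuous_intros)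
    fix s assume s: "s \<in> {0<..<R}"
    have "((\<lambda>s. s * - ?r s) has_real_derivative 1 * - ?r s + weight R s * s) (at s)"
      by (rule DERIV_mult[OF DERIV_ident weight_antiderivative[OF s]])
    then show "((\<lambda>s. - (s * ?r s)) has_vector_derivative s * weight R s - ?r s) (at s)"
      by (simp add: has_real_derivative_iff_has_vector_derivative[symmetric] mult.commute)
  qed (use R in simp)
  moreover have "(?r has_integral integral {0..R} ?r) {0..R}"
    by (intro integrable_integral integrable_continuous_interval continuous_intros)
  ultimately have "((\<lambda>s. (s * weight R s - ?r s) + ?r s) has_integral ((- (R * ?r R) - - (0 * ?r 0)) + integral {0..R} ?r)) {0..R}"
    by (rule has_integral_add)
  then have "((\<lambda>s. s * weight R s) has_integral integral {0..R} ?r) {0..R}" by simp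
  then have "((\<lambda>s. if s \<in> {0..R} then s * weight R s else 0) has_integral integral {0..R} ?r) UNIV"
    by (subst has_integral_restrict_UNIV)
  then show "((\<lambda>s. s * weight R s) has_integral integral {0..R} ?r) UNIV"
    by (rule has_integral_eq[rotated]) (auto simp: weight_alt)
  show "0 \<le> s * weight R s" for s
    using weight_nonneg[of R s] by (cases "0 \<le> s") (simp_all add: weight_def)
qed measurable

lemma weight_decreasing:
  assumes "0 \<le> s" "s < R" "R \<le> R'"
  shows "weight R' s \<le> weight R s"
proof -
  have "gap s < gap R" using assms gap_less_iff[of s R] by simp
  moreover have "gap R \<le> gap R'" using assms gap_mono[of R R'] by simp
  ultimately show ?thesis
    using assms by (auto simp: weight_def intro!: divide_left_mono mult_pos_pos)
qed

text \<open>
  As \<open>R'\<close> tends to \<open>R\<close>, the equality of the two integrals says that the integral of \<open>p\<close> against the derivative of the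
  weight in \<open>R\<close> is zero.  An integration by parts would express it through the derivative of \<open>p\<close>, which is bounded
  below.  Since the weight is singular, the monotonicity of \<open>p s - K (2 sinh (s/2)) + B s\<close> is used directly instead, for
  two radii \<open>R < R'\<close>.
\<close>

lemma avoidance_inequality:
  fixes p :: "real \<Rightarrow> real"
  assumes [measurable]: "p \<in> borel_measurable borel"
    and bound: "\<And>s. 0 \<le> s \<Longrightarrow> s \<le> R' \<Longrightarrow> 0 \<le> p s \<and> p s \<le> M"
    and mono: "\<And>s t. 0 < s \<Longrightarrow> s \<le> t \<Longrightarrow>
      p s - K * (2 * sinh (s / 2)) + B * s \<le> p t - K * (2 * sinh (t / 2)) + B * t"
    and R: "0 < R" "R < R'"
    and B: "0 \<le> B"
    and eq: "(LBINT s. p s * weight R' s) = (LBINT s. p s * weight R s)"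
  shows "K * (pi / 4 * (gap R' - gap R))
    \<le> B * (integral {0..R'} (\<lambda>s. sqrt (gap R' - gap s)) - integral {0..R} (\<lambda>s. sqrt (gap R - gap s)))"
proof -
  define q where "q s = p s - K * (2 * sinh (s / 2)) + B * s" for s
  \<comment> \<open>\<open>q\<close> is increasing, and \<open>q s\<close> is at least \<open>- K (2 sinh (s/2))\<close>, which tends to \<open>0\<close> at \<open>0\<close>.\<close>
  have q0: "0 \<le> q R"
  proof (rule tendsto_upperbound)
    have "((\<lambda>s. - K * (2 * sinh (s / 2))) \<longlongrightarrow> - K * (2 * sinh (0 / 2))) (at_right 0)"
      by (intro tendsto_intros) simp_all
    then show "((\<lambda>s. - K * (2 * sinh (s / 2))) \<longlongrightarrow> 0) (at_right 0)" by simp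
    have "- K * (2 * sinh (s / 2)) \<le> q R" if s: "s \<in> {0<..<R}" for s
    proof -
      have "- K * (2 * sinh (s / 2)) \<le> q s" using bound[of s] s R B by (simp add: q_def)
      also have "\<dots> \<le> q R" unfolding q_def using s by (intro mono) auto
      finally show ?thesis .
    qed
    then show "\<forall>\<^sub>F s in at_right 0. - K * (2 * sinh (s / 2)) \<le> q R"
      using eventually_at_right_real[OF R(1)] by (rule eventually_mono[rotated])
  qed (simp_all)
  have int_p: "integrable lborel (\<lambda>s. p s * weight T s)" if "0 < T" "T \<le> R'" for T
  proof (rule Bochner_Integration.integrable_bound)
    show "integrable lborel (\<lambda>s. M * weight T s)"
      using weight_integral[OF that(1)] by (intro integrable_mult_right) (rule integrable.intros)
    show "AE s in lborel. norm (p s * weight T s) \<le> norm (M * weight T s)"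
    proof (intro AE_I2)
      fix s
      show "norm (p s * weight T s) \<le> norm (M * weight T s)"
        using bound[of s] that weight_nonneg[of T s]
        by (cases "0 \<le> s \<and> s < T") (auto simp: abs_mult mult_right_mono, auto simp: weight_def)
    qed
  qed measurable
  define J where "J T = (LBINT s. p s * weight T s) - K * (pi / 4 * gap T)
    + B * integral {0..T} (\<lambda>s. sqrt (gap T - gap s)) - q R * sqrt (gap T)" for T
  have J: "has_bochner_integral lborel (\<lambda>s. (q s - q R) * weight T s) (J T)" if T: "0 < T" "T \<le> R'" for T
  proof -
    have "has_bochner_integral lborel (\<lambda>s. p s * weight T s - K * (2 * sinh (s / 2) * weight T s)
       + B * (s * weight T s) - q R * weight T s) (J T)"
      unfolding J_def
      by (intro has_bochner_integral_diff has_bochner_integral_add has_bochner_integral_mult_right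
          sinh_weight_integral moment_weight_integral weight_integral T(1)
          has_bochner_integral_integrable int_p T)
    moreover have "p s * weight T s - K * (2 * sinh (s / 2) * weight T s)
       + B * (s * weight T s) - q R * weight T s = (q s - q R) * weight T s" for s
      by (simp add: q_def algebra_simps)
    ultimately show ?thesis by simp
  qed
  \<comment> \<open>The difference of the weights changes sign at \<open>R\<close> exactly as \<open>q s - q R\<close> does.\<close>
  have "(LBINT s. (q s - q R) * weight R s) \<le> (LBINT s. (q s - q R) * weight R' s)"
  proof (rule integral_mono)
    show "integrable lborel (\<lambda>s. (q s - q R) * weight R s)" "integrable lborel (\<lambda>s. (q s - q R) * weight R' s)"
      using J[of R] J[of R'] R by (auto intro: integrable.intros)
    fix s
    show "(q s - q R) * weight R s \<le> (q s - q R) * weight R' s"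
    proof (cases "0 < s \<and> s < R'")
      case True
      show ?thesis
      proof (cases "s < R")
        case True
        then have "q s - q R \<le> 0" using mono[of s R] \<open>0 < s \<and> s < R'\<close> by (simp add: q_def)
        moreover have "weight R' s \<le> weight R s" using True \<open>0 < s \<and> s < R'\<close> R by (intro weight_decreasing) auto
        ultimately show ?thesis by (rule mult_left_mono_neg[rotated])
      next
        case False
        then have "0 \<le> q s - q R" using mono[of R s] R by (simp add: q_def)
        moreover have "weight R s = 0" using False by (simp add: weight_def)
        ultimately show ?thesis using weight_nonneg[of R' s] by simp
      qed
    next
      case False
      then show ?thesis using R by (auto simp: weight_def)
    qed
  qed
  then have "J R \<le> J R'"
    using J[of R] J[of R'] R by (simp add: has_bochner_integral_integral_eq)
  moreover have "q R * sqrt (gap R) \<le> q R * sqrt (gap R')"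
    using q0 R gap_mono[of R R'] by (intro mult_left_mono) auto
  ultimately show ?thesis unfolding J_def eq by (simp add: algebra_simps diff_divide_distrib)
qed

text \<open>
  For \<open>R'\<close> tending to \<open>R\<close>, the quotient of the left-hand side by \<open>(gap R' - gap R) / 2\<close> tends to the integral of
  \<open>1 / sqrt (gap R - gap s)\<close>, that is, to \<open>\<pi>/2\<close> times the spherical function.  It is estimated by
  \<open>gap R - gap s = exp R (1 - exp (s - R)) (1 - exp (- R - s))\<close>.
\<close>

lemma integral_sqrt_gap_increment:
  assumes R: "0 < R" "R < R'"
  shows "integral {0..R'} (\<lambda>s. sqrt (gap R' - gap s)) - integral {0..R} (\<lambda>s. sqrt (gap R - gap s))
    \<le> (gap R' - gap R) / 2 * (exp (- R / 2) / sqrt (1 - exp (- R)) * (R + 2 * ln 2)) + (R' - R) * sqrt (gap R' - gap R)"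
proof -
  let ?r = "\<lambda>R s. sqrt (gap R - gap s)"
  define \<kappa> where "\<kappa> = (gap R' - gap R) / 2 * (exp (- R / 2) / sqrt (1 - exp (- R)))"
  have e1: "exp (- R) < 1" using R by simp
  have q: "gap R < gap R'" using R gap_less_iff[of R R'] by simp
  have \<kappa>: "0 \<le> \<kappa>" using q e1 by (simp add: \<kappa>_def)
  have int: "?r T integrable_on {a..b}" for T a b
    by (intro integrable_continuous_interval continuous_intros)
  define m where "m s = 1 / sqrt (1 - exp (s - R))" for s
  have m_int: "(m has_integral (R + 2 * ln (1 + sqrt (1 - exp (- R))))) {0..R}"
  proof -
    \<comment> \<open>Where \<open>y = sqrt (1 - exp (s - R))\<close>, the derivative of \<open>?A\<close> is \<open>1 + (1 - y) / y = 1 / y\<close>.\<close>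
    let ?A = "\<lambda>s. s - 2 * ln (1 + sqrt (1 - exp (s - R)))"
    have "(m has_integral (?A R - ?A 0)) {0..R}"
    proof (rule fundamental_theorem_of_calculus_interior)
      show "continuous_on {0..R} ?A"
        by (intro continuous_intros) (auto simp: add_pos_nonneg less_imp_neq[symmetric])
      fix s assume s: "s \<in> {0<..<R}"
      define y where "y = sqrt (1 - exp (s - R))"
      have y: "0 < y" "y\<^sup>2 = 1 - exp (s - R)" using s by (auto simp: y_def)
      have "(?A has_real_derivative 1 - 2 * (1 / (1 + y) * (inverse y / 2 * (- exp (s - R))))) (at s)"
        using s y(1) unfolding y_def
        by (auto intro!: derivative_eq_intros simp: add_pos_pos)
      also have "1 - 2 * (1 / (1 + y) * (inverse y / 2 * (- exp (s - R)))) = 1 / y"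
      proof -
        have gen: "1 - 2 * (1 / a * (inverse b / 2 * (- e))) = 1 + e / a / b" if "a \<noteq> 0" "b \<noteq> 0" for a b e :: real
          using that by (simp add: divide_simps)
        have "exp (s - R) = (1 - y) * (1 + y)" using y by (simp add: power2_eq_square algebra_simps)
        then have "exp (s - R) / (1 + y) = 1 - y" using y(1) by simp
        moreover have "1 - 2 * (1 / (1 + y) * (inverse y / 2 * (- exp (s - R)))) = 1 + exp (s - R) / (1 + y) / y"
          using gen[of "1 + y" y "exp (s - R)"] y(1) by simp
        moreover have "1 + (1 - y) / y = 1 / y" using y(1) by (simp add: diff_divide_distrib)
        ultimately show ?thesis by simp
      qed
      finally show "(?A has_vector_derivative m s) (at s)"
        unfolding has_real_derivative_iff_has_vector_derivative m_def y_def .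
    qed (use R in simp)
    then show ?thesis by simp
  qed
  have le: "(if s = R then 0 else ?r R' s - ?r R s) \<le> \<kappa> * m s" if s: "s \<in> {0..R}" for s
  proof (cases "s = R")
    case True
    then show ?thesis by (simp add: m_def)
  next
    case False
    then have sR: "s < R" using s by simp
    then have gs: "gap s < gap R" using s gap_less_iff[of s R] by simp
    define x where "x = gap R - gap s"
    define d where "d = gap R' - gap R"
    have x: "0 < x" "0 \<le> d" using gs q by (simp_all add: x_def d_def)
    have "sqrt (x + d) \<le> sqrt x + d / (2 * sqrt x)"
    proof (rule real_le_lsqrt)
      have "(sqrt x + d / (2 * sqrt x))\<^sup>2 = x + d + (d / (2 * sqrt x))\<^sup>2"
        using x by (simp add: power2_sum)
      then show "x + d \<le> (sqrt x + d / (2 * sqrt x))\<^sup>2" by simp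
    qed (use x in auto)
    then have 1: "?r R' s - ?r R s \<le> d / (2 * sqrt x)" by (simp add: x_def d_def)
    have "exp R * (1 - exp (- R)) * (1 - exp (s - R)) \<le> x"
    proof -
      have "x = exp R * (1 - exp (s - R)) * (1 - exp (- R - s))"
        by (simp add: x_def gap_def cosh_def exp_diff exp_minus field_simps)
      moreover have "1 - exp (- R) \<le> 1 - exp (- R - s)" using s by simp
      ultimately show ?thesis using sR by (simp add: mult.assoc mult_left_mono mult.commute)
    qed
    then have "sqrt (exp R * (1 - exp (- R)) * (1 - exp (s - R))) \<le> sqrt x" by simp
    moreover have "sqrt (exp R) = exp (R / 2)"
      by (rule real_sqrt_unique) (simp_all add: exp_double[symmetric])
    ultimately have y: "exp (R / 2) * sqrt (1 - exp (- R)) * sqrt (1 - exp (s - R)) \<le> sqrt x"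
      by (simp add: real_sqrt_mult)
    have "d / (2 * sqrt x) \<le> d / (2 * (exp (R / 2) * sqrt (1 - exp (- R)) * sqrt (1 - exp (s - R))))"
      using x y e1 sR by (intro divide_left_mono mult_left_mono mult_pos_pos) auto
    also have "\<dots> = \<kappa> * m s"
      using e1 sR by (simp add: \<kappa>_def m_def d_def exp_minus field_simps)
    finally show ?thesis using 1 False by simp
  qed
  have "((\<lambda>s. if s = R then 0 else ?r R' s - ?r R s) has_integral (integral {0..R} (?r R') - integral {0..R} (?r R))) {0..R}"
    by (rule has_integral_spike_finite[of "{R}", OF _ _ has_integral_diff])
       (auto intro!: integrable_integral int)
  moreover have "((\<lambda>s. \<kappa> * m s) has_integral (\<kappa> * (R + 2 * ln (1 + sqrt (1 - exp (- R)))))) {0..R}"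
    by (rule has_integral_mult_right[OF m_int])
  ultimately have A: "integral {0..R} (?r R') - integral {0..R} (?r R) \<le> \<kappa> * (R + 2 * ln (1 + sqrt (1 - exp (- R))))"
    by (rule has_integral_le) (rule le)
  have "ln (1 + sqrt (1 - exp (- R))) \<le> ln 2"
    using e1 by (subst ln_le_cancel_iff) (auto simp: add_pos_nonneg)
  then have A': "\<kappa> * (R + 2 * ln (1 + sqrt (1 - exp (- R)))) \<le> \<kappa> * (R + 2 * ln 2)"
    using \<kappa> by (intro mult_left_mono) auto
  have "integral {R..R'} (?r R') \<le> integral {R..R'} (\<lambda>s. sqrt (gap R' - gap R))"
    using R gap_mono[of R] by (intro integral_le int) auto
  then have "integral {R..R'} (?r R') \<le> (R' - R) * sqrt (gap R' - gap R)"
    using R by simp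
  moreover have "integral {0..R'} (?r R') = integral {0..R} (?r R') + integral {R..R'} (?r R')"
    using R by (intro Henstock_Kurzweil_Integration.integral_combine[symmetric] int) auto
  ultimately show ?thesis using A A' by (simp add: \<kappa>_def mult.assoc)
qed

section \<open>The density bound\<close>

locale finite_invariant_tiling = invariant_tiling +
  assumes finite_F: "emeasure nu F < \<infinity>"
begin

definition area :: real where "area = measure nu F"

definition part :: real where "part = measure nu (F \<inter> E)"

lemma emeasure_F: "emeasure nu F = ennreal area"
  unfolding area_def using finite_F by (intro emeasure_eq_ennreal_measure) auto

lemma emeasure_part: "emeasure nu (F \<inter> E) = ennreal part"
proof -
  have "emeasure nu (F \<inter> E) \<le> emeasure nu F" by (intro emeasure_mono) auto
  then show ?thesis unfolding part_def using finite_F by (intro emeasure_eq_ennreal_measure) auto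
qed

lemma part_nonneg: "0 \<le> part" and part_le_area: "part \<le> area"
proof -
  show "0 \<le> part" by (simp add: part_def)
  have "emeasure nu (F \<inter> E) \<le> emeasure nu F" by (intro emeasure_mono) auto
  then show "part \<le> area"
    unfolding emeasure_F emeasure_part by (simp add: area_def)
qed

definition rcorr :: "real \<Rightarrow> real" where
  "rcorr s = enn2real (corr s)"

lemma measurable_rcorr [measurable]: "rcorr \<in> borel_measurable borel"
  unfolding rcorr_def[abs_def] by measurable

lemma corr_eq: "0 \<le> s \<Longrightarrow> corr s = ennreal (rcorr s)"
proof -
  assume "0 \<le> s"
  then have "corr s \<le> ennreal (4 * pi * sinh (s / 2)) * ennreal part"
    using corr_le[of s] by (simp add: emeasure_part)
  also have "\<dots> < \<infinity>" by (simp add: ennreal_mult_less_top)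
  finally show ?thesis by (simp add: rcorr_def)
qed

lemma rcorr_nonneg: "0 \<le> rcorr s"
  by (simp add: rcorr_def)

lemma rcorr_le: "0 \<le> s \<Longrightarrow> rcorr s \<le> 4 * pi * sinh (s / 2) * part"
  using corr_le[of s] part_nonneg by (simp add: corr_eq emeasure_part ennreal_mult[symmetric])

lemma rcorr_increase:
  assumes "0 \<le> s" "s \<le> t"
  shows "rcorr t \<le> rcorr s + 2 * pi * part * sqrt (gap t - gap s)"
proof -
  have gap: "0 \<le> sqrt (gap t - gap s)" using gap_mono[OF assms] by simp
  have "ennreal (rcorr t) \<le> ennreal (rcorr s) + ennreal (2 * pi * sqrt (gap t - gap s)) * ennreal part"
    using corr_increase[OF assms] assms by (simp add: corr_eq emeasure_part)
  also have "\<dots> = ennreal (rcorr s + 2 * pi * part * sqrt (gap t - gap s))"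
    using gap part_nonneg rcorr_nonneg
    by (simp add: ennreal_mult[symmetric] ennreal_plus[symmetric] mult_ac del: ennreal_plus)
  finally show ?thesis
    using gap part_nonneg rcorr_nonneg by (subst (asm) ennreal_le_iff) (auto intro!: add_nonneg_nonneg mult_nonneg_nonneg)
qed

lemma rcorr_set_integrable:
  assumes "0 \<le> x"
  shows "set_integrable lborel {x..y} rcorr"
  unfolding set_integrable_def
proof (rule Bochner_Integration.integrable_bound)
  show "integrable lborel (\<lambda>s. (4 * pi * sinh (y / 2) * part) * indicator {x..y} s)"
    by (intro integrable_mult_right integrable_real_indicator) (simp_all add: emeasure_lborel_Icc_eq)
  show "AE s in lborel. norm (indicator {x..y} s *\<^sub>R rcorr s) \<le> norm ((4 * pi * sinh (y / 2) * part) * indicator {x..y} s)"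
  proof (intro AE_I2)
    fix s
    have "rcorr s \<le> 4 * pi * sinh (y / 2) * part" if "x \<le> s" "s \<le> y"
    proof -
      have "rcorr s \<le> 4 * pi * sinh (s / 2) * part" using rcorr_le[of s] that assms by simp
      also have "\<dots> \<le> 4 * pi * sinh (y / 2) * part"
        using that part_nonneg by (intro mult_right_mono mult_left_mono) auto
      finally show ?thesis .
    qed
    then show "norm (indicator {x..y} s *\<^sub>R rcorr s) \<le> norm ((4 * pi * sinh (y / 2) * part) * indicator {x..y} s)"
      using rcorr_nonneg[of s] by (auto split: split_indicator)
  qed
qed measurable

lemma rcorr_integrable: "0 \<le> x \<Longrightarrow> rcorr integrable_on {x..y}"
  using set_borel_integral_eq_integral(1)[OF rcorr_set_integrable] .

lemma nn_integral_corr: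
  assumes "0 \<le> x"
  shows "(\<integral>\<^sup>+s. corr s * indicator {x..y} s \<partial>lborel) = ennreal (integral {x..y} rcorr)"
proof -
  have "(\<integral>\<^sup>+s. corr s * indicator {x..y} s \<partial>lborel) = (\<integral>\<^sup>+s. ennreal (indicator {x..y} s *\<^sub>R rcorr s) \<partial>lborel)"
    using assms by (intro nn_integral_cong) (auto simp: corr_eq split: split_indicator)
  also have "\<dots> = ennreal (LBINT s. indicator {x..y} s *\<^sub>R rcorr s)"
    using rcorr_set_integrable[OF assms, of y] rcorr_nonneg unfolding set_integrable_def
    by (intro nn_integral_eq_integral) auto
  also have "(LBINT s. indicator {x..y} s *\<^sub>R rcorr s) = integral {x..y} rcorr"
    using set_borel_integral_eq_integral(2)[OF rcorr_set_integrable[OF assms]]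
    by (simp add: set_lebesgue_integral_def)
  finally show ?thesis .
qed

definition primitive :: "real \<Rightarrow> real" where
  "primitive x = integral {0..x} rcorr"

lemma primitive_diff: "0 \<le> x \<Longrightarrow> x \<le> y \<Longrightarrow> primitive y - primitive x = integral {x..y} rcorr"
  unfolding primitive_def
  using Henstock_Kurzweil_Integration.integral_combine[of 0 x y rcorr] rcorr_integrable[of 0 y] by simp

lemma primitive_le:
  assumes "0 \<le> h"
  shows "primitive h \<le> 2 * pi * part * (4 * cosh (h / 2) - 4)"
proof -
  have upper: "((\<lambda>s. 4 * pi * sinh (s / 2) * part) has_integral
      (2 * pi * part * (4 * cosh (h / 2)) - 2 * pi * part * (4 * cosh (0 / 2)))) {0..h}"
    using assms
    by (intro fundamental_theorem_of_calculus)
       (auto intro!: derivative_eq_intros simp: has_real_derivative_iff_has_vector_derivative[symmetric])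
  have "(rcorr has_integral primitive h) {0..h}"
    unfolding primitive_def by (rule integrable_integral[OF rcorr_integrable]) simp
  from this upper have "primitive h \<le> 2 * pi * part * (4 * cosh (h / 2)) - 2 * pi * part * (4 * cosh (0 / 2))"
    by (rule has_integral_le) (simp add: rcorr_le)
  then show ?thesis by (simp add: algebra_simps)
qed

text \<open>
  The variance of \<open>wave a - wave b\<close> on \<open>F\<close> is nonnegative; the second moments are given by the product formula, the means
  by the total mass of the wave kernel.
\<close>

lemma wave_variance:
  assumes "0 \<le> b" "b \<le> a" and area: "0 < area"
  shows "16 * pi * part\<^sup>2 / area * (sinh (a / 2) - sinh (b / 2))\<^sup>2
    \<le> primitive (2 * a) + primitive (2 * b) - 2 * (primitive (a + b) - primitive (a - b))"
proof -
  define f where "f s z = indicator F z * enn2real (wave s z)" for s z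
  have [measurable]: "f s \<in> borel_measurable borel" for s
    unfolding f_def[abs_def] by measurable
  have fin: "wave s z < \<infinity>" if "z \<in> F" "0 \<le> s" for s z
    by (rule le_less_trans[OF wave_le[OF Im_F[OF that(1)] that(2)]]) simp
  have fw: "ennreal (f s z) = indicator F z * wave s z" if "0 \<le> s" for s z
    using fin[OF _ that, of z] by (auto simp: f_def split: split_indicator)
  have f0: "0 \<le> f s z" for s z by (simp add: f_def)
  have T: "has_bochner_integral nu (f s) (4 * pi * sinh (s / 2) * part)" if "0 \<le> s" for s
  proof (rule has_bochner_integral_nn_integral)
    show "(\<integral>\<^sup>+z. ennreal (f s z) \<partial>nu) = ennreal (4 * pi * sinh (s / 2) * part)"
      using wave_total[OF that] that part_nonneg by (simp add: fw emeasure_part ennreal_mult[symmetric])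
  qed (use that part_nonneg f0 in auto)
  have X: "has_bochner_integral nu (\<lambda>z. f s z * f t z) (pi * (primitive (s + t) - primitive (s - t)))"
    if "0 \<le> t" "t \<le> s" for s t
  proof (rule has_bochner_integral_nn_integral)
    have "(\<integral>\<^sup>+z. ennreal (f s z * f t z) \<partial>nu) = (\<integral>\<^sup>+z. indicator F z * (wave s z * wave t z) \<partial>nu)"
      using that f0 by (intro nn_integral_cong) (auto simp: ennreal_mult fw split: split_indicator)
    also have "\<dots> = ennreal pi * ennreal (integral {s - t..s + t} rcorr)"
      using that by (simp add: wave_product nn_integral_corr)
    also have "integral {s - t..s + t} rcorr = primitive (s + t) - primitive (s - t)"
      using that by (intro primitive_diff[symmetric]) auto
    finally show "(\<integral>\<^sup>+z. ennreal (f s z * f t z) \<partial>nu) = ennreal (pi * (primitive (s + t) - primitive (s - t)))"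
      by (simp add: ennreal_mult')
    show "0 \<le> pi * (primitive (s + t) - primitive (s - t))"
      using that rcorr_nonneg
      by (subst primitive_diff) (auto intro!: mult_nonneg_nonneg Henstock_Kurzweil_Integration.integral_nonneg rcorr_integrable)
  qed (use f0 in auto)
  define D where "D = 4 * pi * part * (sinh (a / 2) - sinh (b / 2))"
  \<comment> \<open>\<open>m\<close> is the mean of \<open>f a - f b\<close> over \<open>F\<close>.\<close>
  define m where "m = D / area"
  have one: "has_bochner_integral nu (indicator F) area"
    unfolding area_def using finite_F by (intro has_bochner_integral_real_indicator) auto
  let ?X = "pi * (primitive (a + a) - primitive (a - a)) - 2 * (pi * (primitive (a + b) - primitive (a - b)))
    + pi * (primitive (b + b) - primitive (b - b))
    - 2 * m * (4 * pi * sinh (a / 2) * part - 4 * pi * sinh (b / 2) * part) + m\<^sup>2 * area"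
  have "has_bochner_integral nu (\<lambda>z. f a z * f a z - 2 * (f a z * f b z) + f b z * f b z
      - 2 * m * (f a z - f b z) + m\<^sup>2 * indicator F z) ?X"
    using assms
    by (intro has_bochner_integral_add has_bochner_integral_diff has_bochner_integral_mult_right X T one) auto
  moreover have "f a z * f a z - 2 * (f a z * f b z) + f b z * f b z
      - 2 * m * (f a z - f b z) + m\<^sup>2 * indicator F z = (f a z - f b z - m * indicator F z)\<^sup>2" for z
    by (auto simp: f_def power2_eq_square algebra_simps split: split_indicator)
  ultimately have "has_bochner_integral nu (\<lambda>z. (f a z - f b z - m * indicator F z)\<^sup>2) ?X" by simp
  then have "?X = (LINT z|nu. (f a z - f b z - m * indicator F z)\<^sup>2)"
    by (rule has_bochner_integral_integral_eq[symmetric])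
  also have "0 \<le> (LINT z|nu. (f a z - f b z - m * indicator F z)\<^sup>2)"
    by (rule Bochner_Integration.integral_nonneg) simp
  finally have "0 \<le> ?X" .
  also have "?X = pi * (primitive (2 * a) + primitive (2 * b) - 2 * (primitive (a + b) - primitive (a - b))) - D\<^sup>2 / area"
    using area by (simp add: m_def D_def primitive_def power2_eq_square field_simps)
  finally have "D\<^sup>2 / area \<le> pi * (primitive (2 * a) + primitive (2 * b) - 2 * (primitive (a + b) - primitive (a - b)))"
    by simp
  moreover have "D\<^sup>2 / area = pi * (16 * pi * part\<^sup>2 / area * (sinh (a / 2) - sinh (b / 2))\<^sup>2)"
    by (simp add: D_def power2_eq_square)
  ultimately have "pi * (16 * pi * part\<^sup>2 / area * (sinh (a / 2) - sinh (b / 2))\<^sup>2)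
    \<le> pi * (primitive (2 * a) + primitive (2 * b) - 2 * (primitive (a + b) - primitive (a - b)))"
    by (simp only:)
  then show ?thesis by (rule mult_left_le_imp_le) simp
qed

text \<open>
  This is \<open>cos (s A) \<ge> - 1\<close> on functions of mean zero: the terms with \<open>K\<close> remove the mean of the indicator function, and
  \<open>B\<close> is \<open>2 \<pi>\<close> times the squared norm of the remainder.  The radii in \<open>wave_variance\<close> are \<open>(s + h)/2\<close> and \<open>(s - h)/2\<close>,
  so that the primitive is evaluated at \<open>s + h\<close>, \<open>s - h\<close>, \<open>s\<close> and \<open>h\<close>.
\<close>

lemma rcorr_monotone:
  assumes area: "0 < area" and st: "0 < s" "s \<le> t"
  defines "K \<equiv> 2 * pi * part\<^sup>2 / area"
  defines "B \<equiv> 2 * pi * (part - part\<^sup>2 / area)"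
  shows "rcorr s - K * (2 * sinh (s / 2)) + B * s \<le> rcorr t - K * (2 * sinh (t / 2)) + B * t"
proof (rule monotone_from_second_differences[where L="2 * pi * part" and G=primitive])
  fix x y M :: real assume xy: "0 \<le> x" "x \<le> y"
  have int: "(rcorr has_integral primitive y - primitive x) {x..y}"
    unfolding primitive_diff[OF xy] by (rule integrable_integral[OF rcorr_integrable[OF xy(1)]])
  have const: "((\<lambda>_. M) has_integral M * (y - x)) {x..y}"
    using has_integral_const_real[of M x y] xy by (simp add: mult.commute)
  show "primitive y - primitive x \<le> M * (y - x)" if "\<And>s. x \<le> s \<Longrightarrow> s \<le> y \<Longrightarrow> rcorr s \<le> M"
    using that by (intro has_integral_le[OF int const]) auto
  show "M * (y - x) \<le> primitive y - primitive x" if "\<And>s. x \<le> s \<Longrightarrow> s \<le> y \<Longrightarrow> M \<le> rcorr s"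
    using that by (intro has_integral_le[OF const int]) auto
next
  fix s h :: real assume h: "0 < h" "h \<le> s"
  define x y where "x = (s + h) / 4" and "y = (s - h) / 4"
  have "16 * pi * part\<^sup>2 / area * (sinh x - sinh y)\<^sup>2
    \<le> primitive (s + h) + primitive (s - h) - 2 * (primitive s - primitive h)"
  proof -
    have e: "2 * ((s + h) / 2) = s + h" "2 * ((s - h) / 2) = s - h" "(s + h) / 2 + (s - h) / 2 = s"
      "(s + h) / 2 - (s - h) / 2 = h" "(s + h) / 2 / 2 = x" "(s - h) / 2 / 2 = y"
      by (simp_all add: x_def y_def add_divide_distrib diff_divide_distrib)
    have "0 \<le> (s - h) / 2" "(s - h) / 2 \<le> (s + h) / 2" using h by simp_all
    from wave_variance[OF this area] show ?thesis unfolding e .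
  qed
  moreover have "16 * pi * part\<^sup>2 / area * (sinh x - sinh y)\<^sup>2 = K * (8 * (sinh x - sinh y)\<^sup>2)"
    by (simp add: K_def)
  moreover have "8 * (sinh x - sinh y)\<^sup>2 = 4 * cosh ((s + h) / 2) + 4 * cosh ((s - h) / 2) - 8 * cosh (s / 2) + 8 * cosh (h / 2) - 8"
  proof -
    have e: "(s + h) / 2 = x + x" "(s - h) / 2 = y + y" "s / 2 = x + y" "h / 2 = x - y"
      by (simp_all add: x_def y_def field_simps)
    show ?thesis
      unfolding e cosh_add cosh_diff using cosh_square_eq[of x] cosh_square_eq[of y]
      by (simp add: power2_eq_square algebra_simps)
  qed
  moreover have "primitive h \<le> 2 * pi * part * (4 * cosh (h / 2) - 4)"
    using primitive_le[of h] h by simp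
  moreover have "2 * pi * part = B + K" by (simp add: B_def K_def algebra_simps)
  ultimately have *: "K * (4 * cosh ((s + h) / 2) + 4 * cosh ((s - h) / 2) - 8 * cosh (s / 2) + 8 * cosh (h / 2) - 8)
      \<le> primitive (s + h) + primitive (s - h) - 2 * primitive s + 2 * primitive h"
    "primitive h \<le> (B + K) * (4 * cosh (h / 2) - 4)" by simp_all
  then show "- (2 * B * (4 * cosh (h / 2) - 4)) \<le> primitive (s + h) - K * (4 * cosh ((s + h) / 2))
    - 2 * (primitive s - K * (4 * cosh (s / 2))) + (primitive (s - h) - K * (4 * cosh ((s - h) / 2)))"
    by (simp add: algebra_simps)
qed (use part_nonneg area st rcorr_increase K_def in auto)

text \<open>
  The previous inequalities, with \<open>B\<close> estimated by \<open>2 \<pi> part\<close>; this drops the factor \<open>1 - \<delta>\<close> of the ratio bound.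
\<close>

lemma density_bound_annulus:
  assumes R: "0 < R" "R < R'"
    and avoid: "\<And>z w. z \<in> F \<inter> E \<Longrightarrow> w \<in> E \<Longrightarrow> \<not> (gap R \<le> hyp_gap z w \<and> hyp_gap z w < gap R')"
  shows "part \<le> (2 / pi * (exp (- R / 2) / sqrt (1 - exp (- R)) * (R + 2 * ln 2))
    + 4 / pi * ((R' - R) / sqrt (gap R' - gap R))) * area"
proof (cases "part = 0")
  case True
  have nonneg: "0 \<le> exp (- R / 2) / sqrt (1 - exp (- R)) * (R + 2 * ln 2)" "0 \<le> (R' - R) / sqrt (gap R' - gap R)"
    using R gap_mono[of R R'] by simp_all
  have "0 \<le> (2 / pi * (exp (- R / 2) / sqrt (1 - exp (- R)) * (R + 2 * ln 2))
    + 4 / pi * ((R' - R) / sqrt (gap R' - gap R))) * area"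
  proof -
    have "0 \<le> (2 / pi * x + 4 / pi * y) * v" if "0 \<le> x" "0 \<le> y" "0 \<le> v" for x y v :: real
      using that by simp
    from this[OF nonneg order_trans[OF part_nonneg part_le_area]] show ?thesis .
  qed
  then show ?thesis using True by simp
next
  case False
  then have pos: "0 < part" "0 < area" using part_nonneg part_le_area by linarith+
  define K where "K = 2 * pi * part\<^sup>2 / area"
  define B where "B = 2 * pi * (part - part\<^sup>2 / area)"
  have B: "0 \<le> B"
    using pos part_le_area by (simp add: B_def power2_eq_square divide_le_eq)
  have lint: "(LBINT s. rcorr s * weight T s) = enn2real (\<integral>\<^sup>+s. corr s * ennreal (weight T s) \<partial>lborel)" for T
  proof -
    have "(LBINT s. rcorr s * weight T s) = enn2real (\<integral>\<^sup>+s. ennreal (rcorr s * weight T s) \<partial>lborel)"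
      using rcorr_nonneg weight_nonneg by (intro integral_eq_nn_integral) auto
    also have "(\<integral>\<^sup>+s. ennreal (rcorr s * weight T s) \<partial>lborel) = (\<integral>\<^sup>+s. corr s * ennreal (weight T s) \<partial>lborel)"
    proof (intro nn_integral_cong)
      fix s
      show "ennreal (rcorr s * weight T s) = corr s * ennreal (weight T s)"
        using rcorr_nonneg[of s] weight_nonneg[of T s]
        by (cases "0 \<le> s") (auto simp: corr_eq ennreal_mult, auto simp: weight_def)
    qed
    finally show ?thesis .
  qed
  define \<Delta> where "\<Delta> = gap R' - gap R"
  have \<Delta>: "0 < \<Delta>" using R gap_less_iff[of R R'] by (simp add: \<Delta>_def)
  define Y where "Y = \<Delta> / 2 * (exp (- R / 2) / sqrt (1 - exp (- R)) * (R + 2 * ln 2)) + (R' - R) * sqrt \<Delta>"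
  have Y: "0 \<le> Y"
    using R \<Delta> unfolding Y_def by (intro add_nonneg_nonneg mult_nonneg_nonneg) auto
  have "K * (pi / 4 * (gap R' - gap R))
    \<le> B * (integral {0..R'} (\<lambda>s. sqrt (gap R' - gap s)) - integral {0..R} (\<lambda>s. sqrt (gap R - gap s)))"
  proof (rule avoidance_inequality[where p=rcorr and M="4 * pi * sinh (R' / 2) * part"])
    fix s assume s: "0 \<le> s" "s \<le> R'"
    have "rcorr s \<le> 4 * pi * sinh (s / 2) * part" by (rule rcorr_le[OF s(1)])
    also have "\<dots> \<le> 4 * pi * sinh (R' / 2) * part"
      using s pos by (intro mult_right_mono mult_left_mono) auto
    finally show "0 \<le> rcorr s \<and> rcorr s \<le> 4 * pi * sinh (R' / 2) * part" using rcorr_nonneg by simp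
  next
    show "(LBINT s. rcorr s * weight R' s) = (LBINT s. rcorr s * weight R s)"
      unfolding lint using corr_weight_avoiding[of R R'] R avoid by simp
  next
    show "rcorr s - K * (2 * sinh (s / 2)) + B * s \<le> rcorr t - K * (2 * sinh (t / 2)) + B * t"
      if "0 < s" "s \<le> t" for s t
      unfolding K_def B_def by (rule rcorr_monotone[OF pos(2) that])
  qed (use R B in simp_all)
  also have "\<dots> \<le> B * Y"
    unfolding Y_def \<Delta>_def using B R by (intro mult_left_mono integral_sqrt_gap_increment)
  also have "\<dots> \<le> 2 * pi * part * Y"
    using Y pos by (intro mult_right_mono) (simp_all add: B_def)
  finally have "2 * pi * part * (part * (pi / 4 * \<Delta>)) \<le> 2 * pi * part * (Y * area)"
    using pos by (simp add: K_def \<Delta>_def power2_eq_square field_simps)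
  then have "part * (pi / 4 * \<Delta>) \<le> Y * area"
    using pos by (simp only: mult_le_cancel_left_pos mult_pos_pos pi_gt_zero zero_less_numeral)
  then have "part \<le> Y * area / (pi / 4 * \<Delta>)"
    using \<Delta> by (simp add: pos_le_divide_eq)
  also have "\<dots> = (2 / pi * (exp (- R / 2) / sqrt (1 - exp (- R)) * (R + 2 * ln 2))
    + 4 / pi * ((R' - R) / sqrt \<Delta>)) * area"
  proof -
    have root: "(R' - R) * sqrt \<Delta> = \<Delta> * ((R' - R) / sqrt \<Delta>)" using \<Delta> by (simp add: field_simps)
    have cancel: "(\<Delta> / 2 * x + \<Delta> * y) * area / (pi / 4 * \<Delta>) = (2 / pi * x + 4 / pi * y) * area" for x y
      using \<Delta> by (simp add: field_simps)
    show ?thesis unfolding Y_def root by (rule cancel)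
  qed
  finally show ?thesis unfolding \<Delta>_def .
qed

end

text \<open>
  As \<open>R\<close> increases to \<open>r\<close> the second term vanishes, because \<open>gap r - gap R \<ge> r - R\<close>.  The remaining constant has leading
  coefficient \<open>2/\<pi>\<close> instead of \<open>1\<close>, so that crude bounds such as \<open>\<pi> > 3\<close> and \<open>exp 2 \<ge> 4\<close> suffice from \<open>r = 2\<close> on.
\<close>

lemma avoidance_constant_limit:
  fixes x r \<delta> :: real
  assumes r: "2 \<le> r" and \<delta>: "0 < \<delta>"
    and bound: "\<And>R. r - \<delta> < R \<Longrightarrow> R < r \<Longrightarrow> 0 < R \<Longrightarrow>
      x \<le> 2 / pi * (exp (- R / 2) / sqrt (1 - exp (- R)) * (R + 2 * ln 2)) + 4 / pi * ((r - R) / sqrt (gap r - gap R))"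
  shows "x \<le> (r + 1) * exp (- r / 2)"
proof -
  let ?L = "\<lambda>R. 2 / pi * (exp (- R / 2) / sqrt (1 - exp (- R)) * (R + 2 * ln 2))"
  have er: "exp (- r) < 1" using r by simp
  have "(?L \<longlongrightarrow> ?L r) (at_left r)"
    using r by (intro tendsto_intros) auto
  moreover have "((\<lambda>R. 4 / pi * ((r - R) / sqrt (gap r - gap R))) \<longlongrightarrow> 0) (at_left r)"
  proof (rule tendsto_sandwich)
    show "\<forall>\<^sub>F R in at_left r. 0 \<le> 4 / pi * ((r - R) / sqrt (gap r - gap R))"
      using eventually_at_left_real[of 0 r] r gap_mono by (auto elim!: eventually_mono)
    show "\<forall>\<^sub>F R in at_left r. 4 / pi * ((r - R) / sqrt (gap r - gap R)) \<le> 4 / pi * (sqrt (r - R))"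
    proof (rule eventually_mono[OF eventually_at_left_real[of 1 r]])
      fix R assume R: "R \<in> {1<..<r}"
      obtain y where y: "R < y" "y < r" "gap r - gap R = (r - R) * (2 * sinh y)"
        using MVT2[of R r gap "\<lambda>s. 2 * sinh s"] R has_real_derivative_gap by auto
      have "sinh y \<ge> 1"
      proof -
        have "exp y \<ge> 1 + y + y\<^sup>2 / 2" using y R by (intro exp_lower_Taylor_quadratic) simp
        moreover have "1 \<le> y\<^sup>2" using y R by (intro one_le_power) simp
        moreover have "1 < y" using y R by simp
        ultimately have e: "5 / 2 \<le> exp y" by linarith
        then have "exp (- y) \<le> 2 / 5" by (simp add: exp_minus field_simps)
        with e have "2 \<le> exp y - exp (- y)" by simp
        then show ?thesis by (simp add: sinh_def)
      qed
      then have "(r - R) * 1 \<le> gap r - gap R" unfolding y(3) using R by (intro mult_left_mono) auto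
      then have "sqrt (r - R) \<le> sqrt (gap r - gap R)" by simp
      moreover have "0 < sqrt (r - R)" using R by simp
      ultimately have "(r - R) / sqrt (gap r - gap R) \<le> (r - R) / sqrt (r - R)"
        using R by (intro divide_left_mono mult_pos_pos) auto
      also have "\<dots> = sqrt (r - R)" using R by (simp add: real_div_sqrt)
      finally show "4 / pi * ((r - R) / sqrt (gap r - gap R)) \<le> 4 / pi * (sqrt (r - R))"
        by (intro mult_left_mono) auto
    qed (use r in simp)
    have "((\<lambda>R. 4 / pi * sqrt (r - R)) \<longlongrightarrow> 4 / pi * sqrt (r - r)) (at_left r)"
      by (intro tendsto_intros)
    then show "((\<lambda>R. 4 / pi * sqrt (r - R)) \<longlongrightarrow> 0) (at_left r)" by simp
  qed simp
  ultimately have "((\<lambda>R. ?L R + 4 / pi * ((r - R) / sqrt (gap r - gap R))) \<longlongrightarrow> ?L r + 0) (at_left r)"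
    by (rule tendsto_add)
  moreover have "\<forall>\<^sub>F R in at_left r. x \<le> ?L R + 4 / pi * ((r - R) / sqrt (gap r - gap R))"
  proof (rule eventually_mono[OF eventually_at_left_real[of "max 0 (r - \<delta>)" r]])
    show "x \<le> ?L R + 4 / pi * ((r - R) / sqrt (gap r - gap R))" if "R \<in> {max 0 (r - \<delta>)<..<r}" for R
      using bound[of R] that by simp
  qed (use r \<delta> in simp)
  ultimately have "x \<le> ?L r + 0"
    by (rule tendsto_lowerbound) simp
  also have "?L r + 0 \<le> (r + 1) * exp (- r / 2)"
  proof -
    have "4 \<le> exp r"
      using exp_lower_Taylor_quadratic[of r] r power_mono[of 2 r 2] by simp
    then have "exp (- r) \<le> 1 / 4" by (simp add: exp_minus field_simps)
    then have s: "6 / 7 \<le> sqrt (1 - exp (- r))"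
      by (intro real_le_rsqrt) (simp add: power2_eq_square)
    have "2 / pi \<le> 2 / 3" using pi_gt3 by (intro divide_left_mono) auto
    moreover have "1 / sqrt (1 - exp (- r)) \<le> 1 / (6 / 7)"
      using s r by (intro divide_left_mono) auto
    ultimately have "2 / pi * (1 / sqrt (1 - exp (- r))) \<le> 2 / 3 * (1 / (6 / 7))"
      using er by (intro mult_mono) auto
    moreover have "0 \<le> r + 2 * ln 2" using r by (simp add: add_nonneg_nonneg)
    ultimately have "2 / pi * (1 / sqrt (1 - exp (- r))) * (r + 2 * ln 2) \<le> 2 / 3 * (1 / (6 / 7)) * (r + 2 * ln 2)"
      by (rule mult_right_mono)
    also have "\<dots> \<le> r + 1" using ln2_le_25_over_36 r by simp
    finally have "2 / pi * (1 / sqrt (1 - exp (- r))) * (r + 2 * ln 2) * exp (- r / 2) \<le> (r + 1) * exp (- r / 2)"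
      by (intro mult_right_mono) auto
    moreover have "2 / pi * (e / q * x) + 0 = 2 / pi * (1 / q) * x * e" for e q x :: real
      by simp
    ultimately show ?thesis by (simp only:)
  qed
  finally show ?thesis .
qed

section \<open>The distance function\<close>

lemma mobius_has_field_derivative:
  fixes A :: "real^2^2"
  assumes "det A = 1" "0 < Im z"
  shows "(mobius A has_field_derivative 1 / (of_real (A$2$1) * z + of_real (A$2$2))\<^sup>2) (at z)"
proof -
  have nz: "of_real (A$2$1) * z + of_real (A$2$2) \<noteq> 0" by (rule mobius_denominator_nonzero[OF assms])
  have d: "of_real (A$1$1) * of_real (A$2$2) - of_real (A$1$2) * of_real (A$2$1) = (1::complex)"
    using assms(1) by (simp add: det_2 flip: of_real_mult of_real_diff)
  have "(mobius A has_field_derivative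
      (of_real (A$1$1) * (of_real (A$2$1) * z + of_real (A$2$2)) - (of_real (A$1$1) * z + of_real (A$1$2)) * of_real (A$2$1))
      / ((of_real (A$2$1) * z + of_real (A$2$2)) * (of_real (A$2$1) * z + of_real (A$2$2)))) (at z)"
    unfolding mobius_def[abs_def] using nz by (intro DERIV_divide) (auto intro!: derivative_eq_intros)
  moreover have "of_real (A$1$1) * (of_real (A$2$1) * z + of_real (A$2$2)) - (of_real (A$1$1) * z + of_real (A$1$2)) * of_real (A$2$1)
      = (of_real (A$1$1) * of_real (A$2$2) - of_real (A$1$2) * of_real (A$2$1) :: complex)"
    by (simp add: algebra_simps)
  ultimately show ?thesis unfolding d by (simp add: power2_eq_square)
qed

text \<open>
  A Moebius transformation preserves the length element, and \<open>|d (ln Im z)|\<close> is at most \<open>|dz| / Im z\<close>.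
\<close>

lemma hyp_length_lower_bound:
  fixes A :: "real^2^2"
  assumes A: "det A = 1" and g: "valid_path g" "path_image g \<subseteq> upper_half_plane" "has_hyp_length g l"
  shows "ln (Im (mobius A (pathfinish g))) - ln (Im (mobius A (pathstart g))) \<le> l"
proof -
  obtain S D where S: "finite S" and cont: "continuous_on {0..1} g"
    and D: "\<And>x. x \<in> {0..1} - S \<Longrightarrow> (g has_vector_derivative D x) (at x)"
    using g(1) unfolding valid_path_def piecewise_C1_differentiable_on_def C1_differentiable_on_def by blast
  have pos: "0 < Im (g x)" if "x \<in> {0..1}" for x
  proof -
    have "g x \<in> path_image g" using that by (simp add: path_image_def)
    then show ?thesis using g(2) by (auto simp: upper_half_plane_def)
  qed
  define den where "den x = of_real (A$2$1) * g x + of_real (A$2$2)" for x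
  have den: "den x \<noteq> 0" if "x \<in> {0..1}" for x
    unfolding den_def by (rule mobius_denominator_nonzero[OF A pos[OF that]])
  define \<phi>' where "\<phi>' x = (if x \<in> {0..1} - S then Im (D x * (1 / (den x)\<^sup>2)) / Im (mobius A (g x)) else 0)" for x
  have "(\<phi>' has_integral (ln (Im (mobius A (g 1))) - ln (Im (mobius A (g 0))))) {0..1}"
  proof (rule fundamental_theorem_of_calculus_interior_strong[OF S])
    have "continuous_on {0..1} (\<lambda>x. mobius A (g x))"
      unfolding mobius_def using den by (intro continuous_intros cont) (auto simp: den_def)
    then show "continuous_on {0..1} (\<lambda>x. ln (Im (mobius A (g x))))"
      using Im_mobius_pos[OF A pos] by (intro continuous_intros) (auto simp: less_imp_neq[symmetric])
    fix x assume x: "x \<in> {0<..<1} - S"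
    then have x': "x \<in> {0..1} - S" by auto
    then have px: "0 < Im (g x)" by (intro pos) simp
    have "((\<lambda>x. mobius A (g x)) has_vector_derivative D x * (1 / (den x)\<^sup>2)) (at x)"
      using field_vector_diff_chain_at[OF D[OF x'] mobius_has_field_derivative[OF A px]]
      unfolding o_def den_def .
    then have "((\<lambda>x. Im (mobius A (g x))) has_real_derivative Im (D x * (1 / (den x)\<^sup>2))) (at x)"
      by (auto simp: has_vector_derivative_complex_iff)
    moreover have "0 < Im (mobius A (g x))" by (rule Im_mobius_pos[OF A px])
    ultimately have "((\<lambda>x. ln (Im (mobius A (g x)))) has_real_derivative 1 / Im (mobius A (g x)) * Im (D x * (1 / (den x)\<^sup>2))) (at x)"
      by (intro DERIV_chain2[OF DERIV_ln_divide])
    moreover have "1 / Im (mobius A (g x)) * Im (D x * (1 / (den x)\<^sup>2)) = \<phi>' x"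
      using x' by (simp add: \<phi>'_def)
    ultimately show "((\<lambda>x. ln (Im (mobius A (g x)))) has_vector_derivative \<phi>' x) (at x)"
      by (simp only: has_real_derivative_iff_has_vector_derivative)
  qed simp
  moreover have "((\<lambda>t. norm (vector_derivative g (at t)) / Im (g t)) has_integral l) {0..1}"
    using g(3) unfolding has_hyp_length_def .
  ultimately have "ln (Im (mobius A (g 1))) - ln (Im (mobius A (g 0))) \<le> l"
  proof (rule has_integral_le)
    fix x :: real assume x: "x \<in> {0..1}"
    show "\<phi>' x \<le> norm (vector_derivative g (at x)) / Im (g x)"
    proof (cases "x \<in> {0..1} - S")
      case True
      have "Im (D x * (1 / (den x)\<^sup>2)) \<le> norm (D x * (1 / (den x)\<^sup>2))"
        using abs_Im_le_cmod[of "D x * (1 / (den x)\<^sup>2)"] by linarith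
      also have "\<dots> = norm (D x) / (cmod (den x))\<^sup>2"
        by (simp add: norm_mult norm_divide norm_power)
      finally have "Im (D x * (1 / (den x)\<^sup>2)) / Im (mobius A (g x)) \<le> norm (D x) / (cmod (den x))\<^sup>2 / Im (mobius A (g x))"
        using Im_mobius_pos[OF A pos[OF x]] by (intro divide_right_mono) auto
      then have "\<phi>' x \<le> norm (D x) / (cmod (den x))\<^sup>2 / Im (mobius A (g x))"
        using True by (simp only: \<phi>'_def if_True)
      also have "\<dots> = norm (D x) / Im (g x)"
        using den[OF x] pos[OF x] by (simp add: Im_mobius[OF A pos[OF x]] den_def)
      also have "D x = vector_derivative g (at x)"
        by (rule vector_derivative_at[OF D[OF True], symmetric])
      finally show ?thesis .
    next
      case False
      then have "\<phi>' x = 0" by (simp only: \<phi>'_def if_False)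
      then show ?thesis using pos[OF x] by simp
    qed
  qed
  then show ?thesis by (simp add: pathstart_def pathfinish_def)
qed

lemma mobius_inverse:
  fixes A :: "real^2^2"
  assumes "det A = 1"
  obtains B :: "real^2^2" where "det B = 1" "\<And>z. 0 < Im z \<Longrightarrow> mobius B (mobius A z) = z"
proof -
  have "invertible A" using assms by (simp add: invertible_det_nz)
  then obtain B where B: "A ** B = mat 1" "B ** A = mat 1" unfolding invertible_def by blast
  have "det B = 1" using det_mul[of A B] B assms by simp
  moreover from this have "mobius B (mobius A z) = z" if "0 < Im z" for z
    using that B assms by (simp add: mobius_mult[symmetric] mobius_one)
  ultimately show thesis using that by blast
qed

text \<open>
  The ratio of \<open>|g'|\<close> and \<open>Im g\<close> is constant along the image of a segment of the imaginary axis, so the lower bound on the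
  length is attained.
\<close>

lemma geodesic_segment:
  fixes B :: "real^2^2"
  assumes B: "det B = 1" and t: "0 \<le> t"
  defines "g \<equiv> \<lambda>x. mobius B (Complex 0 (exp (t * x)))"
  shows "valid_path g" "path_image g \<subseteq> upper_half_plane" "has_hyp_length g t"
proof -
  define v where "v x = Complex 0 (exp (t * x))" for x
  have v: "0 < Im (v x)" "cmod (v x) = Im (v x)" for x by (simp_all add: v_def cmod_def)
  have veq: "v x = \<i> * of_real (exp (t * x))" for x by (simp add: v_def Complex_eq)
  define den where "den x = of_real (B$2$1) * v x + of_real (B$2$2)" for x
  have den: "den x \<noteq> 0" for x unfolding den_def by (rule mobius_denominator_nonzero[OF B v(1)])
  define D where "D x = of_real t * v x * (1 / (den x)\<^sup>2)" for x
  have v': "(v has_vector_derivative of_real t * v x) (at x)" for x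
    unfolding v_def has_vector_derivative_complex_iff by (auto intro!: derivative_eq_intros)
  have g': "(g has_vector_derivative D x) (at x)" for x
    using field_vector_diff_chain_at[OF v' mobius_has_field_derivative[OF B v(1)], of x]
    by (simp add: o_def g_def v_def[symmetric] den_def D_def)
  have contv: "continuous_on {0..1} v"
    unfolding veq by (intro continuous_intros)
  have "continuous_on {0..1} D"
    unfolding D_def den_def using den unfolding den_def by (intro continuous_intros contv) auto
  then have "g C1_differentiable_on {0..1}"
    unfolding C1_differentiable_on_def using g' by blast
  then show "valid_path g"
    unfolding valid_path_def by (rule C1_differentiable_imp_piecewise)
  show "path_image g \<subseteq> upper_half_plane"
    using Im_mobius_pos[OF B] by (auto simp: path_image_def g_def upper_half_plane_def)
  have "norm (vector_derivative g (at x)) / Im (g x) = t" for x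
  proof -
    have "vector_derivative g (at x) = D x" by (rule vector_derivative_at[OF g'])
    moreover have "Im (g x) = Im (v x) / (cmod (den x))\<^sup>2"
      unfolding g_def v_def[symmetric] den_def by (rule Im_mobius[OF B v(1)])
    ultimately show ?thesis
      using t v[of x] den[of x] by (simp add: D_def norm_mult norm_divide norm_power)
  qed
  then show "has_hyp_length g t"
    unfolding has_hyp_length_def using has_integral_const_real[of t 0 1] by simp
qed

text \<open>
  Moving the two points to the imaginary axis reduces the claim to the lower bound on lengths and to the geodesic
  segment above.
\<close>

lemma hyp_dist_eq:
  assumes z: "0 < Im z" and w: "0 < Im w" and r: "0 \<le> r" and gap: "hyp_gap z w = gap r"
  shows "hyp_dist z w = r"
proof -
  obtain A :: "real^2^2" and t where A: "det A = 1" "mobius A z = \<i>" "mobius A w = Complex 0 (exp t)"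
    "0 \<le> t" "gap t = hyp_gap z w"
    using two_point_homogeneous[OF z w] .
  have t: "t = r" using A(4,5) gap r by (simp add: gap_eq_iff)
  obtain B :: "real^2^2" where B: "det B = 1" "\<And>z. 0 < Im z \<Longrightarrow> mobius B (mobius A z) = z"
    by (rule mobius_inverse[OF A(1)]) (rule that)
  define g where "g x = mobius B (Complex 0 (exp (t * x)))" for x
  have "valid_path g \<and> path_image g \<subseteq> upper_half_plane \<and> pathstart g = z \<and> pathfinish g = w \<and> has_hyp_length g t"
  proof (intro conjI)
    have "Complex 0 1 = \<i>" by (simp add: complex_eq_iff)
    then show "pathstart g = z" "pathfinish g = w"
      using B(2)[OF z] B(2)[OF w] A by (simp_all add: pathstart_def pathfinish_def g_def)
  qed (use geodesic_segment[OF B(1) A(4)] in \<open>simp_all add: g_def[abs_def]\<close>)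
  moreover have "t \<le> l" if "valid_path g" "path_image g \<subseteq> upper_half_plane" "pathstart g = z" "pathfinish g = w" "has_hyp_length g l" for g l
    using hyp_length_lower_bound[OF A(1) that(1,2,5)] that A by simp
  ultimately have "hyp_dist z w = t"
    unfolding hyp_dist_def by (intro cInf_eq_minimum) auto
  then show ?thesis using t by simp
qed

section \<open>The action of the group\<close>

lemma PSL2R_representative:
  assumes "\<gamma> \<in> carrier PSL2R"
  obtains A where "det A = 1" "A \<in> \<gamma>" "psl_act \<gamma> = mobius A"
proof -
  obtain A :: "real^2^2" where A: "det A = 1" "\<gamma> = {A, - A}"
    using assms carrier_PSL2R by blast
  then have "psl_act \<gamma> = mobius A"
    using psl_act_eq[OF assms, of A] by auto
  then show thesis using that A by blast
qed

lemma psl_act_mult: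
  assumes "\<gamma> \<in> carrier PSL2R" "\<delta> \<in> carrier PSL2R" "0 < Im z"
  shows "psl_act (\<gamma> \<otimes>\<^bsub>PSL2R\<^esub> \<delta>) z = psl_act \<gamma> (psl_act \<delta> z)"
proof -
  interpret group PSL2R by (rule group_PSL2R)
  obtain A where A: "det A = 1" "A \<in> \<gamma>" "psl_act \<gamma> = mobius A" using PSL2R_representative[OF assms(1)] .
  obtain B where B: "det B = 1" "B \<in> \<delta>" "psl_act \<delta> = mobius B" using PSL2R_representative[OF assms(2)] .
  have "A ** B \<in> \<gamma> \<otimes>\<^bsub>PSL2R\<^esub> \<delta>"
    using A(2) B(2) by (auto simp: PSL2R_def FactGroup_def set_mult_def SL2R_def)
  then have "psl_act (\<gamma> \<otimes>\<^bsub>PSL2R\<^esub> \<delta>) z = mobius (A ** B) z"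
    using assms by (intro psl_act_eq) auto
  then show ?thesis using A B assms(3) by (simp add: mobius_mult)
qed

lemma psl_act_one: "psl_act \<one>\<^bsub>PSL2R\<^esub> z = z"
proof -
  interpret group PSL2R by (rule group_PSL2R)
  have "mat 1 \<in> \<one>\<^bsub>PSL2R\<^esub>" by (simp add: PSL2R_def FactGroup_def)
  then show ?thesis using psl_act_eq[OF one_closed] by (simp add: mobius_one)
qed

lemma psl_act_inv:
  assumes "\<gamma> \<in> carrier PSL2R" "0 < Im z"
  shows "psl_act (inv\<^bsub>PSL2R\<^esub> \<gamma>) (psl_act \<gamma> z) = z"
proof -
  interpret group PSL2R by (rule group_PSL2R)
  have "psl_act (inv\<^bsub>PSL2R\<^esub> \<gamma>) (psl_act \<gamma> z) = psl_act (inv\<^bsub>PSL2R\<^esub> \<gamma> \<otimes>\<^bsub>PSL2R\<^esub> \<gamma>) z"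
    by (rule psl_act_mult[symmetric]) (use assms in auto)
  then show ?thesis using assms by (simp add: psl_act_one)
qed

lemma Im_psl_act: "\<gamma> \<in> carrier PSL2R \<Longrightarrow> 0 < Im z \<Longrightarrow> 0 < Im (psl_act \<gamma> z)"
  using PSL2R_representative[of \<gamma>] by (metis Im_mobius_pos)

lemma continuous_on_psl_act:
  assumes "\<gamma> \<in> carrier PSL2R"
  shows "continuous_on upper_half_plane (psl_act \<gamma>)"
proof -
  obtain A where A: "det A = 1" "A \<in> \<gamma>" "psl_act \<gamma> = mobius A" using PSL2R_representative[OF assms] .
  show ?thesis
    unfolding A(3) using mobius_has_field_derivative[OF A(1)]
    by (intro DERIV_continuous_on[where D="\<lambda>z. 1 / (of_real (A$2$1) * z + of_real (A$2$2))\<^sup>2"])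
       (auto simp: upper_half_plane_def intro: DERIV_subset)
qed

lemma psl_act_image:
  assumes \<gamma>: "\<gamma> \<in> carrier PSL2R" and S: "S \<subseteq> upper_half_plane"
  shows "psl_act \<gamma> ` S = upper_half_plane \<inter> psl_act (inv\<^bsub>PSL2R\<^esub> \<gamma>) -` S"
proof -
  interpret group PSL2R by (rule group_PSL2R)
  have pos: "0 < Im z" if "z \<in> S" for z using S that by (auto simp: upper_half_plane_def)
  show ?thesis
  proof (intro equalityI subsetI)
    fix w assume "w \<in> psl_act \<gamma> ` S"
    then show "w \<in> upper_half_plane \<inter> psl_act (inv\<^bsub>PSL2R\<^esub> \<gamma>) -` S"
      using \<gamma> pos by (auto simp: psl_act_inv Im_psl_act upper_half_plane_def)
  next
    fix w assume w: "w \<in> upper_half_plane \<inter> psl_act (inv\<^bsub>PSL2R\<^esub> \<gamma>) -` S"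
    then have "psl_act \<gamma> (psl_act (inv\<^bsub>PSL2R\<^esub> \<gamma>) w) = w"
      using psl_act_inv[of "inv\<^bsub>PSL2R\<^esub> \<gamma>" w] \<gamma> by (simp add: upper_half_plane_def)
    then show "w \<in> psl_act \<gamma> ` S" using w by (auto intro: image_eqI[of _ _ "psl_act (inv\<^bsub>PSL2R\<^esub> \<gamma>) w"])
  qed
qed

section \<open>Hyperbolic area\<close>

lemma sets_hyp_area: "sets hyp_area = sets (lebesgue_on upper_half_plane)"
  and space_hyp_area: "space hyp_area = upper_half_plane"
  by (simp_all add: hyp_area_def)

lemma sets_hyp_area_iff: "S \<in> sets hyp_area \<longleftrightarrow> S \<in> sets lebesgue \<and> S \<subseteq> upper_half_plane"
  unfolding sets_hyp_area by (subst sets_restrict_space_iff) auto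

lemma emeasure_hyp_area_borel:
  assumes [measurable]: "S \<in> sets borel" and S: "S \<subseteq> upper_half_plane"
  shows "emeasure hyp_area S = emeasure nu S"
proof -
  have S': "S \<in> sets (lebesgue_on upper_half_plane)"
    using S sets_hyp_area_iff[of S] sets_hyp_area by auto
  have meas: "(\<lambda>z. ennreal (1 / (Im z)\<^sup>2)) \<in> borel_measurable (lebesgue_on upper_half_plane)"
    by (rule measurable_restrict_space1, rule measurable_completion) measurable
  have "emeasure hyp_area S = (\<integral>\<^sup>+z. ennreal (1 / (Im z)\<^sup>2) * indicator S z \<partial>lebesgue_on upper_half_plane)"
    unfolding hyp_area_def by (rule emeasure_density[OF meas S'])
  also have "\<dots> = (\<integral>\<^sup>+z. ennreal (1 / (Im z)\<^sup>2) * indicator S z * indicator upper_half_plane z \<partial>lebesgue)"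
    by (rule nn_integral_restrict_space) auto
  also have "\<dots> = (\<integral>\<^sup>+z. ennreal (1 / (Im z)\<^sup>2) * indicator S z * indicator upper_half_plane z \<partial>lborel)"
    by (rule nn_integral_completion)
  also have "\<dots> = (\<integral>\<^sup>+z. (indicator upper_half_plane z * ennreal (1 / (Im z)\<^sup>2)) * indicator S z \<partial>lborel)"
    by (simp add: mult_ac)
  also have "\<dots> = emeasure nu S"
    unfolding nu_def by (rule emeasure_density[symmetric]) measurable
  finally show ?thesis .
qed

text \<open>
  Replaces a Lebesgue measurable set by a Borel subset of the same area, to which inner regularity applies.
\<close>

lemma hyp_area_borel_kernel:
  assumes D: "D \<in> sets hyp_area"
  obtains S where "S \<in> sets borel" "S \<subseteq> D" "emeasure nu S = emeasure hyp_area D"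
proof -
  have DL: "D \<in> sets lebesgue" "D \<subseteq> upper_half_plane" using D sets_hyp_area_iff by auto
  define S where "S = main_part lborel D"
  have S: "S \<in> sets borel" using main_part_sets[OF DL(1)] by (simp add: S_def)
  have un: "S \<union> null_part lborel D = D" unfolding S_def by (rule main_part_null_part_Un[OF DL(1)])
  obtain N where N: "N \<in> null_sets lborel" "null_part lborel D \<subseteq> N"
    using null_part[OF DL(1)] by blast
  have SD: "S \<subseteq> D" using un by blast
  then have SU: "S \<subseteq> upper_half_plane" using DL by blast
  define N' where "N' = N \<inter> upper_half_plane"
  have N'b: "N' \<in> sets borel" unfolding N'_def using N by auto
  have "AE z in lborel. z \<notin> N" by (rule AE_not_in[OF N(1)])
  then have "AE z in nu. z \<notin> N"
    unfolding nu_def by (subst AE_density) auto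
  then have "emeasure nu N' = 0"
    using N'b by (intro AE_iff_measurable[THEN iffD1, of N' nu "\<lambda>z. z \<notin> N'"]) (auto simp: N'_def)
  then have N'0: "emeasure hyp_area N' = 0"
    using N'b by (subst emeasure_hyp_area_borel) (auto simp: N'_def)
  have sets: "S \<in> sets hyp_area" "N' \<in> sets hyp_area"
    using S SU N'b by (auto simp: sets_hyp_area_iff N'_def)
  have "emeasure hyp_area D \<le> emeasure hyp_area (S \<union> N')"
    using un N(2) DL(2) sets by (intro emeasure_mono) (auto simp: N'_def)
  also have "\<dots> \<le> emeasure hyp_area S + emeasure hyp_area N'"
    by (rule emeasure_subadditive[OF sets])
  finally have "emeasure hyp_area D \<le> emeasure hyp_area S" using N'0 by simp
  moreover have "emeasure hyp_area S \<le> emeasure hyp_area D" by (rule emeasure_mono[OF SD D])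
  ultimately show thesis
    using that[OF S SD] emeasure_hyp_area_borel[OF S SU] by simp
qed

section \<open>Boxes\<close>

definition half_plane_box :: "real \<Rightarrow> real \<Rightarrow> complex set" where
  "half_plane_box a M = {z. a \<le> Im z \<and> Im z \<le> M \<and> \<bar>Re z\<bar> \<le> M}"

lemma compact_subset_box:
  assumes K: "compact K" "K \<subseteq> upper_half_plane"
  obtains a M where "0 < a" "K \<subseteq> half_plane_box a M"
proof (cases "K = {}")
  case True
  then show thesis using that[of 1 1] by simp
next
  case False
  obtain k where k: "k \<in> K" "\<And>z. z \<in> K \<Longrightarrow> Im k \<le> Im z"
    using continuous_attains_inf[OF K(1) False, of Im] continuous_on_Im[OF continuous_on_id] by (auto simp: id_def)
  obtain M where M: "\<And>z. z \<in> K \<Longrightarrow> norm z \<le> M"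
    using compact_imp_bounded[OF K(1)] by (auto simp: bounded_iff)
  have "K \<subseteq> half_plane_box (Im k) M"
    using k(2) M abs_Re_le_cmod abs_Im_le_cmod unfolding half_plane_box_def
    by (smt (verit) mem_Collect_eq subsetI)
  moreover have "0 < Im k" using k(1) K(2) by (auto simp: upper_half_plane_def)
  ultimately show thesis using that by blast
qed

text \<open>
  This confines all translates of a compact set that come near it to one box.
\<close>

lemma hyp_gap_box:
  assumes a: "0 < a" and q: "0 \<le> q" and z: "z \<in> half_plane_box a M"
    and w: "0 < Im w" "hyp_gap z w \<le> q"
  shows "w \<in> half_plane_box (a / (q + 2)) (M + (q + 2) * M)"
proof -
  define y v where "y = Im z" and "v = Im w"
  have y: "a \<le> y" "y \<le> M" "0 < y" "\<bar>Re z\<bar> \<le> M" using z a by (auto simp: half_plane_box_def y_def)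
  have v: "0 < v" using w by (simp add: v_def)
  have gap: "(Re z - Re w)\<^sup>2 + (y - v)\<^sup>2 \<le> q * (y * v)"
    using w y v by (simp add: hyp_gap_def cmod_power2 y_def v_def divide_le_eq)
  then have "(y - v)\<^sup>2 \<le> q * (y * v)" using zero_le_power2[of "Re z - Re w"] by linarith
  then have sq: "y * y + v * v \<le> (q + 2) * (y * v)" by (simp add: power2_eq_square algebra_simps)
  have "v * v \<le> (q + 2) * (y * v)" using sq zero_le_square[of y] by linarith
  then have "v * v \<le> ((q + 2) * y) * v" by (simp only: mult.assoc)
  then have vy: "v \<le> (q + 2) * y" using v by simp
  have "y * y \<le> (q + 2) * (y * v)" using sq zero_le_square[of v] by linarith
  then have "y * y \<le> ((q + 2) * v) * y" by (simp only: mult_ac)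
  then have yv: "y \<le> (q + 2) * v" using y(3) by simp
  have vM: "v \<le> (q + 2) * M" using vy y q mult_left_mono[of y M "q + 2"] by linarith
  have "(Re w - Re z)\<^sup>2 \<le> q * (y * v)" using gap zero_le_power2[of "y - v"]
    unfolding power2_commute[of "Re w" "Re z"] by linarith
  also have "\<dots> \<le> (q + 2) * (M * ((q + 2) * M))"
    using q y v vM by (intro mult_mono) auto
  also have "\<dots> \<le> ((q + 2) * M)\<^sup>2" by (simp add: power2_eq_square mult_ac)
  finally have "\<bar>Re w - Re z\<bar> \<le> (q + 2) * M"
    using y q by (subst (asm) abs_le_square_iff[symmetric]) (simp add: abs_mult)
  then have "\<bar>Re w\<bar> \<le> M + (q + 2) * M" using y(4) by linarith
  moreover have "a / (q + 2) \<le> v" using yv y(1) q by (simp add: divide_le_eq mult.commute)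
  moreover have "v \<le> M + (q + 2) * M" using vM y by linarith
  ultimately show ?thesis by (simp add: half_plane_box_def v_def)
qed

lemma emeasure_box_finite:
  assumes a: "0 < a"
  shows "emeasure nu (half_plane_box a M) < \<infinity>"
proof -
  have box: "half_plane_box a M = cbox (Complex (- M) a) (Complex M M)"
    by (auto simp: half_plane_box_def cbox_def Basis_complex_def)
  have [measurable]: "half_plane_box a M \<in> sets borel" unfolding box by simp
  have "emeasure nu (half_plane_box a M)
      = (\<integral>\<^sup>+z. (indicator upper_half_plane z * ennreal (1 / (Im z)\<^sup>2)) * indicator (half_plane_box a M) z \<partial>lborel)"
    unfolding nu_def by (rule emeasure_density) measurable
  also have "\<dots> \<le> (\<integral>\<^sup>+z. ennreal (1 / a\<^sup>2) * indicator (half_plane_box a M) z \<partial>lborel)"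
    using a by (intro nn_integral_mono)
      (auto simp: half_plane_box_def split: split_indicator intro!: ennreal_leI divide_left_mono power_mono mult_pos_pos)
  also have "\<dots> = ennreal (1 / a\<^sup>2) * emeasure lborel (half_plane_box a M)"
    by (simp add: nn_integral_cmult_indicator)
  also have "\<dots> < \<infinity>"
    unfolding box by (simp add: ennreal_mult_less_top emeasure_lborel_cbox_eq)
  finally show ?thesis .
qed

section \<open>The tiling by a fundamental region\<close>

text \<open>
  The boundary part \<open>F - F0\<close> is null, and so are its countably many translates.
\<close>

lemma fundamental_region_tiling:
  assumes \<Gamma>: "subgroup \<Gamma> PSL2R" and F0: "open F0" "F0 \<noteq> {}" "F0 \<subseteq> upper_half_plane"
    and F: "F = closure F0 \<inter> upper_half_plane" "F - F0 \<in> null_sets hyp_area"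
    and cover: "(\<Union>\<gamma>\<in>\<Gamma>. psl_act \<gamma> ` F) = upper_half_plane"
    and disj: "\<And>\<gamma>. \<gamma> \<in> \<Gamma> \<Longrightarrow> \<gamma> \<noteq> \<one>\<^bsub>PSL2R\<^esub> \<Longrightarrow> F0 \<inter> psl_act \<gamma> ` F0 = {}"
  shows "tiling \<Gamma> psl_act (\<lambda>\<gamma>. inv\<^bsub>PSL2R\<^esub> \<gamma>) F0"
proof -
  interpret group PSL2R by (rule group_PSL2R)
  have carr: "\<gamma> \<in> carrier PSL2R" if "\<gamma> \<in> \<Gamma>" for \<gamma> using \<Gamma> that subgroup.subset by blast
  have pos: "0 < Im z" if "z \<in> F0" for z using F0(3) that by (auto simp: upper_half_plane_def)
  have disjoint: "\<gamma> = \<delta>" if g: "\<gamma> \<in> \<Gamma>" "\<delta> \<in> \<Gamma>" "z \<in> F0" "w \<in> F0" "psl_act \<gamma> z = psl_act \<delta> w" for \<gamma> \<delta> z w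
  proof (rule ccontr)
    assume "\<gamma> \<noteq> \<delta>"
    let ?\<eta> = "inv\<^bsub>PSL2R\<^esub> \<delta> \<otimes>\<^bsub>PSL2R\<^esub> \<gamma>"
    have "?\<eta> \<in> \<Gamma>" using \<Gamma> g by (simp add: subgroup.m_closed subgroup.m_inv_closed)
    moreover have "?\<eta> \<noteq> \<one>\<^bsub>PSL2R\<^esub>"
    proof
      assume "?\<eta> = \<one>\<^bsub>PSL2R\<^esub>"
      then have "\<delta> \<otimes>\<^bsub>PSL2R\<^esub> ?\<eta> = \<delta>" using carr g by simp
      then show False using carr g \<open>\<gamma> \<noteq> \<delta>\<close> by (simp add: m_assoc[symmetric])
    qed
    moreover have "psl_act ?\<eta> z = w"
    proof -
      have "psl_act ?\<eta> z = psl_act (inv\<^bsub>PSL2R\<^esub> \<delta>) (psl_act \<gamma> z)"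
        by (rule psl_act_mult) (use carr g pos in auto)
      also have "\<dots> = w" unfolding g(5) by (rule psl_act_inv) (use carr g pos in auto)
      finally show ?thesis .
    qed
    ultimately show False using disj[of ?\<eta>] g(3,4) by blast
  qed
  have meas: "psl_act \<gamma> \<in> borel_measurable borel" if "\<gamma> \<in> \<Gamma>" for \<gamma>
    by (rule PSL2R_representative[OF carr[OF that]]) simp
  have nn: "(\<integral>\<^sup>+z. f (psl_act \<gamma> z) \<partial>nu) = (\<integral>\<^sup>+z. f z \<partial>nu)" if "\<gamma> \<in> \<Gamma>" "f \<in> borel_measurable borel" for \<gamma> f
    by (rule PSL2R_representative[OF carr[OF that(1)]]) (simp add: nn_integral_nu_mobius that(2))
  have "countable \<Gamma>"
  proof -
    have inj: "inj_on (\<lambda>\<gamma>. psl_act \<gamma> ` F0) \<Gamma>"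
    proof (rule inj_onI)
      fix \<gamma> \<delta> assume g: "\<gamma> \<in> \<Gamma>" "\<delta> \<in> \<Gamma>" "psl_act \<gamma> ` F0 = psl_act \<delta> ` F0"
      obtain z where z: "z \<in> F0" using F0(2) by blast
      then obtain w where "w \<in> F0" "psl_act \<gamma> z = psl_act \<delta> w" using g(3) by (metis imageE imageI)
      then show "\<gamma> = \<delta>" using disjoint g z by blast
    qed
    have "countable ((\<lambda>\<gamma>. psl_act \<gamma> ` F0) ` \<Gamma>)"
    proof (rule countable_disjoint_open_subsets)
      fix S assume "S \<in> (\<lambda>\<gamma>. psl_act \<gamma> ` F0) ` \<Gamma>"
      then obtain \<gamma> where g: "\<gamma> \<in> \<Gamma>" "S = psl_act \<gamma> ` F0" by blast
      have "open (upper_half_plane \<inter> psl_act (inv\<^bsub>PSL2R\<^esub> \<gamma>) -` F0)"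
        by (rule continuous_open_preimage[OF continuous_on_psl_act open_upper_half_plane F0(1)])
           (use carr g in simp)
      then show "open S" unfolding g(2) psl_act_image[OF carr[OF g(1)] F0(3)] .
    next
      show "disjoint ((\<lambda>\<gamma>. psl_act \<gamma> ` F0) ` \<Gamma>)"
        unfolding disjoint_def using disjoint by blast
    qed
    then show ?thesis using countable_image_inj_on inj by blast
  qed
  have FU: "F \<subseteq> upper_half_plane" using F(1) by blast
  have Fb: "F - F0 \<in> sets borel" unfolding F(1) using F0(1) by auto
  have "emeasure nu (F - F0) = 0"
    using F(2) emeasure_hyp_area_borel[OF Fb] FU by (auto simp: null_sets_def)
  then have null: "F - F0 \<in> null_sets nu" using Fb by (auto simp: null_sets_def)
  have "AE z in nu. \<forall>\<gamma>\<in>\<Gamma>. psl_act (inv\<^bsub>PSL2R\<^esub> \<gamma>) z \<notin> F - F0"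
  proof (subst AE_ball_countable[OF \<open>countable \<Gamma>\<close>], intro ballI)
    fix \<gamma> assume g: "\<gamma> \<in> \<Gamma>"
    let ?\<delta> = "inv\<^bsub>PSL2R\<^esub> \<gamma>"
    have d: "?\<delta> \<in> \<Gamma>" using \<Gamma> g by (simp add: subgroup.m_inv_closed)
    note [measurable] = meas[OF d] Fb
    have "(\<integral>\<^sup>+z. indicator (F - F0) (psl_act ?\<delta> z) \<partial>nu) = (\<integral>\<^sup>+z. indicator (F - F0) z \<partial>nu)"
      by (rule nn[OF d]) measurable
    also have "\<dots> = 0" using null by auto
    finally have "AE z in nu. indicator (F - F0) (psl_act ?\<delta> z) = (0::ennreal)"
      by (subst (asm) nn_integral_0_iff_AE) auto
    then show "AE z in nu. psl_act ?\<delta> z \<notin> F - F0"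
      by eventually_elim (auto simp: indicator_def split: if_splits)
  qed
  with AE_nu have cov: "AE z in nu. \<exists>\<gamma>\<in>\<Gamma>. z \<in> psl_act \<gamma> ` F0"
  proof eventually_elim
    fix z assume z: "0 < Im z" and n: "\<forall>\<gamma>\<in>\<Gamma>. psl_act (inv\<^bsub>PSL2R\<^esub> \<gamma>) z \<notin> F - F0"
    then have "z \<in> (\<Union>\<gamma>\<in>\<Gamma>. psl_act \<gamma> ` F)" using cover by (simp add: upper_half_plane_def)
    then obtain \<gamma> w where g: "\<gamma> \<in> \<Gamma>" "w \<in> F" "z = psl_act \<gamma> w" by blast
    then have "psl_act (inv\<^bsub>PSL2R\<^esub> \<gamma>) z = w"
      using psl_act_inv[OF carr[OF g(1)]] FU by (auto simp: upper_half_plane_def)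
    then have "w \<in> F0" using n g by auto
    then show "\<exists>\<gamma>\<in>\<Gamma>. z \<in> psl_act \<gamma> ` F0" using g by blast
  qed
  show ?thesis
  proof
    show "countable \<Gamma>" by fact
    show "F0 \<in> sets borel" using F0(1) by simp
    show "F0 \<subseteq> upper_half_plane" by fact
    show "AE z in nu. \<exists>g\<in>\<Gamma>. z \<in> psl_act g ` F0" by (rule cov)
  next
    fix g assume g: "g \<in> \<Gamma>"
    show "psl_act g \<in> borel_measurable borel" by (rule meas[OF g])
    show "inv\<^bsub>PSL2R\<^esub> g \<in> \<Gamma>" using \<Gamma> g by (simp add: subgroup.m_inv_closed)
    show "inv\<^bsub>PSL2R\<^esub> (inv\<^bsub>PSL2R\<^esub> g) = g" using carr[OF g] by simp
    show "0 < Im (psl_act g z)" if "0 < Im z" for z by (rule Im_psl_act[OF carr[OF g] that])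
    show "(\<integral>\<^sup>+z. f (psl_act g z) \<partial>nu) = (\<integral>\<^sup>+z. f z \<partial>nu)" if "f \<in> borel_measurable borel" for f by (rule nn[OF g that])
    show "psl_act (inv\<^bsub>PSL2R\<^esub> g) (psl_act g z) = z" if "0 < Im z" for z by (rule psl_act_inv[OF carr[OF g] that])
    show "hyp_gap (psl_act g z) (psl_act g w) = hyp_gap z w" if "0 < Im z" "0 < Im w" for z w
      by (rule PSL2R_representative[OF carr[OF g]]) (simp add: hyp_gap_mobius that)
    show "g = h" if "h \<in> \<Gamma>" "z \<in> F0" "w \<in> F0" "psl_act g z = psl_act h w" for h z w
      by (rule disjoint[OF g that])
  qed
qed

section \<open>Compact pieces\<close>

text \<open>
  The values of the gap between \<open>K\<close> and those translates that come near it form a compact set, and \<open>q\<close> is not in it.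
\<close>

lemma avoiding_orbit_has_gap:
  assumes \<Gamma>: "subgroup \<Gamma> PSL2R"
    and K: "compact K" "K \<subseteq> upper_half_plane" "0 < emeasure nu K"
    and disj: "\<And>\<gamma> \<delta> z w. \<gamma> \<in> \<Gamma> \<Longrightarrow> \<delta> \<in> \<Gamma> \<Longrightarrow> z \<in> K \<Longrightarrow> w \<in> K \<Longrightarrow> psl_act \<gamma> z = psl_act \<delta> w \<Longrightarrow> \<gamma> = \<delta>"
    and avoid: "\<And>\<gamma> z w. \<gamma> \<in> \<Gamma> \<Longrightarrow> z \<in> K \<Longrightarrow> w \<in> K \<Longrightarrow> hyp_gap z (psl_act \<gamma> w) \<noteq> q"
    and q: "0 \<le> q"
  shows "\<exists>e>0. \<forall>\<gamma>\<in>\<Gamma>. \<forall>z\<in>K. \<forall>w\<in>K. \<not> (q - e < hyp_gap z (psl_act \<gamma> w) \<and> hyp_gap z (psl_act \<gamma> w) \<le> q)"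
proof -
  have carr: "\<gamma> \<in> carrier PSL2R" if "\<gamma> \<in> \<Gamma>" for \<gamma> using \<Gamma> that subgroup.subset by blast
  have pos: "0 < Im z" if "z \<in> K" for z using K(2) that by (auto simp: upper_half_plane_def)
  have cont: "continuous_on (K \<times> K) (\<lambda>(z, w). hyp_gap z (psl_act \<gamma> w))" if g: "\<gamma> \<in> \<Gamma>" for \<gamma>
  proof -
    have c: "continuous_on (K \<times> K) (\<lambda>p. psl_act \<gamma> (snd p))"
      by (rule continuous_on_compose2[OF continuous_on_psl_act[OF carr[OF g]]])
         (use K(2) in \<open>auto intro: continuous_intros\<close>)
    show ?thesis
      unfolding case_prod_beta hyp_gap_def
      using pos Im_psl_act[OF carr[OF g]]
      by (intro continuous_intros c) (auto simp: less_imp_neq[symmetric])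
  qed
  have cpt: "compact ((\<lambda>(z, w). hyp_gap z (psl_act \<gamma> w)) ` (K \<times> K))" if "\<gamma> \<in> \<Gamma>" for \<gamma>
    using cont[OF that] compact_Times[OF K(1) K(1)] by (rule compact_continuous_image)
  \<comment> \<open>Only finitely many translates of \<open>K\<close> come near \<open>K\<close>: they are disjoint, have the same positive area, and lie in
    a common box of finite area.\<close>
  define T where "T = {\<gamma>\<in>\<Gamma>. \<exists>z\<in>K. \<exists>w\<in>K. hyp_gap z (psl_act \<gamma> w) \<le> q}"
  have "finite T"
  proof (rule ccontr)
    assume inf: "infinite T"
    obtain a M where box: "0 < a" "K \<subseteq> half_plane_box a M"
      using compact_subset_box[OF K(1,2)] by blast
    have "compact ((\<lambda>(z, w). hyp_gap z (psl_act \<one>\<^bsub>PSL2R\<^esub> w)) ` (K \<times> K))"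
      by (rule cpt[OF subgroup.one_closed[OF \<Gamma>]])
    from compact_imp_bounded[OF this] obtain q2
      where q2': "\<And>x. x \<in> (\<lambda>(z, w). hyp_gap z (psl_act \<one>\<^bsub>PSL2R\<^esub> w)) ` (K \<times> K) \<Longrightarrow> norm x \<le> q2"
      unfolding bounded_iff by blast
    have q2: "\<bar>hyp_gap z w\<bar> \<le> q2" if "z \<in> K" "w \<in> K" for z w
      using q2'[of "hyp_gap z w"] that by (force simp: psl_act_one)
    define q' where "q' = max q2 0"
    define a1 M1 where "a1 = a / (q + 2)" and "M1 = M + (q + 2) * M"
    define a2 M2 where "a2 = a1 / (q' + 2)" and "M2 = M1 + (q' + 2) * M1"
    let ?Q = "half_plane_box a2 M2"
    have a2: "0 < a1" "0 < a2" using box q by (simp_all add: a1_def a2_def q'_def)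
    have sub: "psl_act \<gamma> ` K \<subseteq> ?Q" if t: "\<gamma> \<in> T" for \<gamma>
    proof (rule image_subsetI)
      fix k assume k: "k \<in> K"
      from t obtain z w where g: "\<gamma> \<in> \<Gamma>" and zw: "z \<in> K" "w \<in> K" "hyp_gap z (psl_act \<gamma> w) \<le> q"
        by (auto simp: T_def)
      have w1: "psl_act \<gamma> w \<in> half_plane_box a1 M1"
        unfolding a1_def M1_def
        by (rule hyp_gap_box[OF box(1) q _ Im_psl_act[OF carr[OF g] pos[OF zw(2)]] zw(3)])
           (use zw(1) box(2) in blast)
      have "hyp_gap (psl_act \<gamma> w) (psl_act \<gamma> k) = hyp_gap w k"
        by (rule PSL2R_representative[OF carr[OF g]]) (simp add: hyp_gap_mobius pos zw k)
      moreover have "hyp_gap w k \<le> q'" using q2[OF zw(2) k] by (simp add: q'_def)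
      ultimately have le: "hyp_gap (psl_act \<gamma> w) (psl_act \<gamma> k) \<le> q'" by simp
      show "psl_act \<gamma> k \<in> ?Q"
        unfolding a2_def M2_def
        by (rule hyp_gap_box[OF a2(1) _ w1 Im_psl_act[OF carr[OF g] pos[OF k]] le]) (simp add: q'_def)
    qed
    have Kb: "K \<in> sets borel" by (rule borel_closed[OF compact_imp_closed[OF K(1)]])
    have img: "psl_act \<gamma> ` K \<in> sets borel" "emeasure nu (psl_act \<gamma> ` K) = emeasure nu K" if g: "\<gamma> \<in> \<Gamma>" for \<gamma>
    proof -
      have "compact (psl_act \<gamma> ` K)"
        by (rule compact_continuous_image[OF continuous_on_subset[OF continuous_on_psl_act[OF carr[OF g]] K(2)] K(1)])
      then show b: "psl_act \<gamma> ` K \<in> sets borel" by (rule borel_closed[OF compact_imp_closed])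
      obtain A where A: "det A = 1" "A \<in> \<gamma>" "psl_act \<gamma> = mobius A" using PSL2R_representative[OF carr[OF g]] .
      note [measurable] = b Kb
      have "emeasure nu (psl_act \<gamma> ` K) = (\<integral>\<^sup>+z. indicator (psl_act \<gamma> ` K) z \<partial>nu)" using b by simp
      also have "\<dots> = (\<integral>\<^sup>+z. indicator (psl_act \<gamma> ` K) (psl_act \<gamma> z) \<partial>nu)"
        unfolding A(3) by (rule nn_integral_nu_mobius[OF A(1), symmetric]) (use b A(3) in simp)
      also have "\<dots> = (\<integral>\<^sup>+z. indicator K z \<partial>nu)"
      proof (rule nn_integral_nu_cong)
        fix z assume z: "0 < Im z"
        have "psl_act \<gamma> z \<in> psl_act \<gamma> ` K \<longleftrightarrow> z \<in> K"
        proof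
          assume "psl_act \<gamma> z \<in> psl_act \<gamma> ` K"
          then obtain k where k: "k \<in> K" "psl_act \<gamma> z = psl_act \<gamma> k" by blast
          have "z = psl_act (inv\<^bsub>PSL2R\<^esub> \<gamma>) (psl_act \<gamma> z)"
            by (rule psl_act_inv[OF carr[OF g] z, symmetric])
          also have "\<dots> = k"
            unfolding k(2) by (rule psl_act_inv[OF carr[OF g] pos[OF k(1)]])
          finally show "z \<in> K" using k(1) by simp
        qed simp
        then show "indicator (psl_act \<gamma> ` K) (psl_act \<gamma> z) = (indicator K z :: ennreal)"
          by (simp add: indicator_def)
      qed
      also have "\<dots> = emeasure nu K" using Kb by simp
      finally show "emeasure nu (psl_act \<gamma> ` K) = emeasure nu K" .
    qed
    have Qfin: "emeasure nu ?Q < \<infinity>" by (rule emeasure_box_finite[OF a2(2)])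
    have Qb: "?Q \<in> sets nu"
    proof -
      have "?Q = cbox (Complex (- M2) a2) (Complex M2 M2)"
        by (auto simp: half_plane_box_def cbox_def Basis_complex_def)
      then show ?thesis by simp
    qed
    have le: "of_nat n * emeasure nu K \<le> emeasure nu ?Q" for n
    proof -
      obtain T' where T': "T' \<subseteq> T" "finite T'" "card T' = n"
        using infinite_arbitrarily_large[OF inf] by blast
      have T'\<Gamma>: "\<gamma> \<in> \<Gamma>" if "\<gamma> \<in> T'" for \<gamma> using T'(1) that by (auto simp: T_def)
      have "of_nat n * emeasure nu K = (\<Sum>\<gamma>\<in>T'. emeasure nu (psl_act \<gamma> ` K))"
        using T' T'\<Gamma> img(2) by simp
      also have "\<dots> = emeasure nu (\<Union>\<gamma>\<in>T'. psl_act \<gamma> ` K)"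
      proof (rule sum_emeasure[OF _ _ T'(2)])
        show "(\<lambda>\<gamma>. psl_act \<gamma> ` K) ` T' \<subseteq> sets nu" using img(1) T'\<Gamma> by auto
        show "disjoint_family_on (\<lambda>\<gamma>. psl_act \<gamma> ` K) T'"
          unfolding disjoint_family_on_def using disj T'\<Gamma> by blast
      qed
      also have "\<dots> \<le> emeasure nu ?Q"
        by (rule emeasure_mono[OF _ Qb]) (use sub T'(1) in blast)
      finally show ?thesis .
    qed
    obtain c where c: "emeasure nu K = ennreal c" "0 < c"
    proof (cases "emeasure nu K")
      case (real x)
      then show thesis using that[of x] K(3) by auto
    next
      case top
      then show thesis using le[of 1] Qfin by auto
    qed
    obtain d where d: "emeasure nu ?Q = ennreal d" "0 \<le> d"
      using Qfin by (cases "emeasure nu ?Q") auto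
    obtain n :: nat where n: "d / c < real n" using reals_Archimedean2 by blast
    have "ennreal (real n * c) \<le> ennreal d"
      using le[of n] c d by (simp add: ennreal_mult ennreal_of_nat_eq_real_of_nat)
    then have "real n * c \<le> d" using d(2) by (simp add: ennreal_le_iff)
    then show False using n c(2) by (simp add: divide_less_eq)
  qed
  define C where "C = (\<Union>\<gamma>\<in>T. (\<lambda>(z, w). hyp_gap z (psl_act \<gamma> w)) ` (K \<times> K))"
  have "compact C"
    unfolding C_def using \<open>finite T\<close>
    by (intro compact_UN cpt) (auto simp: T_def)
  then have "open (- C)" using compact_imp_closed by auto
  moreover have "q \<in> - C" using avoid by (auto simp: C_def T_def)
  ultimately obtain e where e: "0 < e" "ball q e \<subseteq> - C" unfolding open_contains_ball by blast
  have "\<not> (q - e < hyp_gap z (psl_act \<gamma> w) \<and> hyp_gap z (psl_act \<gamma> w) \<le> q)"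
    if "\<gamma> \<in> \<Gamma>" "z \<in> K" "w \<in> K" for \<gamma> z w
  proof
    assume h: "q - e < hyp_gap z (psl_act \<gamma> w) \<and> hyp_gap z (psl_act \<gamma> w) \<le> q"
    then have "hyp_gap z (psl_act \<gamma> w) \<in> ball q e" using e(1) by (simp add: dist_real_def)
    moreover have "hyp_gap z (psl_act \<gamma> w) \<in> C" using h that by (force simp: C_def T_def)
    ultimately show False using e(2) by blast
  qed
  then show ?thesis using e(1) by blast
qed

text \<open>
  The orbit \<open>E\<close> of \<open>K\<close> is an invariant Borel set that meets \<open>F\<close> in \<open>K\<close> and avoids all distances in an interval
  ending at \<open>r\<close>.
\<close>

lemma compact_piece_bound:
  assumes \<Gamma>: "subgroup \<Gamma> PSL2R" and tiling: "tiling \<Gamma> psl_act (\<lambda>\<gamma>. inv\<^bsub>PSL2R\<^esub> \<gamma>) F"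
    and fin: "emeasure nu F < \<infinity>"
    and K: "compact K" "K \<subseteq> F"
    and avoid: "\<And>\<gamma> z w. \<gamma> \<in> \<Gamma> \<Longrightarrow> z \<in> K \<Longrightarrow> w \<in> K \<Longrightarrow> hyp_gap z (psl_act \<gamma> w) \<noteq> gap r"
    and r: "2 \<le> r"
  shows "emeasure nu K \<le> ennreal ((r + 1) * exp (- r / 2)) * emeasure nu F"
proof (cases "emeasure nu K = 0")
  case False
  interpret group PSL2R by (rule group_PSL2R)
  interpret tiling \<Gamma> psl_act "\<lambda>\<gamma>. inv\<^bsub>PSL2R\<^esub> \<gamma>" F by (rule tiling)
  have carr: "\<gamma> \<in> carrier PSL2R" if "\<gamma> \<in> \<Gamma>" for \<gamma> using \<Gamma> that subgroup.subset by blast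
  have KU: "K \<subseteq> upper_half_plane" using K(2) F(2) by blast
  have pos: "0 < Im z" if "z \<in> K" for z using KU that by (auto simp: upper_half_plane_def)
  define E where "E = (\<Union>\<gamma>\<in>\<Gamma>. psl_act \<gamma> ` K)"
  have "finite_invariant_tiling \<Gamma> psl_act (\<lambda>\<gamma>. inv\<^bsub>PSL2R\<^esub> \<gamma>) F E"
  proof
    have "psl_act \<gamma> ` K \<in> sets borel" if g: "\<gamma> \<in> \<Gamma>" for \<gamma>
    proof -
      have "compact (psl_act \<gamma> ` K)"
        by (rule compact_continuous_image[OF continuous_on_subset[OF continuous_on_psl_act[OF carr[OF g]] KU] K(1)])
      then show ?thesis by (rule borel_closed[OF compact_imp_closed])
    qed
    then show "E \<in> sets borel" unfolding E_def using countable_G by (intro sets.countable_UN') auto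
    show "E \<subseteq> upper_half_plane"
      using Im_psl_act[OF carr pos] by (auto simp: E_def upper_half_plane_def)
    fix g z assume g: "g \<in> \<Gamma>" and z: "0 < Im z"
    show "psl_act g z \<in> E \<longleftrightarrow> z \<in> E"
    proof
      assume "psl_act g z \<in> E"
      then obtain h k where h: "h \<in> \<Gamma>" "k \<in> K" "psl_act g z = psl_act h k" by (auto simp: E_def)
      have "z = psl_act (inv\<^bsub>PSL2R\<^esub> g) (psl_act h k)"
        using psl_act_inv[OF carr[OF g] z] h(3) by simp
      also have "\<dots> = psl_act (inv\<^bsub>PSL2R\<^esub> g \<otimes>\<^bsub>PSL2R\<^esub> h) k"
        by (rule psl_act_mult[symmetric]) (use carr g h pos in auto)
      finally show "z \<in> E"
        unfolding E_def using \<Gamma> g h by (blast intro: subgroup.m_closed subgroup.m_inv_closed)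
    next
      assume "z \<in> E"
      then obtain h k where h: "h \<in> \<Gamma>" "k \<in> K" "z = psl_act h k" by (auto simp: E_def)
      have "psl_act g z = psl_act (g \<otimes>\<^bsub>PSL2R\<^esub> h) k"
        unfolding h(3) by (rule psl_act_mult[symmetric]) (use carr g h pos in auto)
      then show "psl_act g z \<in> E"
        unfolding E_def using \<Gamma> g h by (blast intro: subgroup.m_closed)
    qed
  next
    show "emeasure nu F < \<infinity>" by (rule fin)
  qed
  then interpret finite_invariant_tiling \<Gamma> psl_act "\<lambda>\<gamma>. inv\<^bsub>PSL2R\<^esub> \<gamma>" F E .
  have one: "\<one>\<^bsub>PSL2R\<^esub> \<in> \<Gamma>" by (rule subgroup.one_closed[OF \<Gamma>])
  have FE: "F \<inter> E = K"
  proof (intro equalityI subsetI)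
    fix z assume "z \<in> F \<inter> E"
    then obtain g k where g: "g \<in> \<Gamma>" "k \<in> K" "z = psl_act g k" "z \<in> F" by (auto simp: E_def)
    then have "psl_act \<one>\<^bsub>PSL2R\<^esub> z = psl_act g k" by (simp add: psl_act_one)
    then have "\<one>\<^bsub>PSL2R\<^esub> = g" using disjoint[OF one g(1) g(4)] g(2) K(2) by blast
    then have "z = k" using g(3) by (metis psl_act_one)
    then show "z \<in> K" using g(2) by simp
  next
    fix z assume "z \<in> K"
    then have "z = psl_act \<one>\<^bsub>PSL2R\<^esub> z" by (simp add: psl_act_one)
    then show "z \<in> F \<inter> E" using \<open>z \<in> K\<close> K(2) one by (auto simp: E_def)
  qed
  have "\<exists>e>0. \<forall>\<gamma>\<in>\<Gamma>. \<forall>z\<in>K. \<forall>w\<in>K. \<not> (gap r - e < hyp_gap z (psl_act \<gamma> w) \<and> hyp_gap z (psl_act \<gamma> w) \<le> gap r)"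
  proof (rule avoiding_orbit_has_gap[OF \<Gamma> K(1) KU _ _ avoid gap_nonneg])
    show "0 < emeasure nu K" using False by (simp add: zero_less_iff_neq_zero)
    show "\<gamma> = \<delta>" if "\<gamma> \<in> \<Gamma>" "\<delta> \<in> \<Gamma>" "z \<in> K" "w \<in> K" "psl_act \<gamma> z = psl_act \<delta> w" for \<gamma> \<delta> z w
      using disjoint[OF that(1,2)] that K(2) by blast
  qed
  then obtain e where e: "0 < e"
    "\<And>\<gamma> z w. \<gamma> \<in> \<Gamma> \<Longrightarrow> z \<in> K \<Longrightarrow> w \<in> K \<Longrightarrow> \<not> (gap r - e < hyp_gap z (psl_act \<gamma> w) \<and> hyp_gap z (psl_act \<gamma> w) \<le> gap r)"
    by blast
  have "isCont gap r" using has_real_derivative_gap by (rule DERIV_isCont)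
  then obtain \<delta> where \<delta>: "0 < \<delta>" "\<And>x. dist x r < \<delta> \<Longrightarrow> dist (gap x) (gap r) < e"
    unfolding continuous_at_eps_delta using e(1) by blast
  have area: "0 < area"
  proof -
    have "0 < emeasure nu (F \<inter> E)" using False FE by (simp add: zero_less_iff_neq_zero)
    then have "0 < part" by (simp add: emeasure_part)
    then show ?thesis using part_le_area by simp
  qed
  have "part / area \<le> (r + 1) * exp (- r / 2)"
  proof (rule avoidance_constant_limit[OF r \<delta>(1)])
    fix R assume R: "r - \<delta> < R" "R < r" "0 < R"
    have "gap r - e < gap R"
      using \<delta>(2)[of R] R by (simp add: dist_real_def abs_less_iff)
    then have "\<not> (gap R \<le> hyp_gap z w \<and> hyp_gap z w < gap r)" if "z \<in> F \<inter> E" "w \<in> E" for z w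
      using e(2) that unfolding FE by (fastforce simp: E_def)
    then have "part \<le> (2 / pi * (exp (- R / 2) / sqrt (1 - exp (- R)) * (R + 2 * ln 2))
      + 4 / pi * ((r - R) / sqrt (gap r - gap R))) * area"
      using R by (intro density_bound_annulus) auto
    then show "part / area \<le> 2 / pi * (exp (- R / 2) / sqrt (1 - exp (- R)) * (R + 2 * ln 2))
      + 4 / pi * ((r - R) / sqrt (gap r - gap R))"
      unfolding pos_divide_le_eq[OF area] .
  qed
  then have "part \<le> (r + 1) * exp (- r / 2) * area"
    unfolding pos_divide_le_eq[OF area] .
  then have "ennreal part \<le> ennreal ((r + 1) * exp (- r / 2) * area)" by (rule ennreal_leI)
  then show ?thesis
    using emeasure_part r area unfolding FE emeasure_F by (simp add: ennreal_mult)
qed simp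

theorem theorem1p3:
  fixes r :: real and \<Gamma> :: "(real^2^2) set set" and I :: "complex set"
  assumes "r > 0"
    and "finite_covolume_fuchsian \<Gamma>"
    and "I \<in> sets hyp_area"
    and "distance_avoiding r I"
    and "invariant_set \<Gamma> I"
  shows "quotient_area \<Gamma> I \<le> ennreal ((r + 1) * exp (- r / 2)) * quotient_area \<Gamma> upper_half_plane"
proof -
  interpret group PSL2R by (rule group_PSL2R)
  define F where "F = (SOME F. fundamental_region \<Gamma> F)"
  have \<Gamma>: "subgroup \<Gamma> PSL2R" using assms(2) by (simp add: finite_covolume_fuchsian_def fuchsian_def)
  have "\<exists>F. fundamental_region \<Gamma> F" using assms(2) by (auto simp: finite_covolume_fuchsian_def)
  then have "fundamental_region \<Gamma> F" unfolding F_def by (rule someI_ex)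
  then obtain F0 where FF: "open F0 \<and> F0 \<noteq> {} \<and> F0 \<subseteq> upper_half_plane \<and>
      F = closure F0 \<inter> upper_half_plane \<and> F - F0 \<in> null_sets hyp_area \<and>
      (\<Union>\<gamma>\<in>\<Gamma>. psl_act \<gamma> ` F) = upper_half_plane \<and>
      (\<forall>\<gamma>\<in>\<Gamma>. \<gamma> \<noteq> \<one>\<^bsub>PSL2R\<^esub> \<longrightarrow> F0 \<inter> psl_act \<gamma> ` F0 = {})"
    unfolding fundamental_region_def by (rule exE)
  have F0: "open F0" "F0 \<noteq> {}" "F0 \<subseteq> upper_half_plane"
    and region: "F = closure F0 \<inter> upper_half_plane" "F - F0 \<in> null_sets hyp_area"
    and cover: "(\<Union>\<gamma>\<in>\<Gamma>. psl_act \<gamma> ` F) = upper_half_plane"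
    using FF by - (elim conjE, assumption)+
  have disj: "F0 \<inter> psl_act \<gamma> ` F0 = {}" if "\<gamma> \<in> \<Gamma>" "\<gamma> \<noteq> \<one>\<^bsub>PSL2R\<^esub>" for \<gamma>
    using FF that by simp
  have F0F: "F0 \<subseteq> F" using F0(3) region(1) closure_subset by blast
  have IU: "I \<subseteq> upper_half_plane" using assms(3) sets_hyp_area_iff by blast
  have FU: "upper_half_plane \<inter> F = F" using region(1) by blast
  have Fs: "F \<in> sets hyp_area" "F0 \<in> sets hyp_area"
    using F0 region(1) by (auto simp: sets_hyp_area_iff)
  have QI: "quotient_area \<Gamma> I = emeasure hyp_area (I \<inter> F)" and QH: "quotient_area \<Gamma> upper_half_plane = emeasure hyp_area F"
    by (simp_all add: quotient_area_def F_def[symmetric] FU)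
  define m where "m = (r + 1) * exp (- r / 2)"
  have m0: "0 < m" using assms(1) by (simp add: m_def)
  have "emeasure hyp_area (I \<inter> F) \<le> ennreal m * emeasure hyp_area F"
  proof (cases "emeasure hyp_area F = \<infinity> \<or> r < 2")
    case True
    have mono: "emeasure hyp_area (I \<inter> F) \<le> emeasure hyp_area F" using Fs by (intro emeasure_mono) auto
    show ?thesis
    proof (cases "emeasure hyp_area F = \<infinity>")
      case True
      then show ?thesis using m0 by (simp add: ennreal_mult_top)
    next
      case False
      then have r2: "r < 2" using True by simp
      have "exp (r / 2) \<le> 1 + r / 2 + (r / 2)\<^sup>2" using assms(1) r2 by (intro exp_bound) auto
      also have "\<dots> \<le> 1 + r"
      proof -
        have "r * r \<le> 2 * r" using assms(1) r2 by (intro mult_right_mono) auto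
        then show ?thesis by (simp add: power2_eq_square)
      qed
      finally have "1 \<le> m" by (simp add: m_def exp_minus field_simps)
      then have "1 * emeasure hyp_area F \<le> ennreal m * emeasure hyp_area F"
        by (intro mult_right_mono) auto
      then show ?thesis using mono by simp
    qed
  next
    case False
    then have fin: "emeasure hyp_area F < \<infinity>" and r: "2 \<le> r" by (auto simp: less_top)
    have tiling: "tiling \<Gamma> psl_act (\<lambda>\<gamma>. inv\<^bsub>PSL2R\<^esub> \<gamma>) F0"
      by (rule fundamental_region_tiling[OF \<Gamma> F0 region cover disj])
    interpret tiling \<Gamma> psl_act "\<lambda>\<gamma>. inv\<^bsub>PSL2R\<^esub> \<gamma>" F0 by (rule tiling)
    have carr: "\<gamma> \<in> carrier PSL2R" if "\<gamma> \<in> \<Gamma>" for \<gamma> using \<Gamma> that subgroup.subset by blast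
    have nuF0: "emeasure nu F0 = emeasure hyp_area F0"
      using F0 by (subst emeasure_hyp_area_borel) auto
    have "emeasure hyp_area F0 \<le> emeasure hyp_area F" using Fs F0F by (intro emeasure_mono)
    then have finF0: "emeasure nu F0 < \<infinity>" using fin nuF0 by simp
    \<comment> \<open>Off the null set \<open>N\<close> the orbit of a point of \<open>I\<close> stays in \<open>I\<close>, so that orbits avoid the distance \<open>r\<close> exactly.\<close>
    define N where "N = (\<Union>\<gamma>\<in>\<Gamma>. sym_diff I (psl_act \<gamma> ` I))"
    have N: "N \<in> null_sets hyp_area"
      unfolding N_def using assms(5) countable_G by (intro null_sets_UN') (auto simp: invariant_set_def)
    define D where "D = I \<inter> F0 - N"
    have D: "D \<in> sets hyp_area" unfolding D_def using assms(3) Fs N by auto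
    have Z: "(F - F0) \<union> N \<in> null_sets hyp_area" by (rule null_sets.Un[OF region(2) N])
    have "emeasure hyp_area (I \<inter> F) \<le> emeasure hyp_area (D \<union> ((F - F0) \<union> N))"
      by (rule emeasure_mono[OF _ sets.Un[OF D null_setsD2[OF Z]]]) (auto simp: D_def)
    also have "\<dots> = emeasure hyp_area D"
      by (rule emeasure_Un_null_set[OF D Z])
    finally have ID: "emeasure hyp_area (I \<inter> F) \<le> emeasure hyp_area D" .
    obtain S where S: "S \<in> sets borel" "S \<subseteq> D" "emeasure nu S = emeasure hyp_area D"
      by (rule hyp_area_borel_kernel[OF D]) (rule that)
    define P where "P = density nu (indicator F0)"
    have P: "emeasure P A = emeasure nu (F0 \<inter> A)" if [measurable]: "A \<in> sets borel" for A
      unfolding P_def by (simp add: emeasure_density indicator_inter_arith[symmetric])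
    have "emeasure P S = (SUP K \<in> {K. K \<subseteq> S \<and> compact K}. emeasure P K)"
    proof (rule inner_regular)
      show "sets P = sets borel" by (simp add: P_def)
      show "emeasure P (space P) \<noteq> \<infinity>" using finF0 P[of UNIV] by (simp add: P_def)
    qed (rule S(1))
    also have "\<dots> \<le> ennreal m * emeasure nu F0"
    proof (rule SUP_least)
      fix K assume "K \<in> {K. K \<subseteq> S \<and> compact K}"
      then have K: "K \<subseteq> S" "compact K" by auto
      then have KF: "K \<subseteq> F0" using S(2) by (auto simp: D_def)
      have "K \<in> sets borel" by (rule borel_closed[OF compact_imp_closed[OF K(2)]])
      then have "emeasure P K = emeasure nu K" using P KF by (simp add: Int_absorb1)
      also have "\<dots> \<le> ennreal ((r + 1) * exp (- r / 2)) * emeasure nu F0"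
      proof (rule compact_piece_bound[OF \<Gamma> tiling finF0 K(2) KF _ r])
        fix \<gamma> z w assume g: "\<gamma> \<in> \<Gamma>" and z: "z \<in> K" and w: "w \<in> K"
        have zI: "z \<in> I" and wI: "w \<in> I" "w \<notin> N" using z w K(1) S(2) by (auto simp: D_def)
        let ?\<delta> = "inv\<^bsub>PSL2R\<^esub> \<gamma>"
        have d: "?\<delta> \<in> \<Gamma>" using \<Gamma> g by (simp add: subgroup.m_inv_closed)
        then have "w \<in> psl_act ?\<delta> ` I" using wI by (auto simp: N_def)
        then obtain y where y: "y \<in> I" "w = psl_act ?\<delta> y" by blast
        have "psl_act \<gamma> w = y"
          using psl_act_inv[of ?\<delta> y] carr[OF g] carr[OF d] y IU by (auto simp: upper_half_plane_def)
        then have "psl_act \<gamma> w \<in> I" using y by simp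
        then have "hyp_dist z (psl_act \<gamma> w) \<noteq> r" using assms(4) zI by (auto simp: distance_avoiding_def)
        moreover have "0 < Im z" "0 < Im (psl_act \<gamma> w)" using zI \<open>psl_act \<gamma> w \<in> I\<close> IU by (auto simp: upper_half_plane_def)
        ultimately show "hyp_gap z (psl_act \<gamma> w) \<noteq> gap r"
          using hyp_dist_eq assms(1) by fastforce
      qed
      finally show "emeasure P K \<le> ennreal m * emeasure nu F0" unfolding m_def .
    qed
    finally have "emeasure P S \<le> ennreal m * emeasure nu F0" .
    moreover have "emeasure P S = emeasure nu S"
    proof -
      have "F0 \<inter> S = S" using S(2) by (auto simp: D_def)
      then show ?thesis using P[OF S(1)] by simp
    qed
    ultimately have "emeasure hyp_area D \<le> ennreal m * emeasure hyp_area F0" using S(3) nuF0 by simp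
    also have "\<dots> \<le> ennreal m * emeasure hyp_area F"
      using Fs F0F by (intro mult_left_mono emeasure_mono) auto
    finally show ?thesis using ID by simp
  qed
  then show ?thesis unfolding QI QH m_def .
qed

end
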